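(* Assume that, for some $\alpha\in(0,1)$: $c_T\in C^{(1+\alpha/2)}([0,T_{max}])$ and $c_T\ge0$ for every $T\in[0,T_{max}]$; the map $T\in[0,T_{max}]\mapsto c_T\in C^{(1+\alpha/2)}([0,T_{max}])$ is continuous; $m_0\in C^{(2+\alpha)}(\Gamma)$ with $m_0(v_0)=0$; and $$\partial_xm_0(v_0)=\partial_x^2m_0(v_0)=0 .$$ Then the map $\Psi:[t_0,T_{max}]\to[t_0,T_{max}]$ defined in the context admits a fixed point.
   Context: Network. $\Gamma\subset\mathbb R^n$ is a network: a finite set of vertices $V=\{v_i\}_{i\in I}$ connected by finitely many continuous, non self-intersecting arcs (edges) $E=\{e_j\}_{j\in J}$, each parametrized by a smooth $\pi_j:[0,l_j]\to\mathbb R^n$, $l_j>0$. $Inc_i=\{j\in J: e_j \text{ is incident to } v_i\}$, $I_B=\{i:\#Inc_i=1\}$, $I_T=I\setminus I_B$, $\partial\Gamma=\{v_i: i\in I_B\}$, $\Gamma_T=\{v_i:i\in I_T\}$. It is assumed that $\partial\Gamma=\{v_0\}$ is a single boundary vertex. $a_{ij}=1$ if $v_i\in e_j$ and $\pi_j(0)=v_i$, $a_{ij}=-1$ if $v_i\in e_j$ and $\pi_j(l_j)=v_i$, $a_{ij}=0$ otherwise. A point $x\in e_j$ is identified with $y=\pi_j^{-1}(x)\in[0,l_j]$; for $u:\Gamma\to\mathbb R$, $u_j(y)=u(\pi_j(y))$; $\partial_x^\gamma u$ (inside $e_j$) and $\partial_j^\gamma u(v_i)$ (at a vertex, $j\in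 Inc_i$) denote $\frac{d^\gamma u_j}{dy^\gamma}$ at the corresponding $y$. The unique edge $e_0$ incident to $v_0$ is parametrized so that $\pi_0(0)=v_0$; derivatives $\partial_x$ at $v_0$ are taken along $e_0$. $C^{(q+\alpha)}([a,b])$ is the usual Hölder space and $C^{(q+\alpha)}(\Gamma)=\{u\in C(\Gamma): u_j\in C^{(q+\alpha)}([0,l_j])\ \forall j\in J\}$. Data. $0<t_0<T_{max}$; $\theta\in(0,1)$; $m_0:\Gamma\to\mathbb R$ is the initial distribution (a probability density on $\Gamma$: $m_0\ge0$, $\int_\Gamma m_0=1$). The cost is $c_T(s)=c_1(s-t_0)+c_2(s-T)+c_3(T-s)$, $s\in[0,T_{max}]$, where $c_i:\mathbb R\to\mathbb R$ are smooth with $c_i(s)=0$ for $s\le0$ and $c_i(s)>0$ for $s>0$. The map $\Psi$. Given $T$, let $(\phi,\psi)$, $\phi>0$, be the classical solution (continuous on $\Gamma\times[0,T_{max}]$, $C^{2,1}$ on each edge up to its endpoints for times in $(0,T_{max})$; it exists and is unique under the stated hypotheses on $c_T,m_0$) of: $-\partial_t\phi-\partial_x^2\phi=0$ and $\partial_t\psi-\partial_x^2\psi=0$ in $\Gamma\times(0,T_{max})$; $\sum_{j\in Inc_i}a_{ij}\partial_j\phi(v_i,s)=0$ and $\sum_{j\in Inc_i}a_{ij}\partial_j\psi(v_i,s)=0$ for $(v_i,s)\in\Gamma_T\times(0,T_{max})$; $\psi(x,0)=m_0(x)/\phi(x,0)$ and $\phi(x,T_{max})=e^{c_T(T_{max})}$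 for $x\in\Gamma$; $\psi(v_0,s)=0$ and $\phi(v_0,s)=e^{c_T(s)}$ for $s\in[0,T_{max}]$. Set $F(s)=\int_0^se^{c_T(r)}\,\partial_x\psi(v_0,r)\,dr$ and define $\Psi(T)=T^*$ by the quorum rule: $T^*=t_0$ if $F^{-1}(\theta)\le t_0$; $T^*=F^{-1}(\theta)$ if $t_0<F^{-1}(\theta)<T_{max}$; $T^*=T_{max}$ if $F^{-1}(\theta)\ge T_{max}$. Here $F^{-1}(\theta)=\inf\{s\in[0,T_{max}]:F(s)\ge\theta\}$, with the convention $F^{-1}(\theta)=+\infty$ if $F$ does not reach $\theta$ on $[0,T_{max}]$. *)

theory Defs
  imports "HOL-Analysis.Analysis"
begin

section \<open>Derivatives relative to a set, smoothness, Hoelder spaces\<close>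

text \<open>
  All derivatives are taken within the domain \<open>S\<close>, so on a compact interval they are one-sided
  at the endpoints and only depend on the values of the function on the interval.
\<close>

primrec nderiv :: "real set \<Rightarrow> nat \<Rightarrow> (real \<Rightarrow> 'a::real_normed_vector) \<Rightarrow> real \<Rightarrow> 'a" where
  "nderiv S 0 f = f"
| "nderiv S (Suc k) f = (\<lambda>y. vector_derivative (nderiv S k f) (at y within S))"

definition smooth_on :: "real set \<Rightarrow> (real \<Rightarrow> 'a::real_normed_vector) \<Rightarrow> bool" where
  "smooth_on S f \<longleftrightarrow> (\<forall>k. \<forall>y\<in>S. nderiv S k f differentiable (at y within S))"

text \<open>
  The space \<open>C\<^bsup>(q+\<beta>)\<^esup>([a,b])\<close> with \<open>0 < \<beta> < 1\<close>, and its norm. Continuity of the derivatives of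
  order at most \<open>q\<close> follows from differentiability (order below \<open>q\<close>) and from the Hoelder bound
  (order \<open>q\<close>).
\<close>

definition hoelder_on :: "nat \<Rightarrow> real \<Rightarrow> real \<Rightarrow> real \<Rightarrow> (real \<Rightarrow> real) \<Rightarrow> bool" where
  "hoelder_on q \<beta> a b f \<longleftrightarrow>
     (\<forall>k<q. \<forall>y\<in>{a..b}. nderiv {a..b} k f differentiable (at y within {a..b})) \<and>
     (\<exists>C. \<forall>x\<in>{a..b}. \<forall>y\<in>{a..b}.
        \<bar>nderiv {a..b} q f x - nderiv {a..b} q f y\<bar> \<le> C * \<bar>x - y\<bar> powr \<beta>)"

definition hoelder_norm :: "nat \<Rightarrow> real \<Rightarrow> real \<Rightarrow> real \<Rightarrow> (real \<Rightarrow> real) \<Rightarrow> real" where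
  "hoelder_norm q \<beta> a b f =
     (\<Sum>k\<le>q. SUP x\<in>{a..b}. \<bar>nderiv {a..b} k f x\<bar>) +
     (SUP p\<in>{p \<in> {a..b} \<times> {a..b}. fst p \<noteq> snd p}.
        \<bar>nderiv {a..b} q f (fst p) - nderiv {a..b} q f (snd p)\<bar> / \<bar>fst p - snd p\<bar> powr \<beta>)"

section \<open>Networks\<close>

text \<open>Vertices are identified with points of the ambient space; edges are indexed by \<open>'j\<close>.\<close>

record ('a, 'j) network =
  verts :: "'a set"
  edges :: "'j set"
  len :: "'j \<Rightarrow> real"
  param :: "'j \<Rightarrow> real \<Rightarrow> 'a"

definition arc_of :: "('a, 'j) network \<Rightarrow> 'j \<Rightarrow> 'a set" where
  "arc_of N j = param N j ` {0..len N j}"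

definition points :: "('a, 'j) network \<Rightarrow> 'a set" where
  "points N = (\<Union>j\<in>edges N. arc_of N j)"

definition Inc :: "('a, 'j) network \<Rightarrow> 'a \<Rightarrow> 'j set" where
  "Inc N v = {j \<in> edges N. v \<in> arc_of N j}"

definition is_network :: "('a::euclidean_space, 'j) network \<Rightarrow> bool" where
  "is_network N \<longleftrightarrow>
     finite (verts N) \<and> finite (edges N) \<and>
     (\<forall>j\<in>edges N. len N j > 0 \<and> smooth_on {0..len N j} (param N j) \<and>
        inj_on (param N j) {0..len N j} \<and>
        param N j 0 \<in> verts N \<and> param N j (len N j) \<in> verts N \<and>
        param N j ` {0<..<len N j} \<inter> verts N = {}) \<and>
     (\<forall>j\<in>edges N. \<forall>k\<in>edges N. j \<noteq> k \<longrightarrow> arc_of N j \<inter> arc_of N k \<subseteq> verts N) \<and>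
     (\<forall>v\<in>verts N. Inc N v \<noteq> {})"

definition boundary_verts :: "('a, 'j) network \<Rightarrow> 'a set" where
  "boundary_verts N = {v \<in> verts N. card (Inc N v) = 1}"

definition transition_verts :: "('a, 'j) network \<Rightarrow> 'a set" where
  "transition_verts N = verts N - boundary_verts N"

definition incidence :: "('a, 'j) network \<Rightarrow> 'a \<Rightarrow> 'j \<Rightarrow> real" where
  "incidence N v j =
     (if v \<in> arc_of N j \<and> param N j 0 = v then 1
      else if v \<in> arc_of N j \<and> param N j (len N j) = v then -1 else 0)"

definition edge_coord :: "('a, 'j) network \<Rightarrow> 'j \<Rightarrow> 'a \<Rightarrow> real" where
  "edge_coord N j x = the_inv_into {0..len N j} (param N j) x"

text \<open>
  \<open>edge_deriv N j g u y\<close> is the derivative of order \<open>g\<close> of \<open>u\<^sub>j = u \<circ> \<pi>\<^sub>j\<close> at the parameter \<open>y\<close>;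
  \<open>vertex_deriv N j g u v\<close> is the same derivative at a point \<open>v\<close> of the edge \<open>j\<close>.
\<close>

definition edge_deriv :: "('a, 'j) network \<Rightarrow> 'j \<Rightarrow> nat \<Rightarrow> ('a \<Rightarrow> real) \<Rightarrow> real \<Rightarrow> real" where
  "edge_deriv N j g u y = nderiv {0..len N j} g (\<lambda>z. u (param N j z)) y"

definition vertex_deriv :: "('a, 'j) network \<Rightarrow> 'j \<Rightarrow> nat \<Rightarrow> ('a \<Rightarrow> real) \<Rightarrow> 'a \<Rightarrow> real" where
  "vertex_deriv N j g u v = edge_deriv N j g u (edge_coord N j v)"

definition network_integral :: "('a, 'j) network \<Rightarrow> ('a \<Rightarrow> real) \<Rightarrow> real" where
  "network_integral N u = (\<Sum>j\<in>edges N. integral {0..len N j} (\<lambda>y. u (param N j y)))"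

definition hoelder_network ::
    "nat \<Rightarrow> real \<Rightarrow> ('a::euclidean_space, 'j) network \<Rightarrow> ('a \<Rightarrow> real) \<Rightarrow> bool" where
  "hoelder_network q \<beta> N u \<longleftrightarrow>
     continuous_on (points N) u \<and>
     (\<forall>j\<in>edges N. hoelder_on q \<beta> 0 (len N j) (\<lambda>y. u (param N j y)))"

section \<open>The parabolic system and the map \<open>\<Psi>\<close>\<close>

text \<open>Functions on \<open>\<Gamma> \<times> [0,T\<^sub>m\<^sub>a\<^sub>x]\<close> are curried, with the space variable first.\<close>

definition C21_edges :: "('a, 'j) network \<Rightarrow> real \<Rightarrow> ('a \<Rightarrow> real \<Rightarrow> real) \<Rightarrow> bool" where
  "C21_edges N Tmax u \<longleftrightarrow> (\<forall>j\<in>edges N.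
     (\<forall>y\<in>{0..len N j}. \<forall>t\<in>{0<..<Tmax}.
        (\<lambda>s. u (param N j y) s) differentiable (at t) \<and>
        (\<forall>k<2. (\<lambda>z. edge_deriv N j k (\<lambda>x. u x t) z) differentiable (at y within {0..len N j}))) \<and>
     continuous_on ({0..len N j} \<times> {0<..<Tmax}) (\<lambda>(y, t). deriv (\<lambda>s. u (param N j y) s) t) \<and>
     (\<forall>k\<le>2. continuous_on ({0..len N j} \<times> {0<..<Tmax}) (\<lambda>(y, t). edge_deriv N j k (\<lambda>x. u x t) y)))"

definition kirchhoff :: "('a, 'j) network \<Rightarrow> real \<Rightarrow> ('a \<Rightarrow> real \<Rightarrow> real) \<Rightarrow> bool" where
  "kirchhoff N Tmax u \<longleftrightarrow> (\<forall>v\<in>transition_verts N. \<forall>s\<in>{0<..<Tmax}.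
     (\<Sum>j\<in>Inc N v. incidence N v j * vertex_deriv N j 1 (\<lambda>x. u x s) v) = 0)"

definition classical_solution ::
    "('a::euclidean_space, 'j) network \<Rightarrow> 'a \<Rightarrow> real \<Rightarrow> (real \<Rightarrow> real) \<Rightarrow> ('a \<Rightarrow> real) \<Rightarrow>
     ('a \<Rightarrow> real \<Rightarrow> real) \<Rightarrow> ('a \<Rightarrow> real \<Rightarrow> real) \<Rightarrow> bool" where
  "classical_solution N v0 Tmax c m0 \<phi> \<psi> \<longleftrightarrow>
     continuous_on (points N \<times> {0..Tmax}) (\<lambda>(x, t). \<phi> x t) \<and>
     continuous_on (points N \<times> {0..Tmax}) (\<lambda>(x, t). \<psi> x t) \<and>
     C21_edges N Tmax \<phi> \<and> C21_edges N Tmax \<psi> \<and>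
     (\<forall>x\<in>points N. \<forall>t\<in>{0..Tmax}. \<phi> x t > 0) \<and>
     (\<forall>j\<in>edges N. \<forall>y\<in>{0<..<len N j}. \<forall>t\<in>{0<..<Tmax}.
        - deriv (\<lambda>s. \<phi> (param N j y) s) t - edge_deriv N j 2 (\<lambda>x. \<phi> x t) y = 0 \<and>
        deriv (\<lambda>s. \<psi> (param N j y) s) t - edge_deriv N j 2 (\<lambda>x. \<psi> x t) y = 0) \<and>
     kirchhoff N Tmax \<phi> \<and> kirchhoff N Tmax \<psi> \<and>
     (\<forall>x\<in>points N. \<psi> x 0 = m0 x / \<phi> x 0 \<and> \<phi> x Tmax = exp (c Tmax)) \<and>
     (\<forall>s\<in>{0..Tmax}. \<psi> v0 s = 0 \<and> \<phi> v0 s = exp (c s))"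

definition cost ::
    "(real \<Rightarrow> real) \<Rightarrow> (real \<Rightarrow> real) \<Rightarrow> (real \<Rightarrow> real) \<Rightarrow> real \<Rightarrow> real \<Rightarrow> real \<Rightarrow> real" where
  "cost c1 c2 c3 t0 T s = c1 (s - t0) + c2 (s - T) + c3 (T - s)"

definition exit_mass ::
    "('a, 'j) network \<Rightarrow> 'a \<Rightarrow> 'j \<Rightarrow> (real \<Rightarrow> real) \<Rightarrow> ('a \<Rightarrow> real \<Rightarrow> real) \<Rightarrow> real \<Rightarrow> real" where
  "exit_mass N v0 e0 c \<psi> s =
     integral {0..s} (\<lambda>r. exp (c r) * vertex_deriv N e0 1 (\<lambda>x. \<psi> x r) v0)"

text \<open>Extended reals implement the convention that the infimum of the empty set is \<open>+\<infinity>\<close>.\<close>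

definition gen_inverse :: "real \<Rightarrow> (real \<Rightarrow> real) \<Rightarrow> real \<Rightarrow> ereal" where
  "gen_inverse Tmax F \<theta> = Inf (ereal ` {s \<in> {0..Tmax}. F s \<ge> \<theta>})"

definition quorum :: "real \<Rightarrow> real \<Rightarrow> real \<Rightarrow> (real \<Rightarrow> real) \<Rightarrow> real" where
  "quorum t0 Tmax \<theta> F =
     (let S = gen_inverse Tmax F \<theta> in
      if S \<le> ereal t0 then t0
      else if S < ereal Tmax then real_of_ereal S
      else Tmax)"

text \<open>
  The solution is unique on \<open>\<Gamma> \<times> [0,T\<^sub>m\<^sub>a\<^sub>x]\<close> only, while HOL functions are total; hence
  \<open>SOME\<close> rather than \<open>THE\<close>. The value of \<open>\<Psi>\<close> depends only on the restriction of \<open>\<psi>\<close> to that set.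
\<close>

definition Psi ::
    "('a::euclidean_space, 'j) network \<Rightarrow> 'a \<Rightarrow> 'j \<Rightarrow> real \<Rightarrow> real \<Rightarrow> real \<Rightarrow>
     (real \<Rightarrow> real) \<Rightarrow> (real \<Rightarrow> real) \<Rightarrow> (real \<Rightarrow> real) \<Rightarrow> ('a \<Rightarrow> real) \<Rightarrow> real \<Rightarrow> real" where
  "Psi N v0 e0 t0 Tmax \<theta> c1 c2 c3 m0 T =
     (let c = cost c1 c2 c3 t0 T;
          sol = (SOME p. classical_solution N v0 Tmax c m0 (fst p) (snd p))
      in quorum t0 Tmax \<theta> (exit_mass N v0 e0 c (snd sol)))"

lemma quorum_in_interval:
  assumes "t0 < Tmax"
  shows "quorum t0 Tmax \<theta> F \<in> {t0..Tmax}"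
proof (cases "gen_inverse Tmax F \<theta>")
  case (real r)
  then show ?thesis using assms by (auto simp: quorum_def Let_def)
qed (use assms in \<open>auto simp: quorum_def Let_def\<close>)

lemma Psi_in_interval:
  "t0 < Tmax \<Longrightarrow> Psi N v0 e0 t0 Tmax \<theta> c1 c2 c3 m0 T \<in> {t0..Tmax}"
  unfolding Psi_def Let_def by (rule quorum_in_interval)

end

theory Submission
  imports Defs "HOL-Probability.Distributions"
begin

text \<open>
  Write \<open>F\<^sub>T\<close> for the exit mass belonging to the cost \<open>c\<^sub>T\<close>. The product \<open>\<phi> \<psi>\<close> is the density of the
  agents that are still in the network: \<open>\<phi>\<close> solves the backward and \<open>\<psi>\<close> the forward heat equation, so
  after an integration by parts in space, in which the Kirchhoff conditions cancel all contributions
  of the transition vertices, \<open>\<integral> \<phi> \<psi>\<close> decreases at the rate \<open>e\<^bsup>c\<^esup> \<partial>\<psi>(v\<^sub>0)\<close>. Therefore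
  \<open>F\<^sub>T(s) = \<integral> m\<^sub>0 - \<integral> \<phi>(s) \<psi>(s)\<close> (\<open>exit_mass_eq\<close>). This identity removes all derivatives: it shows that
  \<open>F\<^sub>T\<close> is continuous up to the end times, and that it depends on \<open>T\<close> only through the sup norm of the
  solutions, whose change the maximum principle (\<open>network_heat_nonneg\<close>) bounds by the sup norm of the
  change of \<open>e\<^bsup>c\<^esup>\<close> (\<open>exit_mass_stability\<close>). So \<open>T \<mapsto> F\<^sub>T(T)\<close> is continuous.

  If \<open>F\<^sub>T(T) \<ge> \<theta>\<close> at \<open>T = t\<^sub>0\<close>, then \<open>t\<^sub>0\<close> is a fixed point; if \<open>F\<^sub>T(T) < \<theta>\<close> at \<open>T = T\<^sub>m\<^sub>a\<^sub>x\<close>, then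
  \<open>T\<^sub>m\<^sub>a\<^sub>x\<close> is one. Otherwise the intermediate value theorem gives \<open>T\<close> with \<open>F\<^sub>T(T) = \<theta>\<close>, and such a
  \<open>T\<close> is a fixed point as soon as \<open>F\<^sub>T\<close> stays below \<open>\<theta>\<close> before \<open>T\<close> (\<open>quorum_fixed_point\<close>). Now \<open>F\<^sub>T\<close> is
  nondecreasing because \<open>\<psi> \<ge> 0\<close> vanishes at \<open>v\<^sub>0\<close>. It cannot be constant on an interval while being
  positive: \<open>\<partial>\<psi>(v\<^sub>0, t)\<close> is analytic in \<open>t > 0\<close>, so if it vanishes on an interval, then it vanishes
  always and \<open>F\<^sub>T = 0\<close> (\<open>gmoment_vanish\<close>, \<open>exit_mass_properties\<close>). Analyticity takes the place of a strong
  maximum principle and applies whether or not the network is connected.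

  Since \<open>\<Psi>\<close> chooses a solution, solutions must exist for every \<open>T\<close>, and the analyticity argument needs a
  formula for \<open>\<psi>\<close>. Both come from a method of images on the network. The initial values on each
  edge are extended to the whole line in such a way that the heat flow on the line, applied to
  each extension and restricted to its edge, satisfies the vertex conditions: continuity concerns
  the even parts of the extensions about a vertex and the Kirchhoff condition their odd parts
  (\<open>image_solution\<close>). These two requirements say how the values beyond a vertex are scattered from the
  values on the edges meeting there, and they determine the extensions recursively
  (\<open>image_extension\<close>). Polynomial boundary values are obtained in the same way, and superposing time
  delays of the solution with boundary value \<open>t\<^sup>2/2\<close>, as in Taylor's formula with integral remainder,
  produces the smooth boundary values of \<open>\<phi>\<close> (\<open>boundary_value_solution\<close>).
\<close>

section \<open>Integrals depending on a parameter\<close>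

text \<open>
  In a first countable space limits at a point are detected by sequences, so dominated convergence
  applies to parameters other than natural numbers.
\<close>

lemma dominated_tendsto:
  fixes f :: "'x::first_countable_topology \<Rightarrow> real \<Rightarrow> real"
  assumes w: "integrable lborel w"
    and m: "\<And>x. x \<in> S \<Longrightarrow> f x \<in> borel_measurable lborel"
    and m0: "f0 \<in> borel_measurable lborel"
    and b: "\<And>x z. x \<in> S \<Longrightarrow> \<bar>f x z\<bar> \<le> w z"
    and l: "\<And>z. ((\<lambda>x. f x z) \<longlongrightarrow> f0 z) (at x0 within S)"
  shows "((\<lambda>x. LINT z|lborel. f x z) \<longlongrightarrow> (LINT z|lborel. f0 z)) (at x0 within S)"
  unfolding tendsto_at_iff_sequentially comp_def
proof (intro allI impI)
  fix X assume X: "\<forall>i::nat. X i \<in> S - {x0}" "X \<longlonglongrightarrow> x0"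
  show "(\<lambda>i. LINT z|lborel. f (X i) z) \<longlonglongrightarrow> (LINT z|lborel. f0 z)"
  proof (rule integral_dominated_convergence[where w=w])
    show "AE z in lborel. (\<lambda>i. f (X i) z) \<longlonglongrightarrow> f0 z"
      using l X unfolding tendsto_at_iff_sequentially comp_def by auto
  qed (use m m0 w b X in auto)
qed

text \<open>
  The bound on the derivative passes to the difference quotients by the mean value theorem.
\<close>

lemma dominated_derivative:
  fixes f f' :: "real \<Rightarrow> real \<Rightarrow> real"
  assumes r: "0 < r"
    and w: "integrable lborel w"
    and i: "\<And>x. x \<in> ball x0 r \<Longrightarrow> integrable lborel (f x)"
    and m0: "f' x0 \<in> borel_measurable lborel"
    and d: "\<And>x z. x \<in> ball x0 r \<Longrightarrow> ((\<lambda>x. f x z) has_real_derivative f' x z) (at x)"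
    and b: "\<And>x z. x \<in> ball x0 r \<Longrightarrow> \<bar>f' x z\<bar> \<le> w z"
  shows "((\<lambda>x. LINT z|lborel. f x z) has_real_derivative (LINT z|lborel. f' x0 z)) (at x0)"
proof -
  have x0: "x0 \<in> ball x0 r" using r by simp
  let ?q = "\<lambda>x z. (f x z - f x0 z) / (x - x0)"
  have bq: "\<bar>?q x z\<bar> \<le> w z" if "x \<in> ball x0 r - {x0}" for x z
  proof -
    have "norm (f x z - f x0 z) \<le> w z * norm (x - x0)"
    proof (rule field_differentiable_bound[of "ball x0 r"])
      fix t assume "t \<in> ball x0 r"
      then show "((\<lambda>x. f x z) has_real_derivative f' t z) (at t within ball x0 r)" "norm (f' t z) \<le> w z"
        using d[of t z] b[of t z] by (auto intro: DERIV_subset)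
    qed (use that x0 in auto)
    then show ?thesis using that by (simp add: field_simps)
  qed
  have "((\<lambda>x. LINT z|lborel. ?q x z) \<longlongrightarrow> (LINT z|lborel. f' x0 z)) (at x0 within ball x0 r - {x0})"
  proof (rule dominated_tendsto[OF w _ m0 bq])
    fix x assume "x \<in> ball x0 r - {x0}"
    then have [measurable]: "f x \<in> borel_measurable lborel" "f x0 \<in> borel_measurable lborel"
      using i x0 by auto
    show "?q x \<in> borel_measurable lborel" by measurable
  next
    fix z
    have "((\<lambda>x. f x z) has_real_derivative f' x0 z) (at x0)" using d x0 by blast
    then show "((\<lambda>x. ?q x z) \<longlongrightarrow> f' x0 z) (at x0 within ball x0 r - {x0})"
      unfolding has_field_derivative_iff by (rule tendsto_mono[rotated]) (rule at_le, simp)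
  qed
  then have "((\<lambda>x. LINT z|lborel. ?q x z) \<longlongrightarrow> (LINT z|lborel. f' x0 z)) (at x0)"
    using at_within_open[OF x0] by (metis (no_types, lifting) at_within_def open_ball Diff_idemp)
  moreover have "eventually (\<lambda>x. (LINT z|lborel. ?q x z) =
      ((LINT z|lborel. f x z) - (LINT z|lborel. f x0 z)) / (x - x0)) (at x0)"
    unfolding eventually_at
  proof (intro exI conjI ballI impI)
    fix x assume "x \<noteq> x0 \<and> dist x x0 < r"
    then have "x \<in> ball x0 r" by (simp add: dist_commute)
    then show "(LINT z|lborel. ?q x z) = ((LINT z|lborel. f x z) - (LINT z|lborel. f x0 z)) / (x - x0)"
      using i x0 by simp
  qed (use r in auto)
  ultimately show ?thesis
    unfolding has_field_derivative_iff by (rule Lim_transform_eventually)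
qed

section \<open>Gaussian integrals of functions of exponential growth\<close>

text \<open>
  The class of initial functions for the heat flow on the line. Exponential growth is what
  extensions by images have: each passage of a vertex multiplies the bound by a constant.
\<close>

definition tame :: "(real \<Rightarrow> real) \<Rightarrow> bool" where
  "tame F \<longleftrightarrow> continuous_on UNIV F \<and> (\<exists>A k. \<forall>z. \<bar>F z\<bar> \<le> A * exp (k * \<bar>z\<bar>))"

lemma tame_bound:
  assumes "tame F"
  obtains A k where "0 \<le> A" "0 \<le> k" "\<And>z. \<bar>F z\<bar> \<le> A * exp (k * \<bar>z\<bar>)"
proof -
  obtain A k where b: "\<And>z. \<bar>F z\<bar> \<le> A * exp (k * \<bar>z\<bar>)" using assms unfolding tame_def by blast
  have A: "0 \<le> A" using b[of 0] by simp
  have "\<bar>F z\<bar> \<le> A * exp (max k 0 * \<bar>z\<bar>)" for z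
  proof -
    have "exp (k * \<bar>z\<bar>) \<le> exp (max k 0 * \<bar>z\<bar>)" by (simp add: mult_right_mono)
    then show ?thesis using b[of z] A by (meson mult_left_mono order_trans)
  qed
  then show ?thesis using that[of A "max k 0"] A by simp
qed

lemma tame_measurable: "tame F \<Longrightarrow> F \<in> borel_measurable borel"
  unfolding tame_def by (intro borel_measurable_continuous_onI) blast

lemma tame_isCont: "tame F \<Longrightarrow> isCont F x"
  unfolding tame_def by (simp add: continuous_on_eq_continuous_at)

text \<open>
  Half of the Gaussian absorbs the exponential, since \<open>k \<bar>z\<bar> \<le> k\<^sup>2/(2a) + a z\<^sup>2/2\<close>.
\<close>

lemma integrable_exp_gauss:
  fixes a k :: real
  assumes a: "0 < a"
  shows "integrable lborel (\<lambda>z. exp (k * \<bar>z\<bar>) * exp (- a * z\<^sup>2))"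
proof -
  let ?s = "1 / sqrt a"
  have s: "0 < ?s" using a by simp
  have nd: "normal_density 0 ?s z * (sqrt (2 * pi * ?s\<^sup>2)) = exp (- (a/2) * z\<^sup>2)" for z
    using a by (simp add: normal_density_def power_divide field_simps)
  have "integrable lborel (\<lambda>z. normal_density 0 ?s z * (sqrt (2 * pi * ?s\<^sup>2)))"
    using s by (intro integrable_mult_left) auto
  then have "integrable lborel (\<lambda>z. exp (- (a/2) * z\<^sup>2))" unfolding nd .
  then have "integrable lborel (\<lambda>z. exp (k\<^sup>2 / (2*a)) * exp (- (a/2) * z\<^sup>2))" by simp
  then show ?thesis
  proof (rule Bochner_Integration.integrable_bound)
    show "AE z in lborel. norm (exp (k * \<bar>z\<bar>) * exp (- a * z\<^sup>2))
            \<le> norm (exp (k\<^sup>2 / (2*a)) * exp (- (a/2) * z\<^sup>2))"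
    proof (intro AE_I2)
      fix z :: real
      have "0 \<le> (a * \<bar>z\<bar> - k)\<^sup>2" by simp
      then have "2 * a * (k * \<bar>z\<bar>) \<le> k\<^sup>2 + a * (a * z\<^sup>2)"
        by (simp add: power2_eq_square algebra_simps)
      then have "k * \<bar>z\<bar> \<le> k\<^sup>2 / (2*a) + (a/2) * z\<^sup>2"
        using a by (simp add: field_simps)
      then show "norm (exp (k * \<bar>z\<bar>) * exp (- a * z\<^sup>2))
            \<le> norm (exp (k\<^sup>2 / (2*a)) * exp (- (a/2) * z\<^sup>2))"
        by (simp add: exp_add[symmetric])
    qed
  qed simp
qed

lemma power_le_fact_exp: "0 \<le> (x::real) \<Longrightarrow> x ^ m \<le> fact m * exp x"
proof -
  assume x: "0 \<le> x"
  have "(\<Sum>n\<in>{m}. inverse (fact n) * x ^ n) \<le> (\<Sum>n. inverse (fact n) * x ^ n)"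
    by (rule sum_le_suminf) (use x summable_exp[of x] in auto)
  then have "inverse (fact m) * x ^ m \<le> exp x" by (simp add: exp_def field_simps)
  then show ?thesis by (simp add: field_simps)
qed

text \<open>
  With \<open>p = 1/(4t)\<close> these are the integrals that occur in the heat flow and in all its derivatives:
  differentiation in \<open>y\<close> or in \<open>p\<close> only shifts the exponent \<open>m\<close>.
\<close>

definition gmoment :: "nat \<Rightarrow> (real \<Rightarrow> real) \<Rightarrow> real \<Rightarrow> real \<Rightarrow> real" where
  "gmoment m F y p = (LINT z|lborel. (y - z) ^ m * exp (- p * (y - z)\<^sup>2) * F z)"

text \<open>
  One integrable majorant serves for all \<open>y\<close> in a bounded set and all \<open>p \<ge> a\<close>, because
  \<open>(y - z)\<^sup>2 \<ge> z\<^sup>2/2 - y\<^sup>2\<close> and the power is at most \<open>m!\<close> times an exponential.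
\<close>

lemma gmoment_dominated:
  assumes F: "tame F" and a: "0 < a"
  shows "\<exists>w. integrable lborel w \<and>
    (\<forall>y p z. \<bar>y\<bar> \<le> R \<longrightarrow> a \<le> p \<longrightarrow> \<bar>(y - z) ^ m * exp (- p * (y - z)\<^sup>2) * F z\<bar> \<le> w z)"
proof -
  obtain A k where A: "0 \<le> A" "0 \<le> k" "\<And>z. \<bar>F z\<bar> \<le> A * exp (k * \<bar>z\<bar>)"
    using tame_bound[OF F] by blast
  let ?C = "fact m * exp R * exp (a * R\<^sup>2) * A"
  let ?w = "\<lambda>z. ?C * (exp ((k+1) * \<bar>z\<bar>) * exp (- (a/2) * z\<^sup>2))"
  have "integrable lborel ?w" using integrable_exp_gauss[of "a/2" "k+1"] a by simp
  moreover have "\<bar>(y - z) ^ m * exp (- p * (y - z)\<^sup>2) * F z\<bar> \<le> ?w z"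
    if y: "\<bar>y\<bar> \<le> R" and p: "a \<le> p" for y p z
  proof -
    have 1: "\<bar>(y - z) ^ m\<bar> \<le> fact m * exp R * exp \<bar>z\<bar>"
    proof -
      have "\<bar>(y - z) ^ m\<bar> \<le> fact m * exp \<bar>y - z\<bar>"
        using power_le_fact_exp[of "\<bar>y - z\<bar>" m] by (simp add: power_abs)
      also have "\<dots> \<le> fact m * exp (R + \<bar>z\<bar>)" using y by simp
      finally show ?thesis by (simp add: exp_add)
    qed
    have 2: "exp (- p * (y - z)\<^sup>2) \<le> exp (a * R\<^sup>2) * exp (- (a/2) * z\<^sup>2)"
    proof -
      have "0 \<le> (2 * y - z)\<^sup>2" by simp
      then have "z\<^sup>2 / 2 - y\<^sup>2 \<le> (y - z)\<^sup>2" by (simp add: power2_eq_square algebra_simps)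
      moreover have "y\<^sup>2 \<le> R\<^sup>2" using y by (simp add: abs_le_square_iff[symmetric])
      ultimately have "a * (z\<^sup>2 / 2 - R\<^sup>2) \<le> a * (y - z)\<^sup>2" using a by (intro mult_left_mono) auto
      also have "\<dots> \<le> p * (y - z)\<^sup>2" using p by (intro mult_right_mono) auto
      finally show ?thesis by (simp add: exp_add[symmetric] algebra_simps)
    qed
    have "\<bar>(y - z) ^ m * exp (- p * (y - z)\<^sup>2) * F z\<bar>
        = \<bar>(y - z) ^ m\<bar> * exp (- p * (y - z)\<^sup>2) * \<bar>F z\<bar>" by (simp add: abs_mult)
    also have "\<dots> \<le> (fact m * exp R * exp \<bar>z\<bar>) * (exp (a * R\<^sup>2) * exp (- (a/2) * z\<^sup>2)) * (A * exp (k * \<bar>z\<bar>))"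
      by (intro mult_mono 1 2 A) (auto intro!: mult_nonneg_nonneg)
    also have "\<dots> = ?w z" by (simp add: exp_add[symmetric] algebra_simps)
    finally show ?thesis .
  qed
  ultimately show ?thesis by (intro exI[of _ ?w]) auto
qed

lemma gmoment_integrable:
  assumes F: "tame F" and p: "0 < p"
  shows "integrable lborel (\<lambda>z. (y - z) ^ m * exp (- p * (y - z)\<^sup>2) * F z)"
proof -
  note [measurable] = tame_measurable[OF F]
  obtain w where w: "integrable lborel w"
    "\<And>z. \<bar>(y - z) ^ m * exp (- p * (y - z)\<^sup>2) * F z\<bar> \<le> w z"
    using gmoment_dominated[OF F p, of "\<bar>y\<bar>" m] by blast
  show ?thesis
  proof (rule Bochner_Integration.integrable_bound[OF w(1)])
    have "norm ((y - z) ^ m * exp (- p * (y - z)\<^sup>2) * F z) \<le> norm (w z)" for z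
      using w(2)[of z] by simp
    then show "AE z in lborel. norm ((y - z) ^ m * exp (- p * (y - z)\<^sup>2) * F z) \<le> norm (w z)"
      by simp
  qed measurable
qed

lemma gmoment_continuous:
  assumes F: "tame F"
  shows "continuous_on (UNIV \<times> {0<..}) (\<lambda>(y, p). gmoment m F y p)"
proof -
  note [measurable] = tame_measurable[OF F]
  have "isCont (\<lambda>x. gmoment m F (fst x) (snd x)) (y0, p0)" if p0: "0 < p0" for y0 p0
  proof -
    obtain w where w: "integrable lborel w"
      "\<And>y p z. \<bar>y\<bar> \<le> \<bar>y0\<bar> + 1 \<Longrightarrow> p0/2 \<le> p \<Longrightarrow> \<bar>(y - z) ^ m * exp (- p * (y - z)\<^sup>2) * F z\<bar> \<le> w z"
      using gmoment_dominated[OF F, of "p0/2" "\<bar>y0\<bar> + 1" m] p0 by auto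
    let ?S = "{y0-1<..<y0+1} \<times> {p0/2<..}"
    have S: "open ?S" "(y0, p0) \<in> ?S" using p0 by (auto intro: open_Times)
    have "((\<lambda>x. gmoment m F (fst x) (snd x)) \<longlongrightarrow> gmoment m F y0 p0) (at (y0,p0) within ?S)"
      unfolding gmoment_def
    proof (rule dominated_tendsto[OF w(1)])
      fix z
      show "((\<lambda>x. (fst x - z) ^ m * exp (- snd x * (fst x - z)\<^sup>2) * F z) \<longlongrightarrow>
         (y0 - z) ^ m * exp (- p0 * (y0 - z)\<^sup>2) * F z) (at (y0, p0) within ?S)"
        by (intro tendsto_intros tendsto_eq_intros | simp)+
    next
      fix x z assume "x \<in> ?S"
      then show "\<bar>(fst x - z) ^ m * exp (- snd x * (fst x - z)\<^sup>2) * F z\<bar> \<le> w z"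
        by (intro w(2)) auto
    qed auto
    then show ?thesis unfolding continuous_at using at_within_open[OF S(2) S(1)] by simp
  qed
  then show ?thesis
    by (auto simp: case_prod_unfold continuous_on_eq_continuous_at open_Times)
qed

lemma gmoment_deriv_y:
  assumes F: "tame F" and p: "0 < p"
  shows "((\<lambda>y. gmoment m F y p) has_real_derivative
           real m * gmoment (m - 1) F y p - 2 * p * gmoment (m + 1) F y p) (at y)"
proof -
  note [measurable] = tame_measurable[OF F]
  let ?f = "\<lambda>m y z. (y - z) ^ m * exp (- p * (y - z)\<^sup>2) * F z"
  obtain w1 where w1: "integrable lborel w1"
    "\<And>y' z. \<bar>y'\<bar> \<le> \<bar>y\<bar> + 1 \<Longrightarrow> \<bar>?f (m-1) y' z\<bar> \<le> w1 z"
    using gmoment_dominated[OF F p, of "\<bar>y\<bar> + 1" "m-1"] by blast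
  obtain w2 where w2: "integrable lborel w2"
    "\<And>y' z. \<bar>y'\<bar> \<le> \<bar>y\<bar> + 1 \<Longrightarrow> \<bar>?f (m+1) y' z\<bar> \<le> w2 z"
    using gmoment_dominated[OF F p, of "\<bar>y\<bar> + 1" "m+1"] by blast
  have "((\<lambda>y. LINT z|lborel. ?f m y z) has_real_derivative
      (LINT z|lborel. real m * ?f (m-1) y z - 2 * p * ?f (m+1) y z)) (at y)"
  proof (rule dominated_derivative[where r=1 and w="\<lambda>z. real m * w1 z + 2 * p * w2 z"])
    fix x z assume x: "x \<in> ball y (1::real)"
    then have x': "\<bar>x\<bar> \<le> \<bar>y\<bar> + 1" by (auto simp: dist_real_def)
    show "((\<lambda>x. ?f m x z) has_real_derivative real m * ?f (m-1) x z - 2 * p * ?f (m+1) x z) (at x)"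
      by (auto intro!: derivative_eq_intros simp: power2_eq_square algebra_simps)
    have "\<bar>real m * ?f (m-1) x z - 2 * p * ?f (m+1) x z\<bar> \<le> real m * \<bar>?f (m-1) x z\<bar> + 2 * p * \<bar>?f (m+1) x z\<bar>"
      using p by (simp add: abs_mult abs_triangle_ineq4[THEN order_trans])
    also have "\<dots> \<le> real m * w1 z + 2 * p * w2 z"
      using p by (intro add_mono mult_left_mono w1 w2 x') auto
    finally show "\<bar>real m * ?f (m-1) x z - 2 * p * ?f (m+1) x z\<bar> \<le> real m * w1 z + 2 * p * w2 z" .
  next
    fix x assume "x \<in> ball y (1::real)"
    show "integrable lborel (?f m x)" by (rule gmoment_integrable[OF F p])
  qed (use w1(1) w2(1) in auto)
  moreover have "(LINT z|lborel. real m * ?f (m-1) y z - 2 * p * ?f (m+1) y z)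
      = real m * gmoment (m - 1) F y p - 2 * p * gmoment (m + 1) F y p"
    unfolding gmoment_def
    by (subst Bochner_Integration.integral_diff)
      (intro integrable_mult_right gmoment_integrable[OF F p] | simp only: integral_mult_right_zero)+
  ultimately show ?thesis unfolding gmoment_def by simp
qed

lemma gmoment_deriv_p:
  assumes F: "tame F" and p: "0 < p"
  shows "((\<lambda>p. gmoment m F y p) has_real_derivative - gmoment (m + 2) F y p) (at p)"
proof -
  note [measurable] = tame_measurable[OF F]
  let ?f = "\<lambda>m p z. (y - z) ^ m * exp (- p * (y - z)\<^sup>2) * F z"
  obtain w where w: "integrable lborel w"
    "\<And>p' z. p/2 \<le> p' \<Longrightarrow> \<bar>?f (m+2) p' z\<bar> \<le> w z"
    using gmoment_dominated[OF F, of "p/2" "\<bar>y\<bar>" "m+2"] p by auto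
  have "((\<lambda>p. LINT z|lborel. ?f m p z) has_real_derivative
      (LINT z|lborel. - ?f (m+2) p z)) (at p)"
  proof (rule dominated_derivative[where r="p/2", OF _ w(1)])
    fix x z assume x: "x \<in> ball p (p/2)"
    show "((\<lambda>x. ?f m x z) has_real_derivative - ?f (m+2) x z) (at x)"
      by (auto intro!: derivative_eq_intros simp: power2_eq_square algebra_simps)
    have "p/2 \<le> x" using x abs_le_D1[of "p - x" "p/2"] by (auto simp: dist_real_def)
    then show "\<bar>- ?f (m+2) x z\<bar> \<le> w z" using w(2) by simp
  next
    fix x assume "x \<in> ball p (p/2)"
    then have "0 < x" using p abs_less_iff[of "p - x" "p/2"] by (auto simp: dist_real_def)
    then show "integrable lborel (?f m x)" by (rule gmoment_integrable[OF F])
  qed (use p in auto)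
  then show ?thesis unfolding gmoment_def by simp
qed

section \<open>The heat semigroup on the line\<close>

text \<open>
  Convolution with the heat kernel, written as an expectation over a standard normal variable so
  that the formula makes sense, and stays continuous, at \<open>t = 0\<close>. The functions \<open>heat_x\<close> and \<open>heat_xx\<close>
  are its space derivatives for \<open>t > 0\<close>.
\<close>

definition heat :: "(real \<Rightarrow> real) \<Rightarrow> real \<Rightarrow> real \<Rightarrow> real" where
  "heat F y t = (LINT x|lborel. std_normal_density x * F (y + sqrt (2 * t) * x))"

definition heat_x :: "(real \<Rightarrow> real) \<Rightarrow> real \<Rightarrow> real \<Rightarrow> real" where
  "heat_x F y t = - 2 * (1/(4*t)) * gmoment 1 F y (1/(4*t)) / sqrt (4 * pi * t)"

definition heat_xx :: "(real \<Rightarrow> real) \<Rightarrow> real \<Rightarrow> real \<Rightarrow> real" where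
  "heat_xx F y t = - 2 * (1/(4*t)) *
     (gmoment 0 F y (1/(4*t)) - 2 * (1/(4*t)) * gmoment 2 F y (1/(4*t))) / sqrt (4 * pi * t)"

text \<open>
  The substitution \<open>z = y + sqrt (2 t) x\<close> turns the expectation into the convolution with the kernel.
\<close>

lemma heat_eq_gmoment:
  assumes t: "0 < t"
  shows "heat F y t = gmoment 0 F y (1/(4*t)) / sqrt (4 * pi * t)"
proof -
  have c: "sqrt (2 * t) \<noteq> 0" using t by simp
  have s: "sqrt (4 * pi * t) = sqrt (2 * pi) * sqrt (2 * t)" by (simp add: real_sqrt_mult[symmetric])
  have e: "(1/(4*t)) * (sqrt (2 * t) * x)\<^sup>2 = x\<^sup>2 / 2" for x
    using t by (simp add: power_mult_distrib)
  have "gmoment 0 F y (1/(4*t)) =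
      \<bar>sqrt (2 * t)\<bar> *\<^sub>R (LINT x|lborel. exp (- (1/(4*t)) * (y - (y + sqrt (2*t) * x))\<^sup>2) * F (y + sqrt (2*t) * x))"
    unfolding gmoment_def by (subst lborel_integral_real_affine[OF c, of _ y]) simp
  also have "\<dots> = sqrt (2 * t) * (LINT x|lborel. sqrt (2 * pi) * (std_normal_density x * F (y + sqrt (2*t) * x)))"
  proof -
    have "exp (- (1/(4*t)) * (y - (y + sqrt (2*t) * x))\<^sup>2) * F (y + sqrt (2*t) * x) =
        sqrt (2 * pi) * (std_normal_density x * F (y + sqrt (2*t) * x))" for x
      using t by (simp add: std_normal_density_def power_mult_distrib)
    then have "(\<lambda>x. exp (- (1/(4*t)) * (y - (y + sqrt (2*t) * x))\<^sup>2) * F (y + sqrt (2*t) * x)) =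
        (\<lambda>x. sqrt (2 * pi) * (std_normal_density x * F (y + sqrt (2*t) * x)))" by (rule ext)
    moreover have "\<bar>sqrt (2 * t)\<bar> = sqrt (2 * t)" using t by simp
    ultimately show ?thesis by (simp only: real_scaleR_def)
  qed
  also have "\<dots> = sqrt (4 * pi * t) * heat F y t"
    unfolding heat_def s by simp
  finally show ?thesis using t by simp
qed

lemma heat_dominated:
  assumes F: "tame F"
  shows "\<exists>w. integrable lborel w \<and> (\<forall>y t x. \<bar>y\<bar> \<le> R \<longrightarrow> 0 \<le> t \<longrightarrow> t \<le> R \<longrightarrow>
    \<bar>std_normal_density x * F (y + sqrt (2 * t) * x)\<bar> \<le> w x)"
proof -
  obtain A k where A: "0 \<le> A" "0 \<le> k" "\<And>z. \<bar>F z\<bar> \<le> A * exp (k * \<bar>z\<bar>)"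
    using tame_bound[OF F] by blast
  define c where "c = sqrt (2 * \<bar>R\<bar>)"
  let ?w = "\<lambda>x. A * exp (k * R) / sqrt (2 * pi) * (exp ((k*c) * \<bar>x\<bar>) * exp (- (1/2) * x\<^sup>2))"
  have "integrable lborel ?w" using integrable_exp_gauss[of "1/2" "k*c"] by simp
  moreover have "\<bar>std_normal_density x * F (y + sqrt (2 * t) * x)\<bar> \<le> ?w x"
    if y: "\<bar>y\<bar> \<le> R" and t: "0 \<le> t" "t \<le> R" for y t x
  proof -
    have R: "0 \<le> R" using y by simp
    have ct: "\<bar>sqrt (2 * t)\<bar> \<le> c"
      using t R by (simp add: c_def)
    have "\<bar>y + sqrt (2 * t) * x\<bar> \<le> R + c * \<bar>x\<bar>"
      using y mult_right_mono[OF ct, of "\<bar>x\<bar>"] by (intro order_trans[OF abs_triangle_ineq] add_mono) (auto simp: abs_mult)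
    then have "exp (k * \<bar>y + sqrt (2 * t) * x\<bar>) \<le> exp (k * (R + c * \<bar>x\<bar>))"
      using A(2) by (simp add: mult_left_mono)
    then have "\<bar>F (y + sqrt (2 * t) * x)\<bar> \<le> A * exp (k * (R + c * \<bar>x\<bar>))"
      using A by (meson mult_left_mono order_trans)
    then have "\<bar>std_normal_density x * F (y + sqrt (2 * t) * x)\<bar> \<le> std_normal_density x * (A * exp (k * (R + c * \<bar>x\<bar>)))"
      by (simp add: abs_mult mult_left_mono)
    also have "\<dots> = ?w x"
      by (simp add: std_normal_density_def exp_add algebra_simps)
    finally show ?thesis .
  qed
  ultimately show ?thesis by (intro exI[of _ ?w]) auto
qed

lemma heat_integrable:
  assumes F: "tame F" and t: "0 \<le> t"
  shows "integrable lborel (\<lambda>x. std_normal_density x * F (y + sqrt (2 * t) * x))"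
proof -
  note [measurable] = tame_measurable[OF F]
  obtain w where w: "integrable lborel w"
    "\<And>x. \<bar>std_normal_density x * F (y + sqrt (2 * t) * x)\<bar> \<le> w x"
    using heat_dominated[OF F, of "max \<bar>y\<bar> t"] t by (metis max.cobounded1 max.cobounded2)
  show ?thesis
  proof (rule Bochner_Integration.integrable_bound[OF w(1)])
    have "norm (std_normal_density x * F (y + sqrt (2 * t) * x)) \<le> norm (w x)" for x
      using w(2)[of x] by simp
    then show "AE x in lborel. norm (std_normal_density x * F (y + sqrt (2 * t) * x)) \<le> norm (w x)"
      by simp
  qed measurable
qed

lemma heat_continuous:
  assumes F: "tame F"
  shows "continuous_on (UNIV \<times> {0..}) (\<lambda>(y, t). heat F y t)"
  unfolding continuous_on_def
proof
  fix x0 :: "real \<times> real" assume x0: "x0 \<in> UNIV \<times> {0..}"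
  note [measurable] = tame_measurable[OF F]
  obtain y0 t0 where yt: "x0 = (y0, t0)" "0 \<le> t0" using x0 by auto
  define R where "R = \<bar>y0\<bar> + t0 + 1"
  obtain w where w: "integrable lborel w"
      "\<And>y t x. \<bar>y\<bar> \<le> R \<Longrightarrow> 0 \<le> t \<Longrightarrow> t \<le> R \<Longrightarrow> \<bar>std_normal_density x * F (y + sqrt (2 * t) * x)\<bar> \<le> w x"
    using heat_dominated[OF F, of R] by blast
  let ?U = "{-R<..<R} \<times> {..<R}"
  let ?S = "(UNIV \<times> {0..}) \<inter> ?U"
  have "((\<lambda>p. heat F (fst p) (snd p)) \<longlongrightarrow> heat F (fst x0) (snd x0)) (at x0 within ?S)"
    unfolding heat_def
  proof (rule dominated_tendsto[OF w(1)])
    fix z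
    have F': "isCont F u" for u by (rule tame_isCont[OF F])
    have "((\<lambda>p. fst p + sqrt (2 * snd p) * z) \<longlongrightarrow> fst x0 + sqrt (2 * snd x0) * z) (at x0 within ?S)"
      by (intro tendsto_intros)
    then show "((\<lambda>p. std_normal_density z * F (fst p + sqrt (2 * snd p) * z)) \<longlongrightarrow>
         std_normal_density z * F (fst x0 + sqrt (2 * snd x0) * z)) (at x0 within ?S)"
      by (intro tendsto_mult_left isCont_tendsto_compose[OF F'])
  next
    fix p z assume "p \<in> ?S"
    then show "\<bar>std_normal_density z * F (fst p + sqrt (2 * snd p) * z)\<bar> \<le> w z"
      by (intro w(2)) auto
  qed auto
  moreover have "at x0 within ?S = at x0 within (UNIV \<times> {0..})"
  proof (rule at_within_nhd[where S="?U"])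
    show "x0 \<in> ?U" "open ?U" using yt by (auto simp: R_def intro!: open_Times)
  qed auto
  ultimately show "((\<lambda>(y, t). heat F y t) \<longlongrightarrow> (case x0 of (y, t) \<Rightarrow> heat F y t)) (at x0 within UNIV \<times> {0..})"
    by (simp add: case_prod_unfold)
qed

lemma heat_0: "heat F y 0 = F y"
  by (simp add: heat_def)

lemma heat_space_deriv:
  assumes F: "tame F" and t: "0 < t"
  shows "((\<lambda>y. heat F y t) has_real_derivative heat_x F y t) (at y)"
    and "((\<lambda>y. heat_x F y t) has_real_derivative heat_xx F y t) (at y)"
proof -
  have p: "0 < 1/(4*t)" using t by simp
  show "((\<lambda>y. heat F y t) has_real_derivative heat_x F y t) (at y)"
    unfolding heat_eq_gmoment[OF t] heat_x_def
    using DERIV_cdivide[OF gmoment_deriv_y[OF F p, of 0 y], of "sqrt (4 * pi * t)"] by simp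
  show "((\<lambda>y. heat_x F y t) has_real_derivative heat_xx F y t) (at y)"
    unfolding heat_x_def heat_xx_def
    using DERIV_cdivide[OF DERIV_cmult[OF gmoment_deriv_y[OF F p, of 1 y], of "- 2 * (1/(4*t))"],
        of "sqrt (4 * pi * t)"] by (simp add: numeral_2_eq_2)
qed

text \<open>
  The heat equation for the kernel: the left-hand side is the second space derivative, the
  right-hand side comes from the quotient rule in \<open>t\<close>, with \<open>s = sqrt (4 \<pi> t)\<close>.
\<close>

lemma heat_quotient_algebra:
  fixes s t K L :: real
  assumes "s \<noteq> 0" "t \<noteq> 0"
  shows "- 2 * (1/(4*t)) * (K - 2 * (1/(4*t)) * L) / s =
    (- L * (- 1 / (4*t\<^sup>2)) * s - K * (s / (2 * t))) / (s * s)"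
  using assms by (simp add: divide_simps power2_eq_square) (simp add: algebra_simps)

lemma heat_time_deriv:
  assumes F: "tame F" and t: "0 < t"
  shows "((\<lambda>t. heat F y t) has_real_derivative heat_xx F y t) (at t)"
proof -
  have p: "0 < 1/(4*t)" using t by simp
  let ?s = "sqrt (4 * pi * t)"
  have d1: "((\<lambda>t. gmoment 0 F y (1/(4*t))) has_real_derivative
      - gmoment 2 F y (1/(4*t)) * (- 1 / (4*t\<^sup>2))) (at t)"
  proof -
    have 1: "((\<lambda>p. gmoment 0 F y p) has_real_derivative - gmoment 2 F y (1/(4*t))) (at (1/(4*t)))"
      using gmoment_deriv_p[OF F p, of 0 y] unfolding add_0 .
    have 2: "((\<lambda>t. 1/(4*t)) has_real_derivative - 1 / (4*t\<^sup>2)) (at t)"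
      using t by (auto intro!: derivative_eq_intros simp: power2_eq_square)
    show ?thesis by (rule DERIV_chain2[of "\<lambda>p. gmoment 0 F y p", OF 1 2])
  qed
  have d2: "((\<lambda>t. sqrt (4 * pi * t)) has_real_derivative ?s / (2 * t)) (at t)"
  proof -
    have "((\<lambda>t. sqrt (4 * pi * t)) has_real_derivative 4 * pi * (inverse ?s / 2)) (at t)"
      using mult_pos_pos[OF pi_gt_zero t] by (auto intro!: derivative_eq_intros)
    moreover have "?s * ?s = 4 * pi * t" using t by simp
    moreover have "4 * pi * (inverse ?s / 2) = ?s / (2 * t)" if "?s * ?s = 4 * pi * t" "?s \<noteq> 0"
      using that t by (simp add: field_simps del: real_sqrt_mult_self)
    ultimately show ?thesis using t by simp
  qed
  have s: "?s \<noteq> 0" using t by simp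
  have "((\<lambda>t. gmoment 0 F y (1/(4*t)) / sqrt (4 * pi * t)) has_real_derivative heat_xx F y t) (at t)"
    using DERIV_divide[OF d1 d2 s]
    unfolding heat_xx_def heat_quotient_algebra[OF s less_imp_neq[OF t, symmetric]] .
  moreover have "eventually (\<lambda>u. heat F y u = gmoment 0 F y (1/(4*u)) / sqrt (4 * pi * u)) (nhds t)"
    using heat_eq_gmoment eventually_nhds_in_open[of "{0<..}" t] t
    by (auto elim!: eventually_mono)
  ultimately show ?thesis by (subst DERIV_cong_ev[OF refl _ refl])
qed

lemma heat_x_continuous:
  assumes F: "tame F"
  shows "continuous_on (UNIV \<times> {0<..}) (\<lambda>(y, t). heat_x F y t)"
    and "continuous_on (UNIV \<times> {0<..}) (\<lambda>(y, t). heat_xx F y t)"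
proof -
  have *: "continuous_on (UNIV \<times> {0<..}) (\<lambda>x. gmoment m F (fst x) (1/(4 * snd x)))" for m
    using continuous_on_compose2[OF gmoment_continuous[OF F, of m], of "UNIV \<times> {0<..}" "\<lambda>x. (fst x, 1/(4 * snd x))"]
    by (force intro!: continuous_intros simp: case_prod_unfold)
  show "continuous_on (UNIV \<times> {0<..}) (\<lambda>(y, t). heat_x F y t)"
    "continuous_on (UNIV \<times> {0<..}) (\<lambda>(y, t). heat_xx F y t)"
    unfolding heat_x_def heat_xx_def case_prod_unfold
    by (auto intro!: continuous_intros *)
qed

text \<open>
  Derivatives may be moved onto the initial function, uniformly down to \<open>t = 0\<close>. This gives solutions
  whose space derivatives are continuous at the initial time.
\<close>

lemma heat_deriv_initial:
  assumes F: "tame F" and F': "tame F'" and d: "\<And>y. (F has_real_derivative F' y) (at y)" and t: "0 \<le> t"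
  shows "((\<lambda>y. heat F y t) has_real_derivative heat F' y t) (at y)"
  unfolding heat_def
proof -
  note [measurable] = tame_measurable[OF F] tame_measurable[OF F']
  obtain w where w: "integrable lborel w"
    "\<And>u x. \<bar>u\<bar> \<le> \<bar>y\<bar> + 1 \<Longrightarrow> \<bar>std_normal_density x * F' (u + sqrt (2 * t) * x)\<bar> \<le> w x"
    using heat_dominated[OF F', of "\<bar>y\<bar> + 1 + t"] t by force
  show "((\<lambda>y. LINT x|lborel. std_normal_density x * F (y + sqrt (2 * t) * x)) has_real_derivative
      (LINT x|lborel. std_normal_density x * F' (y + sqrt (2 * t) * x))) (at y)"
  proof (rule dominated_derivative[OF zero_less_one w(1)])
    fix u x assume "u \<in> ball y (1::real)"
    then have "\<bar>u\<bar> \<le> \<bar>y\<bar> + 1" by (auto simp: dist_real_def)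
    then show "\<bar>std_normal_density x * F' (u + sqrt (2 * t) * x)\<bar> \<le> w x" by (rule w(2))
    have "((\<lambda>u. F (u + sqrt (2 * t) * x)) has_real_derivative F' (u + sqrt (2 * t) * x)) (at u)"
    proof -
      have "((\<lambda>u. u + sqrt (2 * t) * x) has_real_derivative 1) (at u)"
        by (auto intro!: derivative_eq_intros)
      from DERIV_chain2[of F, OF d this] show ?thesis by simp
    qed
    then show "((\<lambda>u. std_normal_density x * F (u + sqrt (2 * t) * x)) has_real_derivative
        std_normal_density x * F' (u + sqrt (2 * t) * x)) (at u)"
      by (rule DERIV_cmult)
  qed (use heat_integrable[OF F t] in auto)
qed

lemma tame_affine:
  assumes F: "tame F" and s: "\<bar>s\<bar> = (1::real)"
  shows "tame (\<lambda>z. F (r + s * z))"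
proof -
  obtain A k where A: "0 \<le> A" "0 \<le> k" "\<And>z. \<bar>F z\<bar> \<le> A * exp (k * \<bar>z\<bar>)"
    using tame_bound[OF F] by blast
  have "\<bar>F (r + s * z)\<bar> \<le> (A * exp (k * \<bar>r\<bar>)) * exp (k * \<bar>z\<bar>)" for z
  proof -
    have "\<bar>r + s * z\<bar> \<le> \<bar>r\<bar> + \<bar>z\<bar>" using s abs_triangle_ineq[of r "s*z"] by (simp add: abs_mult)
    then have "exp (k * \<bar>r + s * z\<bar>) \<le> exp (k * (\<bar>r\<bar> + \<bar>z\<bar>))" using A(2) by (simp add: mult_left_mono)
    then have "\<bar>F (r + s * z)\<bar> \<le> A * exp (k * (\<bar>r\<bar> + \<bar>z\<bar>))"
      using A by (meson mult_left_mono order_trans)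
    then show ?thesis by (simp add: exp_add algebra_simps)
  qed
  moreover have "continuous_on UNIV (\<lambda>z. F (r + s * z))"
    using F unfolding tame_def by (auto intro!: continuous_on_compose2[of UNIV F] continuous_intros)
  ultimately show ?thesis unfolding tame_def by blast
qed

lemma tame_zero: "tame (\<lambda>z. 0)"
  unfolding tame_def by (auto intro!: exI[of _ 0])

text \<open>
  Measuring from the point \<open>r\<close> in the direction \<open>s = \<plusminus>1\<close>: this is how a vertex at either end of an edge
  is moved to the origin with the edge on the positive side.
\<close>

lemma gmoment_affine:
  assumes s: "\<bar>s\<bar> = 1"
  shows "gmoment m (\<lambda>z. F (r + s * z)) 0 p = s ^ m * gmoment m F r p"
proof -
  have s0: "s \<noteq> 0" and s2: "s\<^sup>2 = 1" using s by (auto simp: power2_eq_1_iff abs_if split: if_splits)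
  have "gmoment m F r p = (LINT z|lborel. (- (s * z)) ^ m * exp (- p * (- (s * z))\<^sup>2) * F (r + s * z))"
    unfolding gmoment_def by (subst lborel_integral_real_affine[OF s0, of _ r]) (simp add: s)
  also have "\<dots> = (LINT z|lborel. s ^ m * ((0 - z) ^ m * exp (- p * (0 - z)\<^sup>2) * F (r + s * z)))"
  proof -
    have "(- (s * z)) ^ m * exp (- p * (- (s * z))\<^sup>2) = s ^ m * ((0 - z) ^ m * exp (- p * (0 - z)\<^sup>2))" for z
      using power_mult_distrib[of s "- z" m] power_mult_distrib[of s "z" 2] s2 by simp
    then show ?thesis by (simp only: mult.assoc)
  qed
  also have "\<dots> = s ^ m * gmoment m (\<lambda>z. F (r + s * z)) 0 p" by (simp add: gmoment_def)
  finally have "s ^ m * gmoment m F r p = (s\<^sup>2) ^ m * gmoment m (\<lambda>z. F (r + s * z)) 0 p"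
    by (simp add: power2_eq_square power_mult_distrib)
  then show ?thesis by (simp add: s2)
qed

lemma heat_affine:
  assumes s: "\<bar>s\<bar> = 1" and t: "0 < t"
  shows "heat (\<lambda>z. F (r + s * z)) 0 t = heat F r t"
    and "heat_x (\<lambda>z. F (r + s * z)) 0 t = s * heat_x F r t"
  using t by (simp_all add: heat_eq_gmoment heat_x_def gmoment_affine[OF s] del: One_nat_def)

text \<open>Only the even part of the initial function contributes to the value at the origin.\<close>

lemma heat_even_part:
  assumes G: "tame G" and t: "0 < t" and S: "\<And>z. G z + G (- z) = S z"
  shows "heat G 0 t = heat S 0 t / 2"
proof -
  have r: "heat G 0 t = heat (\<lambda>z. G (- z)) 0 t"
    using heat_affine(1)[of "-1" t G 0] t by simp
  have G': "tame (\<lambda>z. G (- z))" using tame_affine[OF G, of "-1" 0] by simp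
  have "heat G 0 t + heat (\<lambda>z. G (- z)) 0 t = heat S 0 t"
    unfolding heat_def using heat_integrable[OF G, of t 0] heat_integrable[OF G', of t 0] t
    by (subst Bochner_Integration.integral_add[symmetric]) (auto simp: S[symmetric] algebra_simps)
  then show ?thesis using r by simp
qed

text \<open>
  Only the odd part contributes to the slope at the origin; here the odd parts add up to zero, which
  will be the Kirchhoff condition.
\<close>

lemma heat_x_even_sum:
  assumes G: "\<And>i. i \<in> I \<Longrightarrow> tame (G i)" and t: "0 < t"
    and S: "\<And>z. (\<Sum>i\<in>I. G i z) = (\<Sum>i\<in>I. G i (- z))"
  shows "(\<Sum>i\<in>I. heat_x (G i) 0 t) = 0"
proof -
  let ?S = "\<lambda>z. \<Sum>i\<in>I. G i z"
  have p: "0 < 1/(4*t)" using t by simp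
  have "(\<Sum>i\<in>I. gmoment 1 (G i) 0 (1/(4*t))) = gmoment 1 ?S 0 (1/(4*t))"
    unfolding gmoment_def using gmoment_integrable[OF G p, of _ 0 1]
    by (subst Bochner_Integration.integral_sum[symmetric]) (auto simp: sum_distrib_left)
  moreover have "gmoment 1 ?S 0 (1/(4*t)) = gmoment 1 (\<lambda>z. ?S (- z)) 0 (1/(4*t))"
    using S by presburger
  moreover have "gmoment 1 (\<lambda>z. ?S (- z)) 0 (1/(4*t)) = - gmoment 1 ?S 0 (1/(4*t))"
    using gmoment_affine[of "-1" 1 ?S 0 "1/(4*t)"] by simp
  ultimately have "(\<Sum>i\<in>I. gmoment 1 (G i) 0 (1/(4*t))) = 0" by linarith
  moreover have "(\<Sum>i\<in>I. heat_x (G i) 0 t) =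
      - 2 * (1/(4*t)) / sqrt (4 * pi * t) * (\<Sum>i\<in>I. gmoment 1 (G i) 0 (1/(4*t)))"
    unfolding sum_distrib_left by (intro sum.cong) (auto simp: heat_x_def)
  ultimately show ?thesis by simp
qed

section \<open>Analyticity in time\<close>

text \<open>
  Expanding \<open>exp (h w\<^sup>2)\<close> with \<open>w = y - z\<close> under the integral; the series of absolute values sums to the
  integrand with parameter \<open>p - \<bar>h\<bar>\<close>; it is integrable because \<open>\<bar>h\<bar> < p\<close>.
\<close>

lemma gmoment_power_series:
  assumes F: "tame F" and h: "\<bar>h\<bar> < p"
  shows "(\<lambda>k. h ^ k / fact k * gmoment (m + 2 * k) F y p) sums gmoment m F y (p - h)"
proof -
  have p: "0 < p" and ph: "0 < p - \<bar>h\<bar>" using h by auto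
  let ?g = "\<lambda>k z. (y - z) ^ (m + 2 * k) * exp (- p * (y - z)\<^sup>2) * F z"
  let ?f = "\<lambda>k z. h ^ k / fact k * ?g k z"
  let ?w = "\<lambda>z. (y - z) ^ m * exp (- (p - \<bar>h\<bar>) * (y - z)\<^sup>2) * F z"
  have i: "integrable lborel (?f k)" for k using gmoment_integrable[OF F p] by (intro integrable_mult_right)
  have iw: "integrable lborel (\<lambda>z. \<bar>?w z\<bar>)" using gmoment_integrable[OF F ph] by (intro integrable_abs)
  have e: "(\<lambda>k. x ^ k / fact k * (y - z) ^ (2 * k)) sums exp (x * (y - z)\<^sup>2)" for x z
    using exp_converges[of "x * (y - z)\<^sup>2"] unfolding power_mult power_mult_distrib by (simp add: field_simps)
  have s: "(\<lambda>k. x ^ k / fact k * ?g k z) sums ((y - z) ^ m * exp (- (p - x) * (y - z)\<^sup>2) * F z)" for x z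
  proof -
    have "(\<lambda>k. (y - z) ^ m * exp (- p * (y - z)\<^sup>2) * (x ^ k / fact k * (y - z) ^ (2 * k)) * F z) =
        (\<lambda>k. x ^ k / fact k * ?g k z)"
      by (rule ext) (simp add: power_add)
    moreover have "(y - z) ^ m * exp (- p * (y - z)\<^sup>2) * exp (x * (y - z)\<^sup>2) * F z =
        (y - z) ^ m * exp (- (p - x) * (y - z)\<^sup>2) * F z"
      by (simp only: mult.assoc exp_add[symmetric]) (simp add: algebra_simps)
    ultimately show ?thesis
      using sums_mult2[OF sums_mult[OF e[of x z], of "(y - z) ^ m * exp (- p * (y - z)\<^sup>2)"], of "F z"] by metis
  qed
  have sa: "(\<lambda>k. \<bar>?f k z\<bar>) sums \<bar>?w z\<bar>" for z
  proof -
    have "\<bar>?f k z\<bar> = (\<bar>h\<bar> ^ k / fact k * (y - z) ^ (2 * k)) * \<bar>(y - z) ^ m * exp (- p * (y - z)\<^sup>2) * F z\<bar>" for k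
      by (simp add: power_add abs_mult power_abs[symmetric])
    moreover have "\<bar>?w z\<bar> = exp (\<bar>h\<bar> * (y - z)\<^sup>2) * \<bar>(y - z) ^ m * exp (- p * (y - z)\<^sup>2) * F z\<bar>"
    proof -
      have "exp (- (p - \<bar>h\<bar>) * (y - z)\<^sup>2) = exp (\<bar>h\<bar> * (y - z)\<^sup>2) * exp (- p * (y - z)\<^sup>2)"
        by (simp only: exp_add[symmetric]) (simp add: algebra_simps)
      then show ?thesis by (simp only: abs_mult abs_exp_cancel mult_ac)
    qed
    ultimately show ?thesis
      using sums_mult2[OF e[of "\<bar>h\<bar>" z], of "\<bar>(y - z) ^ m * exp (- p * (y - z)\<^sup>2) * F z\<bar>"] by simp
  qed
  have "(\<lambda>k. LINT z|lborel. ?f k z) sums (LINT z|lborel. (\<Sum>k. ?f k z))"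
  proof (rule sums_integral[OF i])
    show "AE z in lborel. summable (\<lambda>k. norm (?f k z))" using sa by (auto simp: sums_iff)
    show "summable (\<lambda>k. LINT z|lborel. norm (?f k z))"
    proof (rule summableI_nonneg_bounded)
      fix n
      have "(\<Sum>k<n. LINT z|lborel. norm (?f k z)) = (LINT z|lborel. (\<Sum>k<n. \<bar>?f k z\<bar>))"
        unfolding real_norm_def by (rule Bochner_Integration.integral_sum[symmetric]) (rule integrable_abs[OF i])
      also have "\<dots> \<le> (LINT z|lborel. \<bar>?w z\<bar>)"
      proof (rule integral_mono)
        show "(\<Sum>k<n. \<bar>?f k z\<bar>) \<le> \<bar>?w z\<bar>" for z
          using sa[of z] sum_le_suminf[of "\<lambda>k. \<bar>?f k z\<bar>" "{..<n}"] by (auto simp: sums_iff)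
        show "integrable lborel (\<lambda>z. \<Sum>k<n. \<bar>?f k z\<bar>)"
          by (intro Bochner_Integration.integrable_sum integrable_abs i)
      qed (rule iw)
      finally show "(\<Sum>k<n. LINT z|lborel. norm (?f k z)) \<le> (LINT z|lborel. \<bar>?w z\<bar>)" .
    qed auto
  qed
  moreover have "(\<Sum>k. ?f k z) = (y - z) ^ m * exp (- (p - h) * (y - z)\<^sup>2) * F z" for z
    using s[of h z] by (simp add: sums_iff)
  ultimately show ?thesis by (simp add: gmoment_def)
qed

text \<open>
  Unique continuation. The series about a point \<open>p\<^sub>0\<close> of the interval converges on \<open>(0, 2 p\<^sub>0)\<close>, which reaches
  down to 0 at once; repeating the step extends the range by a fixed factor each time.
\<close>

lemma gmoment_vanish:
  assumes F: "tame F" and ab: "0 \<le> a" "a < b" and z: "\<And>p. p \<in> {a<..<b} \<Longrightarrow> gmoment m F y p = 0"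
    and p: "0 < p"
  shows "gmoment m F y p = 0"
proof -
  \<comment> \<open>Derivatives of all orders vanish on an interval, hence so does the Taylor series.\<close>
  have step: "\<forall>q\<in>{0<..<2*p0}. gmoment m F y q = 0"
    if "0 \<le> a'" "p0 \<in> {a'<..<b'}" "\<forall>p\<in>{a'<..<b'}. gmoment m F y p = 0" for a' b' p0
  proof
    fix q assume q: "q \<in> {0<..<2*p0}"
    have all: "\<forall>p\<in>{a'<..<b'}. gmoment (m + 2 * k) F y p = 0" for k
    proof (induction k)
      case (Suc k)
      show ?case
      proof
        fix p assume p: "p \<in> {a'<..<b'}"
        have "((\<lambda>p. gmoment (m + 2 * k) F y p) has_real_derivative - gmoment (m + 2 * k + 2) F y p) (at p)"
          using p that(1) by (intro gmoment_deriv_p[OF F]) auto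
        moreover have "((\<lambda>p. gmoment (m + 2 * k) F y p) has_real_derivative 0) (at p)"
          by (rule has_field_derivative_transform_within_open[OF DERIV_const[of 0], of "{a'<..<b'}"])
            (use p Suc in auto)
        ultimately have "- gmoment (m + 2 * k + 2) F y p = 0" by (rule DERIV_unique)
        then show "gmoment (m + 2 * Suc k) F y p = 0" by (simp add: add.assoc)
      qed
    qed (use that in auto)
    have "\<bar>p0 - q\<bar> < p0" using q by auto
    from gmoment_power_series[OF F this, of m y] all that(2)
    have "(\<lambda>k. 0) sums gmoment m F y q" by simp
    then show "gmoment m F y q = 0" by (simp add: sums_iff)
  qed
  have b: "0 < b" using ab by simp
  have grow: "\<forall>q\<in>{0<..<(3/2)^n * b}. gmoment m F y q = 0" for n
  proof (induction n)
    case 0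
    have "\<forall>q\<in>{0<..<2*((a+b)/2)}. gmoment m F y q = 0"
      by (rule step[OF ab(1), of _ b]) (use ab z in auto)
    then show ?case using ab by auto
  next
    case (Suc n)
    \<comment> \<open>The centre is taken at three quarters of the range, so that the range grows by the factor 3/2.\<close>
    have "\<forall>q\<in>{0<..<2*(3/4*((3/2)^n*b))}. gmoment m F y q = 0"
      by (rule step[of 0 _ "(3/2)^n*b"]) (use b Suc in auto)
    then show ?case by (simp add: field_simps)
  qed
  obtain n where "p / b < (3/2)^n" using real_arch_pow[of "3/2"] by auto
  then have "p < (3/2)^n * b" using b by (simp add: field_simps)
  then show ?thesis using grow p by auto
qed

text \<open>
  An even initial function \<open>q\<close> yields the value \<open>heat q 0 t\<close> at the origin, so multiples of \<open>z\<^sup>2\<close> and \<open>z\<^sup>4\<close>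
  prescribe the boundary values \<open>t\<close> and \<open>t\<^sup>2/2\<close>.
\<close>

lemma heat_power:
  assumes t: "0 \<le> t"
  shows "heat (\<lambda>z. z\<^sup>2) 0 t = 2 * t" and "heat (\<lambda>z. z ^ 4) 0 t = 12 * t\<^sup>2"
proof -
  have 2: "(LINT x|lborel. std_normal_density x * x\<^sup>2) = 1"
    using integral_std_normal_moment_even[of 1] by simp
  have 4: "(LINT x|lborel. std_normal_density x * x ^ 4) = 3"
    using integral_std_normal_moment_even[of 2] by (simp add: fact_numeral)
  have "heat (\<lambda>z. z\<^sup>2) 0 t = (LINT x|lborel. (2 * t) * (std_normal_density x * x\<^sup>2))"
    unfolding heat_def using t by (simp add: power_mult_distrib mult_ac)
  then show "heat (\<lambda>z. z\<^sup>2) 0 t = 2 * t" using 2 by simp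
  have s4: "sqrt (2 * t) ^ 4 = (2 * t)\<^sup>2"
    using t power_mult[of "sqrt (2 * t)" 2 2] by simp
  have "heat (\<lambda>z. z ^ 4) 0 t = (LINT x|lborel. (2 * t)\<^sup>2 * (std_normal_density x * x ^ 4))"
    unfolding heat_def add_0 power_mult_distrib[of "sqrt (2 * t)"] s4 by (simp only: mult_ac)
  then show "heat (\<lambda>z. z ^ 4) 0 t = 12 * t\<^sup>2" using 4 by (simp add: power_mult_distrib)
qed

section \<open>Solutions of the heat equation on a network\<close>

text \<open>
  A solution together with its first and second space derivatives \<open>D1\<close> and \<open>D2\<close> on the edges. Carrying
  the derivatives as witnesses makes linear combinations, time reversal and gluing routine. The sign
  \<open>\<sigma>\<close> is \<open>1\<close> for the forward and \<open>- 1\<close> for the backward equation, which holds up to the ends of the edges.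
\<close>

definition network_heat ::
    "('a::euclidean_space, 'j) network \<Rightarrow> real \<Rightarrow> real \<Rightarrow> ('a \<Rightarrow> real \<Rightarrow> real) \<Rightarrow>
     ('j \<Rightarrow> real \<Rightarrow> real \<Rightarrow> real) \<Rightarrow> ('j \<Rightarrow> real \<Rightarrow> real \<Rightarrow> real) \<Rightarrow> bool" where
  "network_heat N Tmax \<sigma> u D1 D2 \<longleftrightarrow>
     continuous_on (points N \<times> {0..Tmax}) (\<lambda>(x, t). u x t) \<and>
     (\<forall>j\<in>edges N. \<forall>y\<in>{0..len N j}. \<forall>t\<in>{0<..<Tmax}.
        ((\<lambda>z. u (param N j z) t) has_real_derivative D1 j y t) (at y within {0..len N j}) \<and>
        ((\<lambda>z. D1 j z t) has_real_derivative D2 j y t) (at y within {0..len N j}) \<and>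
        ((\<lambda>s. u (param N j y) s) has_real_derivative \<sigma> * D2 j y t) (at t)) \<and>
     (\<forall>j\<in>edges N. continuous_on ({0..len N j} \<times> {0<..<Tmax}) (\<lambda>(y, t). D1 j y t) \<and>
        continuous_on ({0..len N j} \<times> {0<..<Tmax}) (\<lambda>(y, t). D2 j y t)) \<and>
     (\<forall>v\<in>transition_verts N. \<forall>t\<in>{0<..<Tmax}.
        (\<Sum>j\<in>Inc N v. incidence N v j * D1 j (edge_coord N j v) t) = 0)"

lemma derivative_cong_on:
  fixes f g :: "real \<Rightarrow> real"
  assumes "y \<in> S" "\<And>z. z \<in> S \<Longrightarrow> g z = f z" "(f has_real_derivative d) (at y within S)"
  shows "(g has_real_derivative d) (at y within S)"
  using has_field_derivative_transform_within[OF assms(3) zero_less_one assms(1), of g] assms(2) by metis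

lemma network_heat_derivs:
  assumes "network_heat N Tmax \<sigma> u D1 D2" "j \<in> edges N" "y \<in> {0..len N j}" "t \<in> {0<..<Tmax}"
  shows "((\<lambda>z. u (param N j z) t) has_real_derivative D1 j y t) (at y within {0..len N j})"
    "((\<lambda>z. D1 j z t) has_real_derivative D2 j y t) (at y within {0..len N j})"
    "((\<lambda>s. u (param N j y) s) has_real_derivative \<sigma> * D2 j y t) (at t)"
  using assms unfolding network_heat_def by blast+

locale exit_network =
  fixes N :: "('a::euclidean_space, 'j) network" and v0 :: 'a and e0 :: 'j
  assumes network: "is_network N"
    and boundary: "boundary_verts N = {v0}"
    and exit_edge: "Inc N v0 = {e0}" "param N e0 0 = v0"
begin

lemma finite_edges: "finite (edges N)"
  using network by (simp add: is_network_def)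

lemma len_pos: "j \<in> edges N \<Longrightarrow> 0 < len N j"
  using network by (simp add: is_network_def)

lemma param_continuous: "j \<in> edges N \<Longrightarrow> continuous_on {0..len N j} (param N j)"
proof -
  assume "j \<in> edges N"
  then have "\<forall>y\<in>{0..len N j}. nderiv {0..len N j} 0 (param N j) differentiable (at y within {0..len N j})"
    using network unfolding is_network_def smooth_on_def by blast
  then show ?thesis
    by (simp add: continuous_on_eq_continuous_within differentiable_imp_continuous_within)
qed

lemma param_inj: "j \<in> edges N \<Longrightarrow> inj_on (param N j) {0..len N j}"
  using network by (simp add: is_network_def)

lemma param_ends: "j \<in> edges N \<Longrightarrow> param N j 0 \<in> verts N" "j \<in> edges N \<Longrightarrow> param N j (len N j) \<in> verts N"
  using network by (simp_all add: is_network_def)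

lemma param_in_points: "j \<in> edges N \<Longrightarrow> y \<in> {0..len N j} \<Longrightarrow> param N j y \<in> points N"
  unfolding points_def arc_of_def by blast

lemma pointsE:
  assumes "x \<in> points N"
  obtains j y where "j \<in> edges N" "y \<in> {0..len N j}" "x = param N j y"
  using assms unfolding points_def arc_of_def by blast

lemma edge_coord_param: "j \<in> edges N \<Longrightarrow> y \<in> {0..len N j} \<Longrightarrow> edge_coord N j (param N j y) = y"
  unfolding edge_coord_def by (rule the_inv_into_f_f[OF param_inj])

lemma IncD: "j \<in> Inc N v \<Longrightarrow> j \<in> edges N"
  by (simp add: Inc_def)

lemma finite_Inc: "finite (Inc N v)"
  unfolding Inc_def using finite_edges by simp

lemma Inc_ends:
  assumes "v \<in> verts N" "j \<in> Inc N v"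
  shows "param N j 0 = v \<or> param N j (len N j) = v"
proof -
  have j: "j \<in> edges N" using assms(2) by (rule IncD)
  obtain y where y: "y \<in> {0..len N j}" "v = param N j y"
    using assms(2) by (auto simp: Inc_def arc_of_def)
  have "param N j ` {0<..<len N j} \<inter> verts N = {}" using network j by (simp add: is_network_def)
  then have "y \<notin> {0<..<len N j}" using y assms(1) by blast
  then have "y = 0 \<or> y = len N j" using y by auto
  then show ?thesis using y by auto
qed

lemma ends_distinct: "j \<in> edges N \<Longrightarrow> param N j 0 \<noteq> param N j (len N j)"
  using inj_onD[OF param_inj, of j 0 "len N j"] len_pos[of j] by auto

lemma end_in_Inc: "j \<in> edges N \<Longrightarrow> j \<in> Inc N (param N j 0)" "j \<in> edges N \<Longrightarrow> j \<in> Inc N (param N j (len N j))"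
  using len_pos[of j] by (auto simp: Inc_def arc_of_def)

lemma verts_points: "v \<in> verts N \<Longrightarrow> v \<in> points N"
proof -
  assume "v \<in> verts N"
  then have "Inc N v \<noteq> {}" using network by (simp add: is_network_def)
  then show ?thesis by (auto simp: Inc_def points_def)
qed

lemma card_Inc: "v \<in> verts N \<Longrightarrow> 0 < card (Inc N v)"
  using network finite_Inc by (simp add: is_network_def card_gt_0_iff)

lemma v0_vert: "v0 \<in> verts N"
  using boundary unfolding boundary_verts_def by blast

lemma e0_edge: "e0 \<in> edges N"
  using exit_edge(1) IncD by blast

lemma transition_verts_eq: "transition_verts N = verts N - {v0}"
  using boundary by (simp add: transition_verts_def)

lemma compact_arc: "j \<in> edges N \<Longrightarrow> compact (arc_of N j)"
  unfolding arc_of_def by (intro compact_continuous_image param_continuous) auto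

lemma compact_points: "compact (points N)"
  unfolding points_def by (intro compact_UN finite_edges compact_arc)

text \<open>
  The coordinate of the edge \<open>j\<close> measured from its end vertex \<open>v\<close>, extended to all reals: positive
  values point into the edge.
\<close>

definition from_vertex :: "'j \<Rightarrow> 'a \<Rightarrow> real \<Rightarrow> real" where
  "from_vertex j v z = (if param N j 0 = v then z else len N j - z)"

lemma incidence_eq:
  "v \<in> verts N \<Longrightarrow> j \<in> Inc N v \<Longrightarrow> incidence N v j = (if param N j 0 = v then 1 else - 1)"
  using Inc_ends[of v j] by (auto simp: incidence_def Inc_def)

lemma from_vertex_affine:
  "v \<in> verts N \<Longrightarrow> j \<in> Inc N v \<Longrightarrow> from_vertex j v z = from_vertex j v 0 + incidence N v j * z"
  by (simp add: incidence_eq from_vertex_def)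

lemma abs_incidence: "v \<in> verts N \<Longrightarrow> j \<in> Inc N v \<Longrightarrow> \<bar>incidence N v j\<bar> = 1"
  by (simp add: incidence_eq)

lemma from_vertex_0:
  assumes "v \<in> verts N" "j \<in> Inc N v"
  shows "param N j (from_vertex j v 0) = v" "from_vertex j v 0 \<in> {0..len N j}"
  using Inc_ends[OF assms] len_pos[OF IncD[OF assms(2)]] by (auto simp: from_vertex_def)

lemma edge_coord_vertex:
  assumes "v \<in> verts N" "j \<in> Inc N v"
  shows "edge_coord N j v = from_vertex j v 0"
  using edge_coord_param[OF IncD[OF assms(2)] from_vertex_0(2)[OF assms]] from_vertex_0(1)[OF assms] by simp

subsection \<open>Gluing functions on the edges\<close>

text \<open>
  Inverse to restriction to the edges: the value at a point is read off on any edge through it, and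
  \<open>matching\<close> says that at a vertex the choice is irrelevant.
\<close>

definition glue :: "('j \<Rightarrow> real \<Rightarrow> 'b) \<Rightarrow> 'a \<Rightarrow> 'b" where
  "glue U x = (let j = (SOME j. j \<in> Inc N x) in U j (edge_coord N j x))"

definition matching :: "('j \<Rightarrow> real \<Rightarrow> 'b) \<Rightarrow> bool" where
  "matching U \<longleftrightarrow> (\<forall>v\<in>verts N. \<forall>j\<in>Inc N v. \<forall>k\<in>Inc N v. U j (from_vertex j v 0) = U k (from_vertex k v 0))"

lemma glue_param:
  assumes U: "matching U" and j: "j \<in> edges N" and y: "y \<in> {0..len N j}"
  shows "glue U (param N j y) = U j y"
proof -
  let ?x = "param N j y"
  define k where "k = (SOME k. k \<in> Inc N ?x)"
  have jI: "j \<in> Inc N ?x" using j y by (auto simp: Inc_def arc_of_def)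
  then have kI: "k \<in> Inc N ?x" unfolding k_def by (rule someI)
  have g: "glue U ?x = U k (edge_coord N k ?x)" by (simp add: glue_def k_def Let_def)
  show ?thesis
  proof (cases "?x \<in> verts N")
    case True
    have "edge_coord N j ?x = y" by (rule edge_coord_param[OF j y])
    then show ?thesis
      using U True jI kI unfolding g matching_def by (metis edge_coord_vertex)
  next
    case False
    have "arc_of N j \<inter> arc_of N k \<subseteq> verts N" if "j \<noteq> k"
      using network that j IncD[OF kI] by (simp add: is_network_def)
    then have "j = k" using False jI kI by (auto simp: Inc_def)
    then show ?thesis using g edge_coord_param[OF j y] by simp
  qed
qed

lemma glue_continuous:
  assumes U: "\<And>t. t \<in> T \<Longrightarrow> matching (\<lambda>j y. U j y t)" and T: "closed T"
    and c: "\<And>j. j \<in> edges N \<Longrightarrow> continuous_on ({0..len N j} \<times> T) (\<lambda>(y, t). U j y t)"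
  shows "continuous_on (points N \<times> T) (\<lambda>(x, t). glue (\<lambda>j y. U j y t) x)"
proof -
  have "continuous_on (\<Union>j\<in>edges N. arc_of N j \<times> T) (\<lambda>(x, t). glue (\<lambda>j y. U j y t) x)"
  proof (rule continuous_on_closed_Union[OF finite_edges])
    fix j assume j: "j \<in> edges N"
    show "closed (arc_of N j \<times> T)" using compact_arc[OF j] T by (intro closed_Times compact_imp_closed)
    have i: "continuous_on (arc_of N j) (edge_coord N j)"
      unfolding arc_of_def edge_coord_def
      by (rule continuous_on_inv_into[OF param_continuous[OF j] _ param_inj[OF j]]) simp
    have ec: "edge_coord N j x \<in> {0..len N j}" if "x \<in> arc_of N j" for x
      using that edge_coord_param[OF j] by (auto simp: arc_of_def)
    have "continuous_on (arc_of N j \<times> T) (\<lambda>p. (edge_coord N j (fst p), snd p))"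
      by (intro continuous_intros continuous_on_compose2[OF i]) auto
    moreover have "(\<lambda>p. (edge_coord N j (fst p), snd p)) ` (arc_of N j \<times> T) \<subseteq> {0..len N j} \<times> T"
      using ec by auto
    ultimately have "continuous_on (arc_of N j \<times> T) (\<lambda>p. U j (edge_coord N j (fst p)) (snd p))"
      using continuous_on_compose2[OF c[OF j], of "arc_of N j \<times> T" "\<lambda>p. (edge_coord N j (fst p), snd p)"]
      by (simp add: case_prod_unfold)
    then show "continuous_on (arc_of N j \<times> T) (\<lambda>(x, t). glue (\<lambda>j y. U j y t) x)"
    proof (rule continuous_on_eq)
      fix p assume p: "p \<in> arc_of N j \<times> T"
      then obtain y where y: "y \<in> {0..len N j}" "fst p = param N j y" by (auto simp: arc_of_def)
      show "U j (edge_coord N j (fst p)) (snd p) = (\<lambda>(x, t). glue (\<lambda>j y. U j y t) x) p"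
        using p y j glue_param[OF U[of "snd p"] j y(1)] edge_coord_param[OF j y(1)]
        by (auto simp: case_prod_unfold)
    qed
  qed
  moreover have "(\<Union>j\<in>edges N. arc_of N j \<times> T) = points N \<times> T" by (auto simp: points_def)
  ultimately show ?thesis by simp
qed

lemma network_heat_glue:
  assumes U: "\<And>t. t \<in> {0..Tmax} \<Longrightarrow> matching (\<lambda>j y. U j y t)"
    and c: "\<And>j. j \<in> edges N \<Longrightarrow> continuous_on ({0..len N j} \<times> {0..Tmax}) (\<lambda>(y, t). U j y t)"
    and d: "\<And>j y t. j \<in> edges N \<Longrightarrow> y \<in> {0..len N j} \<Longrightarrow> t \<in> {0<..<Tmax} \<Longrightarrow>
        ((\<lambda>z. U j z t) has_real_derivative D1 j y t) (at y within {0..len N j}) \<and>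
        ((\<lambda>z. D1 j z t) has_real_derivative D2 j y t) (at y within {0..len N j}) \<and>
        ((\<lambda>s. U j y s) has_real_derivative \<sigma> * D2 j y t) (at t)"
    and c1: "\<And>j. j \<in> edges N \<Longrightarrow> continuous_on ({0..len N j} \<times> {0<..<Tmax}) (\<lambda>(y, t). D1 j y t)"
    and c2: "\<And>j. j \<in> edges N \<Longrightarrow> continuous_on ({0..len N j} \<times> {0<..<Tmax}) (\<lambda>(y, t). D2 j y t)"
    and k: "\<And>v t. v \<in> verts N \<Longrightarrow> v \<noteq> v0 \<Longrightarrow> t \<in> {0<..<Tmax} \<Longrightarrow>
        (\<Sum>j\<in>Inc N v. incidence N v j * D1 j (from_vertex j v 0) t) = 0"
  shows "network_heat N Tmax \<sigma> (\<lambda>x t. glue (\<lambda>j y. U j y t) x) D1 D2"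
  unfolding network_heat_def
proof (intro conjI ballI)
  show "continuous_on (points N \<times> {0..Tmax}) (\<lambda>(x, t). glue (\<lambda>j y. U j y t) x)"
    by (rule glue_continuous[OF U _ c]) auto
  fix j assume j: "j \<in> edges N"
  show "continuous_on ({0..len N j} \<times> {0<..<Tmax}) (\<lambda>(y, t). D1 j y t)"
    "continuous_on ({0..len N j} \<times> {0<..<Tmax}) (\<lambda>(y, t). D2 j y t)" by (rule c1[OF j], rule c2[OF j])
  fix y t assume y: "y \<in> {0..len N j}" and t: "t \<in> {0<..<Tmax}"
  note dd = d[OF j y t]
  show "((\<lambda>z. glue (\<lambda>j y. U j y t) (param N j z)) has_real_derivative D1 j y t) (at y within {0..len N j})"
    by (rule derivative_cong_on[OF y _ conjunct1[OF dd]])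
      (use glue_param[OF U j] t in auto)
  show "((\<lambda>z. D1 j z t) has_real_derivative D2 j y t) (at y within {0..len N j})" using dd by blast
  show "((\<lambda>s. glue (\<lambda>j y. U j y s) (param N j y)) has_real_derivative \<sigma> * D2 j y t) (at t)"
    by (rule has_field_derivative_transform_within_open[of "\<lambda>s. U j y s" _ _ "{0<..<Tmax}"])
      (use dd t glue_param[OF U j y] in auto)
next
  fix v t assume "v \<in> transition_verts N" and t: "t \<in> {0<..<Tmax}"
  then have v: "v \<in> verts N" "v \<noteq> v0" by (auto simp: transition_verts_eq)
  show "(\<Sum>j\<in>Inc N v. incidence N v j * D1 j (edge_coord N j v) t) = 0"
    using k[OF v t] by (simp add: edge_coord_vertex[OF v(1)])
qed

subsection \<open>Comparison with the derivatives taken along the edges\<close>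

lemma network_heat_edge_deriv:
  assumes u: "network_heat N Tmax \<sigma> u D1 D2" and j: "j \<in> edges N" and y: "y \<in> {0..len N j}" and t: "t \<in> {0<..<Tmax}"
  shows "edge_deriv N j 1 (\<lambda>x. u x t) y = D1 j y t" "edge_deriv N j 2 (\<lambda>x. u x t) y = D2 j y t"
    "deriv (\<lambda>s. u (param N j y) s) t = \<sigma> * D2 j y t"
proof -
  let ?S = "{0..len N j}"
  note d = network_heat_derivs[OF u j _ t]
  have 1: "nderiv ?S 1 (\<lambda>z. u (param N j z) t) y = D1 j y t" if "y \<in> ?S" for y
    using vector_derivative_within_closed_interval[OF len_pos[OF j] that
        d(1)[OF that, unfolded has_real_derivative_iff_has_vector_derivative]] by simp
  show "edge_deriv N j 1 (\<lambda>x. u x t) y = D1 j y t" using 1[OF y] by (simp add: edge_deriv_def)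
  have "(nderiv ?S 1 (\<lambda>z. u (param N j z) t) has_real_derivative D2 j y t) (at y within ?S)"
    by (rule derivative_cong_on[OF y 1 d(2)[OF y]])
  then have "vector_derivative (nderiv ?S 1 (\<lambda>z. u (param N j z) t)) (at y within ?S) = D2 j y t"
    unfolding has_real_derivative_iff_has_vector_derivative
    by (rule vector_derivative_within_closed_interval[OF len_pos[OF j] y])
  then show "edge_deriv N j 2 (\<lambda>x. u x t) y = D2 j y t"
    by (simp add: edge_deriv_def numeral_2_eq_2)
  show "deriv (\<lambda>s. u (param N j y) s) t = \<sigma> * D2 j y t" by (rule DERIV_imp_deriv[OF d(3)[OF y]])
qed

lemma network_heat_vertex_deriv:
  assumes "network_heat N Tmax \<sigma> u D1 D2" "v \<in> verts N" "j \<in> Inc N v" "t \<in> {0<..<Tmax}"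
  shows "vertex_deriv N j 1 (\<lambda>x. u x t) v = D1 j (edge_coord N j v) t"
  unfolding vertex_deriv_def edge_coord_vertex[OF assms(2,3)]
  by (rule network_heat_edge_deriv(1)[OF assms(1) IncD[OF assms(3)] from_vertex_0(2)[OF assms(2,3)] assms(4)])

lemma network_heat_C21:
  assumes u: "network_heat N Tmax \<sigma> u D1 D2"
  shows "C21_edges N Tmax u"
  unfolding C21_edges_def
proof (intro ballI conjI allI impI)
  fix j assume j: "j \<in> edges N"
  note e = network_heat_edge_deriv[OF u j]
  have cu: "continuous_on ({0..len N j} \<times> {0<..<Tmax}) (\<lambda>(y, t). u (param N j y) t)"
  proof -
    have "continuous_on (points N \<times> {0..Tmax}) (\<lambda>(x, t). u x t)" using u by (simp add: network_heat_def)
    from continuous_on_compose2[OF this, of "{0..len N j} \<times> {0<..<Tmax}" "\<lambda>p. (param N j (fst p), snd p)"]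
    show ?thesis using param_in_points[OF j]
      by (force simp: case_prod_unfold intro!: continuous_intros continuous_on_compose2[OF param_continuous[OF j]])
  qed
  have c: "continuous_on ({0..len N j} \<times> {0<..<Tmax}) (\<lambda>(y, t). D1 j y t)"
    "continuous_on ({0..len N j} \<times> {0<..<Tmax}) (\<lambda>(y, t). D2 j y t)"
    using u j by (simp_all add: network_heat_def)
  {
    fix y t assume y: "y \<in> {0..len N j}" and t: "t \<in> {0<..<Tmax}"
    note d = network_heat_derivs[OF u j y t]
    show "(\<lambda>s. u (param N j y) s) differentiable (at t)"
      using d(3) real_differentiable_def by blast
    fix k :: nat assume "k < 2"
    then consider "k = 0" | "k = 1" by linarith
    then show "(\<lambda>z. edge_deriv N j k (\<lambda>x. u x t) z) differentiable (at y within {0..len N j})"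
    proof cases
      case 1
      then show ?thesis using d(1) by (auto simp: edge_deriv_def real_differentiable_def)
    next
      case 2
      have "((\<lambda>z. edge_deriv N j 1 (\<lambda>x. u x t) z) has_real_derivative D2 j y t) (at y within {0..len N j})"
        by (rule derivative_cong_on[OF y _ d(2)]) (rule e(1)[OF _ t])
      then show ?thesis using 2 real_differentiable_def by blast
    qed
  }
  show "continuous_on ({0..len N j} \<times> {0<..<Tmax}) (\<lambda>(y, t). deriv (\<lambda>s. u (param N j y) s) t)"
  proof (rule continuous_on_eq)
    show "continuous_on ({0..len N j} \<times> {0<..<Tmax}) (\<lambda>p. \<sigma> * D2 j (fst p) (snd p))"
      using c(2) by (intro continuous_intros) (simp add: case_prod_unfold)
  qed (use e(3) in auto)
  fix k :: nat assume "k \<le> 2"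
  then consider "k = 0" | "k = 1" | "k = 2" by linarith
  then show "continuous_on ({0..len N j} \<times> {0<..<Tmax}) (\<lambda>(y, t). edge_deriv N j k (\<lambda>x. u x t) y)"
  proof cases
    case 1
    then show ?thesis using cu by (simp add: edge_deriv_def)
  next
    case 2
    show ?thesis unfolding 2 by (rule continuous_on_eq[OF c(1)]) (use e(1) in auto)
  next
    case 3
    show ?thesis unfolding 3 by (rule continuous_on_eq[OF c(2)]) (use e(2) in auto)
  qed
qed

lemma network_heat_kirchhoff:
  assumes "network_heat N Tmax \<sigma> u D1 D2"
  shows "kirchhoff N Tmax u"
  unfolding kirchhoff_def
proof (intro ballI)
  fix v s assume v: "v \<in> transition_verts N" and s: "s \<in> {0<..<Tmax}"
  have "(\<Sum>j\<in>Inc N v. incidence N v j * D1 j (edge_coord N j v) s) = 0"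
    using assms v s unfolding network_heat_def by blast
  moreover have "vertex_deriv N j 1 (\<lambda>x. u x s) v = D1 j (edge_coord N j v) s" if "j \<in> Inc N v" for j
    using network_heat_vertex_deriv[OF assms _ that s] v by (auto simp: transition_verts_eq)
  ultimately show "(\<Sum>j\<in>Inc N v. incidence N v j * vertex_deriv N j 1 (\<lambda>x. u x s) v) = 0"
    by simp
qed

text \<open>
  The equation is required in the interior of the edges only; it extends to their ends because both
  sides are continuous there.
\<close>

lemma network_heat_of_C21:
  assumes c: "continuous_on (points N \<times> {0..Tmax}) (\<lambda>(x, t). u x t)"
    and C: "C21_edges N Tmax u" and K: "kirchhoff N Tmax u"
    and pde: "\<And>j y t. j \<in> edges N \<Longrightarrow> y \<in> {0<..<len N j} \<Longrightarrow> t \<in> {0<..<Tmax} \<Longrightarrow>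
        deriv (\<lambda>s. u (param N j y) s) t = \<sigma> * edge_deriv N j 2 (\<lambda>x. u x t) y"
  shows "network_heat N Tmax \<sigma> u (\<lambda>j y t. edge_deriv N j 1 (\<lambda>x. u x t) y) (\<lambda>j y t. edge_deriv N j 2 (\<lambda>x. u x t) y)"
  unfolding network_heat_def
proof (intro conjI ballI)
  fix j assume j: "j \<in> edges N"
  let ?S = "{0..len N j}"
  show "continuous_on (?S \<times> {0<..<Tmax}) (\<lambda>(y, t). edge_deriv N j 1 (\<lambda>x. u x t) y)"
    and c2: "continuous_on (?S \<times> {0<..<Tmax}) (\<lambda>(y, t). edge_deriv N j 2 (\<lambda>x. u x t) y)"
    using C j unfolding C21_edges_def by auto
  have ct: "continuous_on (?S \<times> {0<..<Tmax}) (\<lambda>(y, t). deriv (\<lambda>s. u (param N j y) s) t)"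
    using C j unfolding C21_edges_def by blast
  fix y t assume y: "y \<in> ?S" and t: "t \<in> {0<..<Tmax}"
  have d: "(\<lambda>z. edge_deriv N j k (\<lambda>x. u x t) z) differentiable (at y within ?S)" if "k < 2" for k
    using C j y t that unfolding C21_edges_def by blast
  have "((\<lambda>z. edge_deriv N j k (\<lambda>x. u x t) z) has_real_derivative edge_deriv N j (Suc k) (\<lambda>x. u x t) y) (at y within ?S)"
    if "k < 2" for k
    using d[OF that] unfolding has_real_derivative_iff_has_vector_derivative vector_derivative_works
    by (simp add: edge_deriv_def[abs_def])
  from this[of 0] this[of 1]
  show "((\<lambda>z. u (param N j z) t) has_real_derivative edge_deriv N j 1 (\<lambda>x. u x t) y) (at y within ?S)"
    "((\<lambda>z. edge_deriv N j 1 (\<lambda>x. u x t) z) has_real_derivative edge_deriv N j 2 (\<lambda>x. u x t) y) (at y within ?S)"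
    by (simp_all add: edge_deriv_def numeral_2_eq_2)
  have "deriv (\<lambda>s. u (param N j y) s) t - \<sigma> * edge_deriv N j 2 (\<lambda>x. u x t) y = 0"
  proof (rule continuous_constant_on_closure[where S="{0<..<len N j}" and
        f="\<lambda>y. deriv (\<lambda>s. u (param N j y) s) t - \<sigma> * edge_deriv N j 2 (\<lambda>x. u x t) y"])
    have cl: "closure {0<..<len N j} = ?S" using len_pos[OF j] by simp
    have "continuous_on ?S (\<lambda>y. deriv (\<lambda>s. u (param N j y) s) t)"
      using continuous_on_compose2[OF ct, of ?S "\<lambda>y. (y, t)"] t by (force intro!: continuous_intros)
    moreover have "continuous_on ?S (\<lambda>y. edge_deriv N j 2 (\<lambda>x. u x t) y)"
      using continuous_on_compose2[OF c2, of ?S "\<lambda>y. (y, t)"] t by (force intro!: continuous_intros)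
    ultimately show "continuous_on (closure {0<..<len N j})
        (\<lambda>y. deriv (\<lambda>s. u (param N j y) s) t - \<sigma> * edge_deriv N j 2 (\<lambda>x. u x t) y)"
      unfolding cl by (intro continuous_intros)
    show "y \<in> closure {0<..<len N j}" using y cl by simp
  qed (use pde[OF j _ t] in auto)
  moreover have "(\<lambda>s. u (param N j y) s) differentiable (at t)"
    using C j y t unfolding C21_edges_def by blast
  ultimately show "((\<lambda>s. u (param N j y) s) has_real_derivative \<sigma> * edge_deriv N j 2 (\<lambda>x. u x t) y) (at t)"
    by (simp add: DERIV_deriv_iff_real_differentiable[symmetric])
next
  fix v t assume "v \<in> transition_verts N" "t \<in> {0<..<Tmax}"
  then show "(\<Sum>j\<in>Inc N v. incidence N v j * edge_deriv N j 1 (\<lambda>x. u x t) (edge_coord N j v)) = 0"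
    using K unfolding kirchhoff_def vertex_deriv_def by blast
qed (rule c)

lemma classical_solution_iff:
  "classical_solution N v0 Tmax c m0 \<phi> \<psi> \<longleftrightarrow>
     (\<exists>D1 D2. network_heat N Tmax (- 1) \<phi> D1 D2) \<and> (\<exists>D1 D2. network_heat N Tmax 1 \<psi> D1 D2) \<and>
     (\<forall>x\<in>points N. \<forall>t\<in>{0..Tmax}. \<phi> x t > 0) \<and>
     (\<forall>x\<in>points N. \<psi> x 0 = m0 x / \<phi> x 0 \<and> \<phi> x Tmax = exp (c Tmax)) \<and>
     (\<forall>s\<in>{0..Tmax}. \<psi> v0 s = 0 \<and> \<phi> v0 s = exp (c s))" (is "?L \<longleftrightarrow> ?R")
proof
  assume L: ?L
  have "network_heat N Tmax (- 1) \<phi> (\<lambda>j y t. edge_deriv N j 1 (\<lambda>x. \<phi> x t) y) (\<lambda>j y t. edge_deriv N j 2 (\<lambda>x. \<phi> x t) y)"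
  proof (rule network_heat_of_C21)
    fix j y t assume "j \<in> edges N" "y \<in> {0<..<len N j}" "t \<in> {0<..<Tmax}"
    then have "- deriv (\<lambda>s. \<phi> (param N j y) s) t - edge_deriv N j 2 (\<lambda>x. \<phi> x t) y = 0"
      using L unfolding classical_solution_def by blast
    then show "deriv (\<lambda>s. \<phi> (param N j y) s) t = - 1 * edge_deriv N j 2 (\<lambda>x. \<phi> x t) y" by linarith
  qed (use L in \<open>auto simp: classical_solution_def\<close>)
  moreover have "network_heat N Tmax 1 \<psi> (\<lambda>j y t. edge_deriv N j 1 (\<lambda>x. \<psi> x t) y) (\<lambda>j y t. edge_deriv N j 2 (\<lambda>x. \<psi> x t) y)"
    by (rule network_heat_of_C21) (use L in \<open>auto simp: classical_solution_def\<close>)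
  ultimately show ?R using L unfolding classical_solution_def by blast
next
  assume R: ?R
  then obtain D1 D2 E1 E2 where h: "network_heat N Tmax (- 1) \<phi> D1 D2" "network_heat N Tmax 1 \<psi> E1 E2" by blast
  have pde: "- deriv (\<lambda>s. \<phi> (param N j y) s) t - edge_deriv N j 2 (\<lambda>x. \<phi> x t) y = 0"
    "deriv (\<lambda>s. \<psi> (param N j y) s) t - edge_deriv N j 2 (\<lambda>x. \<psi> x t) y = 0"
    if "j \<in> edges N" "y \<in> {0<..<len N j}" "t \<in> {0<..<Tmax}" for j y t
    using network_heat_edge_deriv[OF h(1) that(1) _ that(3), of y]
      network_heat_edge_deriv[OF h(2) that(1) _ that(3), of y] that(2) by auto
  have c: "continuous_on (points N \<times> {0..Tmax}) (\<lambda>(x, t). \<phi> x t)"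
      "continuous_on (points N \<times> {0..Tmax}) (\<lambda>(x, t). \<psi> x t)"
    using h by (simp_all add: network_heat_def)
  show ?L
    unfolding classical_solution_def
    using R c pde h[THEN network_heat_C21] h[THEN network_heat_kirchhoff] by blast
qed

subsection \<open>Linear combinations and time reversal\<close>

lemma network_heat_linear:
  assumes u: "network_heat N Tmax \<sigma> u D1 D2" and w: "network_heat N Tmax \<sigma> w E1 E2"
  shows "network_heat N Tmax \<sigma> (\<lambda>x t. a * u x t + b * w x t)
    (\<lambda>j y t. a * D1 j y t + b * E1 j y t) (\<lambda>j y t. a * D2 j y t + b * E2 j y t)"
  unfolding network_heat_def
proof (intro conjI ballI)
  show "continuous_on (points N \<times> {0..Tmax}) (\<lambda>(x, t). a * u x t + b * w x t)"
    using u w unfolding network_heat_def case_prod_unfold by (auto intro!: continuous_intros)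
  fix j assume j: "j \<in> edges N"
  show "continuous_on ({0..len N j} \<times> {0<..<Tmax}) (\<lambda>(y, t). a * D1 j y t + b * E1 j y t)"
    "continuous_on ({0..len N j} \<times> {0<..<Tmax}) (\<lambda>(y, t). a * D2 j y t + b * E2 j y t)"
    using u w j unfolding network_heat_def case_prod_unfold by (auto intro!: continuous_intros)
  fix y t assume y: "y \<in> {0..len N j}" and t: "t \<in> {0<..<Tmax}"
  note d = network_heat_derivs[OF u j y t] and e = network_heat_derivs[OF w j y t]
  show "((\<lambda>z. a * u (param N j z) t + b * w (param N j z) t) has_real_derivative a * D1 j y t + b * E1 j y t) (at y within {0..len N j})"
    "((\<lambda>z. a * D1 j z t + b * E1 j z t) has_real_derivative a * D2 j y t + b * E2 j y t) (at y within {0..len N j})"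
    by (intro DERIV_add DERIV_cmult d e)+
  show "((\<lambda>s. a * u (param N j y) s + b * w (param N j y) s) has_real_derivative \<sigma> * (a * D2 j y t + b * E2 j y t)) (at t)"
    using DERIV_add[OF DERIV_cmult[OF d(3), of a] DERIV_cmult[OF e(3), of b]] by (simp add: algebra_simps)
next
  fix v t assume v: "v \<in> transition_verts N" and t: "t \<in> {0<..<Tmax}"
  have "(\<Sum>j\<in>Inc N v. incidence N v j * D1 j (edge_coord N j v) t) = 0"
     "(\<Sum>j\<in>Inc N v. incidence N v j * E1 j (edge_coord N j v) t) = 0"
    using u w v t unfolding network_heat_def by blast+
  moreover have "(\<Sum>j\<in>Inc N v. incidence N v j * (a * D1 j (edge_coord N j v) t + b * E1 j (edge_coord N j v) t)) =
     a * (\<Sum>j\<in>Inc N v. incidence N v j * D1 j (edge_coord N j v) t) +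
     b * (\<Sum>j\<in>Inc N v. incidence N v j * E1 j (edge_coord N j v) t)"
    by (simp add: sum_distrib_left sum.distrib[symmetric] algebra_simps)
  ultimately show "(\<Sum>j\<in>Inc N v. incidence N v j * (a * D1 j (edge_coord N j v) t + b * E1 j (edge_coord N j v) t)) = 0"
    by simp
qed

lemma network_heat_const: "network_heat N Tmax \<sigma> (\<lambda>x t. c) (\<lambda>j y t. 0) (\<lambda>j y t. 0)"
  unfolding network_heat_def by (auto intro!: continuous_intros)

lemma network_heat_reverse:
  assumes u: "network_heat N Tmax \<sigma> u D1 D2"
  shows "network_heat N Tmax (- \<sigma>) (\<lambda>x t. u x (Tmax - t)) (\<lambda>j y t. D1 j y (Tmax - t)) (\<lambda>j y t. D2 j y (Tmax - t))"
  unfolding network_heat_def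
proof (intro conjI ballI)
  have c: "continuous_on (A \<times> T) (\<lambda>(x, t). f x (Tmax - t))"
    if "continuous_on (A \<times> T) (\<lambda>(x, t). f x t)" "(\<lambda>t. Tmax - t) ` T \<subseteq> T"
    for A :: "'c::topological_space set" and T and f :: "'c \<Rightarrow> real \<Rightarrow> real"
    using continuous_on_compose2[OF that(1), of "A \<times> T" "\<lambda>p. (fst p, Tmax - snd p)"] that(2)
    by (force simp: case_prod_unfold intro!: continuous_intros)
  show "continuous_on (points N \<times> {0..Tmax}) (\<lambda>(x, t). u x (Tmax - t))"
    by (rule c) (use u in \<open>auto simp: network_heat_def\<close>)
  fix j assume j: "j \<in> edges N"
  show "continuous_on ({0..len N j} \<times> {0<..<Tmax}) (\<lambda>(y, t). D1 j y (Tmax - t))"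
    by (rule c) (use u j in \<open>auto simp: network_heat_def\<close>)
  show "continuous_on ({0..len N j} \<times> {0<..<Tmax}) (\<lambda>(y, t). D2 j y (Tmax - t))"
    by (rule c) (use u j in \<open>auto simp: network_heat_def\<close>)
  fix y t assume y: "y \<in> {0..len N j}" and t: "t \<in> {0<..<Tmax}"
  have t': "Tmax - t \<in> {0<..<Tmax}" using t by auto
  note d = network_heat_derivs[OF u j y t']
  show "((\<lambda>z. u (param N j z) (Tmax - t)) has_real_derivative D1 j y (Tmax - t)) (at y within {0..len N j})"
      "((\<lambda>z. D1 j z (Tmax - t)) has_real_derivative D2 j y (Tmax - t)) (at y within {0..len N j})"
    by (fact d)+
  have "((\<lambda>t. Tmax - t) has_real_derivative - 1) (at t)" by (auto intro!: derivative_eq_intros)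
  from DERIV_chain2[OF d(3) this]
  show "((\<lambda>s. u (param N j y) (Tmax - s)) has_real_derivative - \<sigma> * D2 j y (Tmax - t)) (at t)" by simp
next
  fix v t assume v: "v \<in> transition_verts N" and t: "t \<in> {0<..<Tmax}"
  have "Tmax - t \<in> {0<..<Tmax}" using t by auto
  then show "(\<Sum>j\<in>Inc N v. incidence N v j * D1 j (edge_coord N j v) (Tmax - t)) = 0"
    using u v unfolding network_heat_def by blast
qed

end

context exit_network
begin

section \<open>Generalised images\<close>

text \<open>
  Twice the even part about \<open>v\<close>, at distance \<open>z\<close>, of every extension \<open>F j\<close> with \<open>j\<close> at \<open>v\<close>. At a transition
  vertex it must be the same for all edges (continuity), and twice the average is the only choice for
  which the odd parts add up to zero (Kirchhoff). At \<open>v0\<close> the even part is the given function \<open>q\<close>, which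
  fixes the boundary values; \<open>q = 0\<close> is the classical odd reflection.
\<close>

definition scatter :: "(real \<Rightarrow> real) \<Rightarrow> ('j \<Rightarrow> real \<Rightarrow> real) \<Rightarrow> 'a \<Rightarrow> real \<Rightarrow> real" where
  "scatter q F v z = (if v = v0 then 2 * q z
     else 2 / real (card (Inc N v)) * (\<Sum>k\<in>Inc N v. F k (from_vertex k v z)))"

definition reflecting :: "(real \<Rightarrow> real) \<Rightarrow> ('j \<Rightarrow> real \<Rightarrow> real) \<Rightarrow> bool" where
  "reflecting q F \<longleftrightarrow> (\<forall>v\<in>verts N. \<forall>j\<in>Inc N v. \<forall>z\<ge>0.
     F j (from_vertex j v (- z)) = scatter q F v z - F j (from_vertex j v z))"

abbreviation image_flow :: "('j \<Rightarrow> real \<Rightarrow> real) \<Rightarrow> 'a \<Rightarrow> real \<Rightarrow> real" where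
  "image_flow F \<equiv> \<lambda>x t. glue (\<lambda>j y. heat (F j) y t) x"

text \<open>
  The value and the slope at a vertex depend only on the even and on the odd parts of the extensions
  about it (\<open>heat_even_part\<close>, \<open>heat_x_even_sum\<close>), and the reflection law prescribes exactly these.
\<close>

lemma image_solution:
  assumes F: "\<And>j. j \<in> edges N \<Longrightarrow> tame (F j)" and R: "reflecting q F"
  shows "network_heat N Tmax 1 (image_flow F) (\<lambda>j. heat_x (F j)) (\<lambda>j. heat_xx (F j))"
    and "0 \<le> t \<Longrightarrow> matching (\<lambda>j y. heat (F j) y t)"
    and "0 < t \<Longrightarrow> heat (F e0) 0 t = heat (\<lambda>z. q \<bar>z\<bar>) 0 t"
proof -
  define G where "G v k z = F k (from_vertex k v z)" for v k z
  have G_affine: "G v k = (\<lambda>z. F k (from_vertex k v 0 + incidence N v k * z))"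
    if "v \<in> verts N" "k \<in> Inc N v" for v k
    unfolding G_def by (rule ext) (rule arg_cong[OF from_vertex_affine[OF that]])
  have G_tame: "tame (G v k)" if "v \<in> verts N" "k \<in> Inc N v" for v k
    unfolding G_affine[OF that] by (rule tame_affine[OF F abs_incidence[OF that]]) (rule IncD[OF that(2)])
  have G_heat: "heat (F k) (from_vertex k v 0) t = heat (G v k) 0 t"
      "incidence N v k * heat_x (F k) (from_vertex k v 0) t = heat_x (G v k) 0 t"
    if "v \<in> verts N" "k \<in> Inc N v" "0 < t" for v k t
    unfolding G_affine[OF that(1,2)] using heat_affine[OF abs_incidence[OF that(1,2)] that(3)] by simp_all
  have G_refl: "G v k z + G v k (- z) = scatter q F v \<bar>z\<bar>" if "v \<in> verts N" "k \<in> Inc N v" for v k z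
  proof -
    have "G v k (- \<bar>z\<bar>) = scatter q F v \<bar>z\<bar> - G v k \<bar>z\<bar>"
      unfolding G_def using R that abs_ge_zero[of z] unfolding reflecting_def by blast
    then show ?thesis by (cases "0 \<le> z") (simp_all add: abs_of_neg)
  qed
  have val: "heat (F k) (from_vertex k v 0) t = heat (\<lambda>z. scatter q F v \<bar>z\<bar>) 0 t / 2"
    if "v \<in> verts N" "k \<in> Inc N v" "0 < t" for v k t
    unfolding G_heat(1)[OF that] by (rule heat_even_part[OF G_tame[OF that(1,2)] that(3) G_refl[OF that(1,2)]])
  have val0: "F k (from_vertex k v 0) = scatter q F v 0 / 2" if "v \<in> verts N" "k \<in> Inc N v" for v k
    using G_refl[OF that, of 0] by (simp add: G_def)
  show match: "matching (\<lambda>j y. heat (F j) y t)" if "0 \<le> t" for t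
  proof (cases "t = 0")
    case True
    show ?thesis unfolding matching_def True heat_0 using val0 by metis
  next
    case False
    then have "0 < t" using that by simp
    from val[OF _ _ this] show ?thesis unfolding matching_def by metis
  qed
  have "from_vertex e0 v0 0 = 0" by (simp add: from_vertex_def exit_edge)
  moreover have "heat (\<lambda>z. 2 * q \<bar>z\<bar>) 0 t = 2 * heat (\<lambda>z. q \<bar>z\<bar>) 0 t"
    unfolding heat_def by (subst integral_mult_right_zero[symmetric]) (simp only: mult_ac)
  ultimately show "heat (F e0) 0 t = heat (\<lambda>z. q \<bar>z\<bar>) 0 t" if "0 < t"
    using val[OF v0_vert _ that, of e0] exit_edge(1) by (simp add: scatter_def)
  show "network_heat N Tmax 1 (image_flow F) (\<lambda>j. heat_x (F j)) (\<lambda>j. heat_xx (F j))"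
  proof (rule network_heat_glue)
    fix j assume j: "j \<in> edges N"
    show "continuous_on ({0..len N j} \<times> {0..Tmax}) (\<lambda>(y, t). heat (F j) y t)"
      by (rule continuous_on_subset[OF heat_continuous[OF F[OF j]]]) auto
    show "continuous_on ({0..len N j} \<times> {0<..<Tmax}) (\<lambda>(y, t). heat_x (F j) y t)"
      by (rule continuous_on_subset[OF heat_x_continuous(1)[OF F[OF j]]]) auto
    show "continuous_on ({0..len N j} \<times> {0<..<Tmax}) (\<lambda>(y, t). heat_xx (F j) y t)"
      by (rule continuous_on_subset[OF heat_x_continuous(2)[OF F[OF j]]]) auto
    fix y t assume "y \<in> {0..len N j}" and t: "t \<in> {0<..<Tmax}"
    have t: "0 < t" using t by simp
    show "((\<lambda>z. heat (F j) z t) has_real_derivative heat_x (F j) y t) (at y within {0..len N j}) \<and>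
        ((\<lambda>z. heat_x (F j) z t) has_real_derivative heat_xx (F j) y t) (at y within {0..len N j}) \<and>
        ((\<lambda>s. heat (F j) y s) has_real_derivative 1 * heat_xx (F j) y t) (at t)"
      using heat_space_deriv[OF F[OF j] t] heat_time_deriv[OF F[OF j] t]
      by (auto intro: has_field_derivative_at_within)
  next
    fix v t assume v: "v \<in> verts N" "v \<noteq> v0" and t: "t \<in> {0<..<Tmax}"
    have S: "scatter q F v \<bar>z\<bar> = 2 / real (card (Inc N v)) * (\<Sum>k\<in>Inc N v. G v k \<bar>z\<bar>)" for z
      using v by (simp add: scatter_def G_def)
    have 1: "(\<Sum>k\<in>Inc N v. G v k (- \<bar>z\<bar>)) = (\<Sum>k\<in>Inc N v. G v k \<bar>z\<bar>)" for z
    proof -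
      have "(\<Sum>k\<in>Inc N v. G v k (- \<bar>z\<bar>)) = (\<Sum>k\<in>Inc N v. scatter q F v \<bar>z\<bar> - G v k \<bar>z\<bar>)"
        using G_refl[OF v(1), of _ "\<bar>z\<bar>"] by (intro sum.cong) (auto simp: algebra_simps)
      also have "\<dots> = real (card (Inc N v)) * scatter q F v \<bar>z\<bar> - (\<Sum>k\<in>Inc N v. G v k \<bar>z\<bar>)"
        by (simp add: sum_subtractf)
      also have "\<dots> = (\<Sum>k\<in>Inc N v. G v k \<bar>z\<bar>)"
        using card_Inc[OF v(1)] by (simp add: S)
      finally show ?thesis .
    qed
    have "(\<Sum>k\<in>Inc N v. G v k z) = (\<Sum>k\<in>Inc N v. G v k (- z))" for z
      using 1[of z] by (cases "0 \<le> z") simp_all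
    then have "(\<Sum>k\<in>Inc N v. heat_x (G v k) 0 t) = 0"
      using t G_tame[OF v(1)] by (intro heat_x_even_sum) auto
    then show "(\<Sum>j\<in>Inc N v. incidence N v j * heat_x (F j) (from_vertex j v 0) t) = 0"
      using G_heat(2)[OF v(1)] t by simp
  qed (use match in auto)
qed

subsection \<open>Existence of reflecting extensions\<close>

text \<open>
  Iterated reflection of the values \<open>u\<close> on the edges. The start, constant outside the edge, serves to
  have continuous functions throughout; after \<open>n\<close> steps the values within distance \<open>n * min_len\<close> of the edge are
  final (\<open>images_stable\<close>).
\<close>

primrec images :: "('j \<Rightarrow> real \<Rightarrow> real) \<Rightarrow> (real \<Rightarrow> real) \<Rightarrow> nat \<Rightarrow> 'j \<Rightarrow> real \<Rightarrow> real" where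
  "images u q 0 = (\<lambda>j y. u j (max 0 (min (len N j) y)))"
| "images u q (Suc n) = (\<lambda>j y.
     if y < 0 then scatter q (images u q n) (param N j 0) (- y) - images u q n j (- y)
     else if y > len N j then scatter q (images u q n) (param N j (len N j)) (y - len N j)
       - images u q n j (len N j - (y - len N j))
     else u j y)"

definition min_len :: real where "min_len = Min (len N ` edges N)"
definition max_len :: real where "max_len = Max (len N ` edges N)"

lemma min_len: "0 < min_len" "j \<in> edges N \<Longrightarrow> min_len \<le> len N j"
proof -
  show "0 < min_len"
    unfolding min_len_def using finite_edges e0_edge len_pos by (subst Min_gr_iff) auto
  show "j \<in> edges N \<Longrightarrow> min_len \<le> len N j"
    unfolding min_len_def using finite_edges by simp
qed

lemma max_len: "0 < max_len" "j \<in> edges N \<Longrightarrow> len N j \<le> max_len"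
proof -
  show "j \<in> edges N \<Longrightarrow> len N j \<le> max_len" for j unfolding max_len_def using finite_edges by auto
  from this[OF e0_edge] show "0 < max_len" using len_pos[OF e0_edge] by simp
qed

lemma images_on_edge: "j \<in> edges N \<Longrightarrow> y \<in> {0..len N j} \<Longrightarrow> images u q n j y = u j y"
  by (cases n) (auto simp: max_def min_def)

lemma scatter_cong:
  assumes "\<And>k. k \<in> Inc N v \<Longrightarrow> F k (from_vertex k v z) = G k (from_vertex k v z)"
  shows "scatter q F v z = scatter q G v z"
  unfolding scatter_def using assms by simp

text \<open>
  A point at distance \<open>z \<le> (n + 1) * min_len\<close> beyond a vertex receives its value from points at distance
  \<open>z\<close> inside the edges at that vertex, and since every edge has length at least \<open>min_len\<close>, those overshoot
  the far end by at most \<open>n * min_len\<close>.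
\<close>

lemma images_stable:
  assumes "n \<le> m" "j \<in> edges N" "- (real n * min_len) \<le> y" "y \<le> len N j + real n * min_len"
  shows "images u q m j y = images u q n j y"
  using assms
proof (induction n arbitrary: m j y)
  case 0
  then show ?case using images_on_edge[of j y u q] by simp
next
  case (Suc n)
  then obtain m' where m: "m = Suc m'" "n \<le> m'" by (cases m) auto
  have in_range: "images u q m' k (from_vertex k v z) = images u q n k (from_vertex k v z)"
    if "0 \<le> z" "z \<le> real (Suc n) * min_len" "k \<in> edges N" for k v z
  proof (rule Suc.IH[OF m(2) that(3)])
    have "0 \<le> real n * min_len" using min_len(1) by simp
    moreover have "z \<le> min_len + real n * min_len" using that(2) by (simp add: algebra_simps)
    ultimately show "- (real n * min_len) \<le> from_vertex k v z" "from_vertex k v z \<le> len N k + real n * min_len"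
      using that(1) min_len(2)[OF that(3)] len_pos[OF that(3)] by (auto simp: from_vertex_def)
  qed
  have sc: "scatter q (images u q m') v z = scatter q (images u q n) v z"
    if "0 \<le> z" "z \<le> real (Suc n) * min_len" for v z
    by (rule scatter_cong) (rule in_range[OF that IncD])
  have j: "j \<in> edges N" by (rule Suc.prems)
  consider "y < 0" | "len N j < y" | "y \<in> {0..len N j}" by force
  then show ?case
  proof cases
    case 1
    have "images u q m' j (- y) = images u q n j (- y)"
      using in_range[of "- y" j "param N j 0"] 1 Suc.prems j by (simp add: from_vertex_def)
    then show ?thesis using sc[of "- y"] 1 Suc.prems by (simp add: m)
  next
    case 2
    have "images u q m' j (len N j - (y - len N j)) = images u q n j (len N j - (y - len N j))"
      using in_range[of "y - len N j" j "param N j (len N j)"] 2 Suc.prems j ends_distinct[OF j]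
      by (simp add: from_vertex_def)
    then show ?thesis using sc[of "y - len N j"] 2 Suc.prems len_pos[OF j] by (simp add: m)
  next
    case 3
    then show ?thesis using images_on_edge[OF j 3] by metis
  qed
qed

definition image_extension :: "('j \<Rightarrow> real \<Rightarrow> real) \<Rightarrow> (real \<Rightarrow> real) \<Rightarrow> 'j \<Rightarrow> real \<Rightarrow> real" where
  "image_extension u q j y = images u q (nat \<lceil>\<bar>y\<bar> / min_len\<rceil>) j y"

lemma image_extension_eq:
  assumes j: "j \<in> edges N" and y: "\<bar>y\<bar> \<le> real n * min_len"
  shows "image_extension u q j y = images u q n j y"
proof -
  let ?k = "nat \<lceil>\<bar>y\<bar> / min_len\<rceil>"
  have "\<bar>y\<bar> / min_len \<le> real ?k" by linarith
  then have k: "\<bar>y\<bar> \<le> real ?k * min_len" using min_len(1) pos_divide_le_eq by blast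
  have *: "- (real i * min_len) \<le> y \<and> y \<le> len N j + real i * min_len" if "\<bar>y\<bar> \<le> real i * min_len" for i
    using that len_pos[OF j] by (auto simp: abs_le_iff)
  show ?thesis
  proof (cases "n \<le> ?k")
    case True
    then show ?thesis using images_stable[OF True j, of y u q] *[OF y] by (simp add: image_extension_def)
  next
    case False
    then have "?k \<le> n" by linarith
    from images_stable[OF this j, of y u q] *[OF k] show ?thesis
      unfolding image_extension_def by metis
  qed
qed

lemma image_extension_on_edge:
  "j \<in> edges N \<Longrightarrow> y \<in> {0..len N j} \<Longrightarrow> image_extension u q j y = u j y"
  unfolding image_extension_def by (rule images_on_edge)

context
  fixes u :: "'j \<Rightarrow> real \<Rightarrow> real" and q :: "real \<Rightarrow> real"
  assumes u_match: "matching u" and u_cont: "\<And>j. j \<in> edges N \<Longrightarrow> continuous_on {0..len N j} (u j)"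
    and q: "tame q" "q 0 = u e0 0"
begin

text \<open>
  The two sides of a reflection agree at the vertex itself: this is where the continuity of the data
  on the network and the compatibility \<open>q 0 = u e0 0\<close> enter.
\<close>

lemma scatter_images_0:
  assumes v: "v \<in> verts N" and j: "j \<in> Inc N v"
  shows "scatter q (images u q n) v 0 = 2 * u j (from_vertex j v 0)"
proof (cases "v = v0")
  case True
  then have "j = e0" using j exit_edge by simp
  then show ?thesis using True q(2) exit_edge by (simp add: scatter_def from_vertex_def)
next
  case False
  have "images u q n k (from_vertex k v 0) = u j (from_vertex j v 0)" if k: "k \<in> Inc N v" for k
    using images_on_edge[OF IncD[OF k] from_vertex_0(2)[OF v k]] u_match v j k
    unfolding matching_def by metis
  then show ?thesis using False card_Inc[OF v] by (simp add: scatter_def)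
qed

lemma images_continuous: "j \<in> edges N \<Longrightarrow> continuous_on UNIV (images u q n j)"
proof (induction n arbitrary: j)
  case 0
  have "(\<lambda>y. max 0 (min (len N j) y)) ` UNIV \<subseteq> {0..len N j}" using len_pos[OF 0] by auto
  then show ?case
    unfolding images.simps
    by (intro continuous_on_compose2[OF u_cont[OF 0]] continuous_intros) auto
next
  case (Suc n)
  note j = Suc.prems
  have sc: "continuous_on UNIV (scatter q (images u q n) v)" for v
  proof -
    have "continuous_on UNIV (\<lambda>z. images u q n k (from_vertex k v z))" if "k \<in> Inc N v" for k
    proof (rule continuous_on_compose2[OF Suc.IH[OF IncD[OF that]]])
      show "continuous_on UNIV (from_vertex k v)"
        by (cases "param N k 0 = v") (simp_all add: from_vertex_def[abs_def] continuous_intros)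
    qed simp
    then have "continuous_on UNIV (\<lambda>z. 2 / real (card (Inc N v)) * (\<Sum>k\<in>Inc N v. images u q n k (from_vertex k v z)))"
      by (intro continuous_on_mult_left continuous_on_sum)
    moreover have "continuous_on UNIV (\<lambda>z. 2 * q z)"
      using q(1) unfolding tame_def by (auto intro!: continuous_intros)
    ultimately show ?thesis unfolding scatter_def[abs_def] by (cases "v = v0") simp_all
  qed
  let ?A = "\<lambda>y. scatter q (images u q n) (param N j 0) (- y) - images u q n j (- y)"
  let ?B = "\<lambda>y. scatter q (images u q n) (param N j (len N j)) (y - len N j) - images u q n j (len N j - (y - len N j))"
  have cA: "continuous_on {..0} ?A" and cB: "continuous_on {len N j..} ?B"
    by (intro continuous_intros continuous_on_compose2[OF sc] continuous_on_compose2[OF Suc.IH[OF j]]; simp)+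
  have A0: "?A 0 = u j 0"
    using scatter_images_0[OF param_ends(1)[OF j] end_in_Inc(1)[OF j], of n]
      images_on_edge[OF j, of 0] len_pos[OF j] by (simp add: from_vertex_def)
  have B0: "?B (len N j) = u j (len N j)"
    using scatter_images_0[OF param_ends(2)[OF j] end_in_Inc(2)[OF j], of n] ends_distinct[OF j]
      images_on_edge[OF j, of "len N j"] len_pos[OF j] by (simp add: from_vertex_def)
  have 1: "continuous_on ({0..len N j} \<union> {len N j..}) (\<lambda>y. if y > len N j then ?B y else u j y)"
    by (rule continuous_on_eq[OF continuous_on_If[OF _ _ u_cont[OF j] cB, of "\<lambda>y. y \<le> len N j"]])
      (use B0 len_pos[OF j] in auto)
  have "continuous_on ({..0} \<union> ({0..len N j} \<union> {len N j..})) (\<lambda>y. if y < 0 then ?A y else if y > len N j then ?B y else u j y)"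
    by (rule continuous_on_eq[OF continuous_on_If[OF _ _ cA 1, of "\<lambda>y. y < 0"]])
      (use A0 len_pos[OF j] in \<open>auto split: if_splits\<close>)
  moreover have "{..0} \<union> ({0..len N j} \<union> {len N j..}) = UNIV" by auto
  ultimately show ?case by simp
qed

lemma scatter_bound:
  assumes "v \<in> verts N" "\<And>k. k \<in> Inc N v \<Longrightarrow> \<bar>F k (from_vertex k v z)\<bar> \<le> B" "\<bar>q z\<bar> \<le> A"
  shows "\<bar>scatter q F v z\<bar> \<le> 2 * max A B"
proof (cases "v = v0")
  case False
  have "\<bar>\<Sum>k\<in>Inc N v. F k (from_vertex k v z)\<bar> \<le> real (card (Inc N v)) * B"
    using sum_norm_bound[of "Inc N v" "\<lambda>k. F k (from_vertex k v z)" B] assms(2) by simp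
  then have "2 / real (card (Inc N v)) * \<bar>\<Sum>k\<in>Inc N v. F k (from_vertex k v z)\<bar>
      \<le> 2 / real (card (Inc N v)) * (real (card (Inc N v)) * B)"
    by (intro mult_left_mono) auto
  then have "\<bar>scatter q F v z\<bar> \<le> 2 / real (card (Inc N v)) * (real (card (Inc N v)) * B)"
    using False unfolding scatter_def by (simp add: abs_mult)
  also have "\<dots> = 2 * B" using card_Inc[OF assms(1)] by simp
  finally show ?thesis by simp
qed (use assms(3) in \<open>simp add: scatter_def abs_mult\<close>)

text \<open>
  Each reflection multiplies the bound by at most \<open>K\<close>, and about \<open>\<bar>y\<bar> / min_len\<close> reflections are needed
  to reach \<open>y\<close>; hence exponential growth.
\<close>

lemma image_extension_tame:
  assumes j: "j \<in> edges N"
  shows "tame (image_extension u q j)"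
proof -
  obtain A k where A: "0 \<le> A" "0 \<le> k" "\<And>z. \<bar>q z\<bar> \<le> A * exp (k * \<bar>z\<bar>)"
    using tame_bound[OF q(1)] by blast
  have "\<exists>B. \<forall>j\<in>edges N. \<forall>y\<in>{0..len N j}. \<bar>u j y\<bar> \<le> B"
  proof -
    have "\<forall>j\<in>edges N. \<exists>B. \<forall>y\<in>{0..len N j}. \<bar>u j y\<bar> \<le> B"
    proof
      fix j assume "j \<in> edges N"
      then have "bounded (u j ` {0..len N j})"
        by (intro compact_imp_bounded compact_continuous_image u_cont) auto
      then show "\<exists>B. \<forall>y\<in>{0..len N j}. \<bar>u j y\<bar> \<le> B" by (auto simp: bounded_iff)
    qed
    then obtain B where B: "\<And>j y. j \<in> edges N \<Longrightarrow> y \<in> {0..len N j} \<Longrightarrow> \<bar>u j y\<bar> \<le> B j" by metis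
    have "\<bar>u j y\<bar> \<le> Max (B ` edges N)" if "j \<in> edges N" "y \<in> {0..len N j}" for j y
      using B[OF that] finite_edges that by (meson Max_ge finite_imageI imageI order_trans)
    then show ?thesis by blast
  qed
  then obtain B where B: "\<And>j y. j \<in> edges N \<Longrightarrow> y \<in> {0..len N j} \<Longrightarrow> \<bar>u j y\<bar> \<le> B" by blast
  define C where "C = max A B"
  \<comment> \<open>A reflection combines twice the values on the edges or of \<open>q\<close> with one more value; arguments grow by at most \<open>max_len\<close>.\<close>
  define K where "K = 3 * exp (k * max_len) + 2"
  have C: "0 \<le> C" "A \<le> C" "B \<le> C" using A(1) by (auto simp: C_def)
  have K: "1 \<le> K" by (simp add: K_def add_increasing)
  have bound: "\<bar>images u q n j y\<bar> \<le> C * K ^ n * exp (k * \<bar>y\<bar>)" if "j \<in> edges N" for n j y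
    using that
  proof (induction n arbitrary: j y)
    case 0
    have "\<bar>images u q 0 j y\<bar> \<le> C"
      using B[OF 0, of "max 0 (min (len N j) y)"] len_pos[OF 0] C by auto
    also have "C \<le> C * exp (k * \<bar>y\<bar>)" using C A(2) by (simp add: mult_le_cancel_left1)
    finally show ?case by simp
  next
    case (Suc n)
    note j = Suc.prems
    let ?M = "C * K ^ n * exp (k * max_len) * exp (k * \<bar>y\<bar>)"
    have near: "\<bar>images u q n i x\<bar> \<le> ?M" if "i \<in> edges N" "\<bar>x\<bar> \<le> max_len + \<bar>y\<bar>" for i x
    proof -
      have "exp (k * \<bar>x\<bar>) \<le> exp (k * (max_len + \<bar>y\<bar>))" using that(2) A(2) by (simp add: mult_left_mono)
      then have "C * K ^ n * exp (k * \<bar>x\<bar>) \<le> C * K ^ n * exp (k * (max_len + \<bar>y\<bar>))"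
        using C K by (intro mult_left_mono) auto
      then show ?thesis using Suc.IH[OF that(1), of x] by (simp add: exp_add algebra_simps)
    qed
    have 1: "C * exp (k * \<bar>y\<bar>) \<le> C * K ^ n * exp (k * \<bar>y\<bar>)"
      using C one_le_power[OF K, of n] by (intro mult_right_mono) (auto simp: mult_le_cancel_left1)
    have step: "\<bar>scatter q (images u q n) v z - images u q n j x\<bar> \<le> C * K ^ Suc n * exp (k * \<bar>y\<bar>)"
      if v: "v \<in> verts N" and z: "0 \<le> z" "z \<le> \<bar>y\<bar>" and x: "\<bar>x\<bar> \<le> max_len + \<bar>y\<bar>" for v z x
    proof -
      have qz: "\<bar>q z\<bar> \<le> C * exp (k * \<bar>y\<bar>)"
      proof -
        have "exp (k * \<bar>z\<bar>) \<le> exp (k * \<bar>y\<bar>)" using z A(2) by (simp add: mult_left_mono)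
        then show ?thesis using A(3)[of z] C A(1) by (meson mult_mono' exp_ge_zero order_trans)
      qed
      have "\<bar>scatter q (images u q n) v z\<bar> \<le> 2 * max (C * exp (k * \<bar>y\<bar>)) ?M"
      proof (rule scatter_bound[OF v _ qz])
        fix i assume i: "i \<in> Inc N v"
        show "\<bar>images u q n i (from_vertex i v z)\<bar> \<le> ?M"
          by (rule near[OF IncD[OF i]])
            (use z max_len(2)[OF IncD[OF i]] len_pos[OF IncD[OF i]] in \<open>auto simp: from_vertex_def abs_le_iff\<close>)
      qed
      also have "\<dots> \<le> 2 * (C * exp (k * \<bar>y\<bar>)) + 2 * ?M" using C K by (simp add: max_def)
      finally have "\<bar>scatter q (images u q n) v z - images u q n j x\<bar> \<le> 2 * (C * exp (k * \<bar>y\<bar>)) + 3 * ?M"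
        using near[OF j x] by linarith
      also have "\<dots> \<le> 2 * (C * K ^ n * exp (k * \<bar>y\<bar>)) + 3 * ?M" using 1 by simp
      also have "\<dots> = C * K ^ Suc n * exp (k * \<bar>y\<bar>)" by (simp add: K_def algebra_simps)
      finally show ?thesis .
    qed
    consider "y < 0" | "len N j < y" | "y \<in> {0..len N j}" by force
    then show ?case
    proof cases
      case 1
      then show ?thesis using step[OF param_ends(1)[OF j], of "- y" "- y"] max_len(1) by simp
    next
      case 2
      then show ?thesis using step[OF param_ends(2)[OF j], of "y - len N j" "len N j - (y - len N j)"]
          max_len(2)[OF j] len_pos[OF j] by (auto simp: abs_le_iff)
    next
      case 3
      have "\<bar>u j y\<bar> \<le> C" using B[OF j 3] C by simp
      also have "C = C * 1 * 1" by simp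
      also have "\<dots> \<le> C * K ^ Suc n * exp (k * \<bar>y\<bar>)"
        using C K A(2) by (intro mult_mono one_le_power) auto
      finally show ?thesis using images_on_edge[OF j 3, of u q "Suc n"] by simp
    qed
  qed
  have "\<bar>image_extension u q j y\<bar> \<le> C * K * exp ((ln K / min_len + k) * \<bar>y\<bar>)" for y
  proof -
    let ?n = "nat \<lceil>\<bar>y\<bar> / min_len\<rceil>"
    have n: "real ?n \<le> \<bar>y\<bar> / min_len + 1" using min_len(1) by (simp add: of_nat_nat)
    have "K ^ ?n = exp (real ?n * ln K)" using K by (simp add: exp_of_nat_mult)
    also have "\<dots> \<le> exp ((\<bar>y\<bar> / min_len + 1) * ln K)" using n K by (simp add: mult_right_mono)
    also have "\<dots> = K * exp (ln K / min_len * \<bar>y\<bar>)" using K by (simp add: exp_add algebra_simps)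
    finally have Kn: "K ^ ?n \<le> K * exp (ln K / min_len * \<bar>y\<bar>)" .
    have "\<bar>image_extension u q j y\<bar> \<le> C * K ^ ?n * exp (k * \<bar>y\<bar>)"
      unfolding image_extension_def by (rule bound[OF j])
    also have "\<dots> \<le> C * (K * exp (ln K / min_len * \<bar>y\<bar>)) * exp (k * \<bar>y\<bar>)"
      using C by (intro mult_right_mono mult_left_mono Kn) auto
    also have "\<dots> = C * K * exp ((ln K / min_len + k) * \<bar>y\<bar>)" by (simp add: distrib_right exp_add)
    finally show ?thesis .
  qed
  moreover have "isCont (image_extension u q j) y" for y
  proof -
    obtain n where n: "\<bar>y\<bar> / min_len < real n" using reals_Archimedean2 by blast
    then have y: "y \<in> {- (real n * min_len)<..<real n * min_len}"
      using min_len(1) by (auto simp: field_simps abs_less_iff)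
    have "isCont (images u q n j) y"
      using images_continuous[OF j] by (simp add: continuous_on_eq_continuous_at)
    moreover have "eventually (\<lambda>z. image_extension u q j z = images u q n j z) (nhds y)"
      using eventually_nhds_in_open[OF _ y]
      by (auto elim!: eventually_mono intro!: image_extension_eq[OF j])
    ultimately show ?thesis by (simp add: isCont_cong)
  qed
  ultimately show ?thesis
    unfolding tame_def by (auto simp: continuous_on_eq_continuous_at)
qed

lemma image_extension_reflecting: "reflecting q (image_extension u q)"
  unfolding reflecting_def
proof (intro ballI allI impI)
  fix v j and z :: real assume v: "v \<in> verts N" and jI: "j \<in> Inc N v" and z: "0 \<le> z"
  have j: "j \<in> edges N" by (rule IncD[OF jI])
  obtain n where n: "(max_len + z) / min_len < real n" using reals_Archimedean2 by blast
  then have n: "max_len + z \<le> real n * min_len" using min_len(1) by (simp add: field_simps)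
  have E: "image_extension u q k (from_vertex k v x) = images u q m k (from_vertex k v x)"
    if "k \<in> edges N" "\<bar>x\<bar> \<le> z" "n \<le> m" for k x m
  proof (rule image_extension_eq[OF that(1)])
    have "\<bar>from_vertex k v x\<bar> \<le> max_len + z"
      using that(2) max_len(2)[OF that(1)] len_pos[OF that(1)] by (auto simp: from_vertex_def abs_le_iff)
    also have "\<dots> \<le> real n * min_len" by (rule n)
    also have "\<dots> \<le> real m * min_len" using that(3) min_len(1) by simp
    finally show "\<bar>from_vertex k v x\<bar> \<le> real m * min_len" .
  qed
  have sc: "scatter q (image_extension u q) v z = scatter q (images u q n) v z"
    by (rule scatter_cong) (use E[OF IncD] z in auto)
  have "images u q (Suc n) j (from_vertex j v (- z)) = scatter q (images u q n) v z - images u q n j (from_vertex j v z)"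
  proof (cases "z = 0")
    case True
    then show ?thesis
      using scatter_images_0[OF v jI, of n] images_on_edge[OF j from_vertex_0(2)[OF v jI]] by (simp del: images.simps)
  next
    case False
    show ?thesis
    proof (cases "param N j 0 = v")
      case True
      then show ?thesis using z False by (simp add: from_vertex_def)
    next
      case False': False
      then have "param N j (len N j) = v" using Inc_ends[OF v jI] by simp
      then show ?thesis using z False False' len_pos[OF j] by (simp add: from_vertex_def)
    qed
  qed
  then show "image_extension u q j (from_vertex j v (- z)) =
      scatter q (image_extension u q) v z - image_extension u q j (from_vertex j v z)"
    using E[OF j, of "- z" "Suc n"] E[OF j, of z n] sc z by simp
qed

end

end

section \<open>The maximum principle\<close>

text \<open>
  The point may be an end of the interval: what makes the second derivative test work there is the
  vanishing of the one-sided first derivative.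
\<close>

lemma second_derivative_at_min:
  fixes f D1 :: "real \<Rightarrow> real"
  assumes l: "0 < l" and y: "y \<in> {0..l}"
    and d1: "\<And>z. z \<in> {0..l} \<Longrightarrow> (f has_real_derivative D1 z) (at z within {0..l})"
    and d2: "(D1 has_real_derivative d) (at y within {0..l})"
    and min: "\<And>z. z \<in> {0..l} \<Longrightarrow> f y \<le> f z" and zero: "D1 y = 0"
  shows "0 \<le> d"
proof (rule ccontr)
  assume "\<not> 0 \<le> d"
  then have d: "d < 0" by simp
  have mv: "\<exists>x\<in>{a<..<b}. f b - f a = D1 x * (b - a)" if "0 \<le> a" "a < b" "b \<le> l" for a b
  proof -
    have "(f has_derivative (*) (D1 x)) (at x within {a..b})" if "x \<in> {a..b}" for x
      using has_field_derivative_subset[OF d1[of x], of "{a..b}"] that \<open>0 \<le> a\<close> \<open>b \<le> l\<close>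
      by (auto simp: has_field_derivative_def)
    from mvt_simple[OF \<open>a < b\<close>, of f "\<lambda>x. (*) (D1 x)"] this show ?thesis by auto
  qed
  show False
  proof (cases "y < l")
    case True
    obtain e where e: "0 < e" "\<And>h. 0 < h \<Longrightarrow> y + h \<in> {0..l} \<Longrightarrow> h < e \<Longrightarrow> D1 (y + h) < D1 y"
      using has_real_derivative_neg_dec_right[OF d2 d] by blast
    define b where "b = y + min (e/2) (l - y)"
    have b: "y < b" "b \<le> l" "b - y < e" using e True by (auto simp: b_def min_def)
    obtain x where x: "x \<in> {y<..<b}" "f b - f y = D1 x * (b - y)" using mv[of y b] b y by auto
    have "D1 x < 0" using e(2)[of "x - y"] x b y zero by auto
    then have "f b - f y < 0" using x b by (simp add: mult_neg_pos)
    then show False using min[of b] b y by auto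
  next
    case False
    then have yl: "y = l" using y by simp
    obtain e where e: "0 < e" "\<And>h. 0 < h \<Longrightarrow> y - h \<in> {0..l} \<Longrightarrow> h < e \<Longrightarrow> D1 y < D1 (y - h)"
      using has_real_derivative_neg_dec_left[OF d2 d] by blast
    define a where "a = y - min (e/2) l"
    have a: "a < y" "0 \<le> a" "y - a < e" using e l yl by (auto simp: a_def min_def)
    obtain x where x: "x \<in> {a<..<y}" "f y - f a = D1 x * (y - a)" using mv[of a y] a yl by auto
    have "0 < D1 x" using e(2)[of "y - x"] x a y zero yl by auto
    then have "0 < f y - f a" using x a by simp
    then show False using min[of a] a y by auto
  qed
qed

lemma one_sided_derivative_nonneg:
  fixes f :: "real \<Rightarrow> real"
  assumes d: "(f has_real_derivative d) (at a within S)" and S: "{a..<a+e} \<subseteq> S" "0 < e"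
    and min: "\<And>z. z \<in> S \<Longrightarrow> f a \<le> f z"
  shows "0 \<le> d"
proof (rule ccontr)
  assume "\<not> 0 \<le> d"
  then obtain e' where e': "0 < e'" "\<And>h. 0 < h \<Longrightarrow> a + h \<in> S \<Longrightarrow> h < e' \<Longrightarrow> f (a + h) < f a"
    using has_real_derivative_neg_dec_right[OF d] by force
  let ?h = "min e e' / 2"
  have "a + ?h \<in> S" "0 < ?h" "?h < e'" using S e'(1) by (auto simp: min_def)
  then show False using e'(2)[of ?h] min by (meson leD)
qed

lemma one_sided_derivative_nonpos:
  fixes f :: "real \<Rightarrow> real"
  assumes d: "(f has_real_derivative d) (at a within S)" and S: "{a-e<..a} \<subseteq> S" "0 < e"
    and min: "\<And>z. z \<in> S \<Longrightarrow> f a \<le> f z"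
  shows "d \<le> 0"
proof (rule ccontr)
  assume "\<not> d \<le> 0"
  then obtain e' where e': "0 < e'" "\<And>h. 0 < h \<Longrightarrow> a - h \<in> S \<Longrightarrow> h < e' \<Longrightarrow> f (a - h) < f a"
    using has_real_derivative_pos_inc_left[OF d] by force
  let ?h = "min e e' / 2"
  have "a - ?h \<in> S" "0 < ?h" "?h < e'" using S e'(1) by (auto simp: min_def)
  then show False using e'(2)[of ?h] min by (meson leD)
qed

context exit_network
begin

lemma v0_points: "v0 \<in> points N"
  by (rule verts_points[OF v0_vert])

lemma param_point_cases:
  assumes j: "j \<in> edges N" and y: "y \<in> {0..len N j}"
  obtains "y \<in> {0<..<len N j}" | "param N j y \<in> verts N" "j \<in> Inc N (param N j y)"
proof (cases "y \<in> {0<..<len N j}")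
  case False
  then have "y = 0 \<or> y = len N j" using y by auto
  then show ?thesis using that(2) param_ends[OF j] end_in_Inc[OF j] by auto
qed (use that in blast)

text \<open>
  At an interior vertex where the solution has a spatial minimum, every derivative into an edge is
  nonnegative, while the Kirchhoff condition says that they add up to zero.
\<close>

lemma network_heat_spatial_min:
  assumes u: "network_heat N Tmax \<sigma> u D1 D2" and t: "t \<in> {0<..<Tmax}"
    and x: "x \<in> points N" "x \<noteq> v0" and min: "\<And>x'. x' \<in> points N \<Longrightarrow> u x t \<le> u x' t"
  obtains j y where "j \<in> edges N" "y \<in> {0..len N j}" "x = param N j y" "0 \<le> D2 j y t"
proof -
  note d = network_heat_derivs[OF u _ _ t]
  have zero: "0 \<le> D2 j y t" if j: "j \<in> edges N" and y: "y \<in> {0..len N j}" "x = param N j y" "D1 j y t = 0" for j y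
    by (rule second_derivative_at_min[OF len_pos[OF j] y(1) d(1)[OF j] d(2)[OF j y(1)] _ y(3)])
      (use min param_in_points[OF j] y(2) in auto)
  obtain j y where j: "j \<in> edges N" and y: "y \<in> {0..len N j}" "x = param N j y"
    using x(1) by (rule pointsE)
  show ?thesis
  proof (cases rule: param_point_cases[OF j y(1)])
    case 1
    have "at y within {0..len N j} = at y" using 1 by (intro at_within_Icc_at) auto
    then have "((\<lambda>z. u (param N j z) t) has_real_derivative D1 j y t) (at y)" using d(1)[OF j y(1)] by simp
    then have "D1 j y t = 0"
    proof (rule DERIV_local_min)
      show "0 < min y (len N j - y)" using 1 by auto
      show "\<forall>z. \<bar>y - z\<bar> < min y (len N j - y) \<longrightarrow> u (param N j y) t \<le> u (param N j z) t"
      proof (intro allI impI)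
        fix z assume "\<bar>y - z\<bar> < min y (len N j - y)"
        then have "z \<in> {0..len N j}" by (auto simp: abs_less_iff)
        then show "u (param N j y) t \<le> u (param N j z) t" using min[OF param_in_points[OF j]] y(2) by auto
      qed
    qed
    then show ?thesis using that[OF j y zero[OF j y]] by blast
  next
    case 2
    then have v: "x \<in> verts N" and jx: "j \<in> Inc N x" using y(2) by auto
    have outward: "0 \<le> incidence N x k * D1 k (edge_coord N k x) t" if k: "k \<in> Inc N x" for k
    proof -
      have kE: "k \<in> edges N" by (rule IncD[OF k])
      note dk = d(1)[OF kE from_vertex_0(2)[OF v k]]
      have mk: "u (param N k (from_vertex k x 0)) t \<le> u (param N k z) t" if "z \<in> {0..len N k}" for z
        using min[OF param_in_points[OF kE that]] from_vertex_0(1)[OF v k] by simp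
      show ?thesis
      proof (cases "param N k 0 = x")
        case True
        then have "0 \<le> D1 k 0 t"
          using dk mk len_pos[OF kE]
          by (intro one_sided_derivative_nonneg[of _ _ 0 "{0..len N k}" "len N k"]) (auto simp: from_vertex_def)
        then show ?thesis using True by (simp add: incidence_eq[OF v k] edge_coord_vertex[OF v k] from_vertex_def)
      next
        case False
        then have "D1 k (len N k) t \<le> 0"
          using dk mk len_pos[OF kE]
          by (intro one_sided_derivative_nonpos[of _ _ "len N k" "{0..len N k}" "len N k"]) (auto simp: from_vertex_def)
        then show ?thesis using False by (simp add: incidence_eq[OF v k] edge_coord_vertex[OF v k] from_vertex_def)
      qed
    qed
    have "(\<Sum>k\<in>Inc N x. incidence N x k * D1 k (edge_coord N k x) t) = 0"
      using u v x(2) t unfolding network_heat_def transition_verts_eq by blast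
    then have "incidence N x j * D1 j (edge_coord N j x) t = 0"
      using sum_nonneg_eq_0_iff[OF finite_Inc, of x "\<lambda>k. incidence N x k * D1 k (edge_coord N k x) t"] outward jx by blast
    then have "D1 j y t = 0"
      using abs_incidence[OF v jx] edge_coord_param[OF j y(1)] y(2) by auto
    then show ?thesis using that[OF j y zero[OF j y]] by blast
  qed
qed

text \<open>
  The weak maximum principle. Adding \<open>e t\<close> with a small \<open>e > 0\<close> makes the inequalities at a negative minimum
  strict: in time the derivative of \<open>u\<close> is at most \<open>- e\<close>, in space the second derivative is nonnegative.
\<close>

theorem network_heat_nonneg:
  assumes u: "network_heat N Tmax 1 u D1 D2"
    and init: "\<And>x. x \<in> points N \<Longrightarrow> 0 \<le> u x 0" and bd: "\<And>t. t \<in> {0..Tmax} \<Longrightarrow> 0 \<le> u v0 t"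
    and x: "x \<in> points N" and t: "t \<in> {0..Tmax}"
  shows "0 \<le> u x t"
proof -
  have cu: "continuous_on (points N \<times> {0..Tmax}) (\<lambda>p. u (fst p) (snd p))"
    using u by (simp add: network_heat_def case_prod_unfold)
  have early: "0 \<le> u x1 t1" if x1: "x1 \<in> points N" and t1: "t1 \<in> {0..<Tmax}" for x1 t1
  proof (rule ccontr)
    assume "\<not> 0 \<le> u x1 t1"
    then have neg: "u x1 t1 < 0" by simp
    \<comment> \<open>Small enough for \<open>u + e t\<close> to be still negative at the given point.\<close>
    define e where "e = - u x1 t1 / (t1 + 1)"
    have e: "0 < e" using neg t1 by (simp add: e_def divide_neg_pos)
    let ?w = "\<lambda>p. u (fst p) (snd p) + e * snd p"
    have "compact (points N \<times> {0..t1})" by (intro compact_Times compact_points) auto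
    moreover have "continuous_on (points N \<times> {0..t1}) ?w"
      using t1 by (intro continuous_intros continuous_on_subset[OF cu]) auto
    moreover have "(x1, t1) \<in> points N \<times> {0..t1}" using x1 t1 by simp
    then have "points N \<times> {0..t1} \<noteq> {}" by blast
    ultimately obtain p where p: "p \<in> points N \<times> {0..t1}" "\<And>p'. p' \<in> points N \<times> {0..t1} \<Longrightarrow> ?w p \<le> ?w p'"
      using continuous_attains_inf[of "points N \<times> {0..t1}" ?w] by blast
    obtain y s where ys: "p = (y, s)" "y \<in> points N" "s \<in> {0..t1}" using p(1) by auto
    have "e * (t1 + 1) = - u x1 t1" using t1 by (simp add: e_def)
    then have "?w (x1, t1) < 0" using e by (simp add: algebra_simps)
    then have wneg: "u y s + e * s < 0" using p(2)[of "(x1, t1)"] x1 t1 ys by auto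
    have s0: "0 < s" using wneg init[OF ys(2)] ys(3) by (cases "s = 0") auto
    then have s: "s \<in> {0<..<Tmax}" using ys t1 by auto
    have yv: "y \<noteq> v0"
    proof
      assume "y = v0"
      then have "0 \<le> u y s" using bd[of s] s by simp
      then show False using wneg mult_pos_pos[OF e s0] by linarith
    qed
    have "u y s \<le> u x' s" if "x' \<in> points N" for x' using p(2)[of "(x', s)"] ys that by auto
    then obtain j z where jz: "j \<in> edges N" "z \<in> {0..len N j}" "y = param N j z" "0 \<le> D2 j z s"
      by (rule network_heat_spatial_min[OF u s ys(2) yv])
    have "((\<lambda>s. u (param N j z) s) has_real_derivative 1 * D2 j z s) (at s)"
      using u jz s unfolding network_heat_def by blast
    then have "((\<lambda>s. u y s + e * s) has_real_derivative D2 j z s + e) (at s)"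
      unfolding jz(3) by (auto intro!: derivative_eq_intros)
    then have "((\<lambda>s. u y s + e * s) has_real_derivative D2 j z s + e) (at s within {0..s})"
      by (rule has_field_derivative_at_within)
    then have "D2 j z s + e \<le> 0"
    proof (rule one_sided_derivative_nonpos[OF _ _ s0])
      fix r assume "r \<in> {0..s}"
      then show "u y s + e * s \<le> u y r + e * r" using p(2)[of "(y, r)"] ys by auto
    qed auto
    then show False using jz(4) e by simp
  qed
  show ?thesis
  proof (cases "t < Tmax \<or> Tmax \<le> 0")
    case True
    then show ?thesis using early[OF x, of t] t init[OF x] by (cases "t = 0") auto
  next
    case False
    then have tT: "t = Tmax" "0 < Tmax" using t by auto
    have "continuous_on {0..Tmax} (\<lambda>t. u x t)"
      using continuous_on_compose2[OF cu, of "{0..Tmax}" "\<lambda>t. (x, t)"] x by (force intro!: continuous_intros)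
    moreover have "closure {0..<Tmax} = {0..Tmax}" using tT by simp
    ultimately show ?thesis
      using continuous_ge_on_closure[of "{0..<Tmax}" "\<lambda>t. u x t" t 0] early[OF x] t by auto
  qed
qed

corollary network_heat_bound:
  assumes u: "network_heat N Tmax 1 u D1 D2"
    and init: "\<And>x. x \<in> points N \<Longrightarrow> \<bar>u x 0\<bar> \<le> B" and bd: "\<And>t. t \<in> {0..Tmax} \<Longrightarrow> \<bar>u v0 t\<bar> \<le> B"
    and x: "x \<in> points N" and t: "t \<in> {0..Tmax}"
  shows "\<bar>u x t\<bar> \<le> B"
proof -
  have *: "0 \<le> 1 * B + b * u x t" if b: "\<bar>b\<bar> = 1" for b
  proof (rule network_heat_nonneg[OF network_heat_linear[OF network_heat_const[of Tmax 1 B] u, of 1 b] _ _ x t])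
    have le: "0 \<le> 1 * B + b * r" if "\<bar>r\<bar> \<le> B" for r
      using that b by (auto simp: abs_if split: if_splits)
    show "0 \<le> 1 * B + b * u x 0" if "x \<in> points N" for x by (rule le[OF init[OF that]])
    show "0 \<le> 1 * B + b * u v0 t" if "t \<in> {0..Tmax}" for t by (rule le[OF bd[OF that]])
  qed
  show ?thesis using *[of 1] *[of "-1"] by simp
qed

corollary network_heat_backward_bound:
  assumes u: "network_heat N Tmax (- 1) u D1 D2"
    and init: "\<And>x. x \<in> points N \<Longrightarrow> \<bar>u x Tmax\<bar> \<le> B" and bd: "\<And>t. t \<in> {0..Tmax} \<Longrightarrow> \<bar>u v0 t\<bar> \<le> B"
    and x: "x \<in> points N" and t: "t \<in> {0..Tmax}"
  shows "\<bar>u x t\<bar> \<le> B"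
proof -
  have "network_heat N Tmax 1 (\<lambda>x t. u x (Tmax - t)) (\<lambda>j y t. D1 j y (Tmax - t)) (\<lambda>j y t. D2 j y (Tmax - t))"
    using network_heat_reverse[OF u] by simp
  from network_heat_bound[OF this, of B x "Tmax - t"] show ?thesis using init bd x t by simp
qed

end

section \<open>Prescribed boundary values\<close>

text \<open>
  The factor \<open>\<bar>y\<bar>\<close> gained by integration is absorbed into the exponential.
\<close>

lemma tame_antiderivative:
  assumes f: "tame f"
  obtains g where "tame g" "g 0 = 0" "\<And>y. (g has_real_derivative f y) (at y)"
proof -
  obtain G where G: "\<And>y. (G has_real_derivative f y) (at y)"
    using einterval_antiderivative[of "-\<infinity>" "\<infinity>" f] tame_isCont[OF f]
    unfolding has_real_derivative_iff_has_vector_derivative by auto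
  define g where "g y = G y - G 0" for y
  have g: "(g has_real_derivative f y) (at y)" for y
    unfolding g_def using DERIV_diff[OF G[of y] DERIV_const[of "G 0"]] by simp
  obtain A k where A: "0 \<le> A" "0 \<le> k" "\<And>z. \<bar>f z\<bar> \<le> A * exp (k * \<bar>z\<bar>)"
    using tame_bound[OF f] by blast
  have "\<bar>g y\<bar> \<le> A * exp ((k + 1) * \<bar>y\<bar>)" for y
  proof -
    have "norm (g y - g 0) \<le> (A * exp (k * \<bar>y\<bar>)) * norm (y - 0)"
    proof (rule field_differentiable_bound[of "{-\<bar>y\<bar>..\<bar>y\<bar>}"])
      fix z assume "z \<in> {-\<bar>y\<bar>..\<bar>y\<bar>}"
      then have "\<bar>z\<bar> \<le> \<bar>y\<bar>" by auto
      then have "exp (k * \<bar>z\<bar>) \<le> exp (k * \<bar>y\<bar>)" using A(2) by (simp add: mult_left_mono)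
      then show "norm (f z) \<le> A * exp (k * \<bar>y\<bar>)"
        using A(3)[of z] A(1) by (simp add: order_trans[OF _ mult_left_mono])
      show "(g has_real_derivative f z) (at z within {-\<bar>y\<bar>..\<bar>y\<bar>})"
        using g by (rule has_field_derivative_at_within)
    qed auto
    then have "\<bar>g y\<bar> \<le> A * exp (k * \<bar>y\<bar>) * \<bar>y\<bar>" by (simp add: g_def)
    also have "\<dots> \<le> A * exp (k * \<bar>y\<bar>) * exp \<bar>y\<bar>"
    proof (rule mult_left_mono)
      show "\<bar>y\<bar> \<le> exp \<bar>y\<bar>" using exp_ge_add_one_self[of "\<bar>y\<bar>"] by linarith
    qed (use A(1) in simp)
    finally show ?thesis by (simp add: exp_add algebra_simps)
  qed
  moreover have "continuous_on UNIV g"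
    using g by (auto intro!: continuous_at_imp_continuous_on DERIV_isCont)
  ultimately have "tame g" unfolding tame_def by blast
  then show ?thesis using that g by (simp add: g_def)
qed

lemma zero_of_second_derivative:
  fixes f f' f'' :: "real \<Rightarrow> real"
  assumes S: "convex S" "0 \<in> S"
    and d: "\<And>z. (f has_real_derivative f' z) (at z)" "\<And>z. (f' has_real_derivative f'' z) (at z)"
    and 0: "f 0 = 0" "f' 0 = 0" and z: "\<And>z. z \<in> S \<Longrightarrow> f'' z = 0"
    and x: "x \<in> S"
  shows "f x = 0" and "f' x = 0"
proof -
  have 1: "f' z = 0" if "z \<in> S" for z
  proof -
    have "\<exists>c. \<forall>x\<in>S. f' x = c"
      by (rule has_field_derivative_zero_constant[OF S(1)])
        (use z d(2) in \<open>metis has_field_derivative_at_within\<close>)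
    then show ?thesis using 0(2) S(2) that by metis
  qed
  then show "f' x = 0" using x by blast
  have "\<exists>c. \<forall>x\<in>S. f x = c"
    by (rule has_field_derivative_zero_constant[OF S(1)])
      (use 1 d(1) in \<open>metis has_field_derivative_at_within\<close>)
  then show "f x = 0" using 0(1) S(2) x by metis
qed

text \<open>
  Differentiability at the initial time, by the mean value theorem, when the derivative tends to zero.
\<close>

lemma derivative_extend_zero:
  fixes f g :: "real \<Rightarrow> real"
  assumes f: "\<And>t. t \<le> 0 \<Longrightarrow> f t = 0" and cf: "isCont f 0"
    and d: "\<And>t. 0 < t \<Longrightarrow> (f has_real_derivative g t) (at t)" and g: "isCont g 0" "g 0 = 0"
  shows "(f has_real_derivative 0) (at 0)"
  unfolding has_field_derivative_iff tendsto_iff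
proof (intro allI impI)
  fix e :: real assume e: "0 < e"
  then obtain r where r: "0 < r" "\<And>t. \<bar>t\<bar> < r \<Longrightarrow> \<bar>g t\<bar> < e"
    using g unfolding continuous_at_eps_delta by (auto simp: dist_real_def)
  show "\<forall>\<^sub>F x in at 0. dist ((f x - f 0) / (x - 0)) 0 < e"
    unfolding eventually_at
  proof (intro exI conjI ballI impI)
    fix x :: real assume x: "x \<noteq> 0 \<and> dist x 0 < r"
    show "dist ((f x - f 0) / (x - 0)) 0 < e"
    proof (cases "0 < x")
      case True
      have cont: "continuous_on {0..x} f"
      proof (intro continuous_at_imp_continuous_on ballI)
        fix t assume "t \<in> {0..x}"
        then show "isCont f t" using cf DERIV_isCont[OF d[of t]] by (cases "t = 0") auto
      qed
      obtain l z where lz: "0 < z" "z < x" "(f has_real_derivative l) (at z)" "f x - f 0 = (x - 0) * l"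
        using MVT[OF True cont] d real_differentiable_def by blast
      have "l = g z" using DERIV_unique[OF lz(3) d[OF lz(1)]] .
      then show ?thesis using lz r(2)[of z] x True by (simp add: dist_real_def)
    next
      case False
      then show ?thesis using f[of x] f[of 0] e by simp
    qed
  qed (rule r(1))
qed

context exit_network
begin

text \<open>
  The extension whose heat flow has zero initial values and the boundary values \<open>t\<close> at \<open>v0\<close>.
\<close>

definition linear_images :: "'j \<Rightarrow> real \<Rightarrow> real" where
  "linear_images = image_extension (\<lambda>j y. 0) (\<lambda>z. z\<^sup>2 / 2)"

lemma tame_power: "tame (\<lambda>z. z ^ m / c)"
proof -
  have *: "\<bar>z ^ m / c\<bar> \<le> (fact m / \<bar>c\<bar>) * exp (1 * \<bar>z\<bar>)" for z :: real
  proof -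
    have "\<bar>z\<bar> ^ m / \<bar>c\<bar> \<le> fact m * exp \<bar>z\<bar> / \<bar>c\<bar>"
      by (rule divide_right_mono[OF power_le_fact_exp]) auto
    then show ?thesis by (simp add: power_abs)
  qed
  have "continuous_on UNIV (\<lambda>z::real. z ^ m / c)"
    by (simp only: divide_inverse) (intro continuous_intros)
  then show ?thesis unfolding tame_def using * by blast
qed

lemma linear_images:
  "j \<in> edges N \<Longrightarrow> tame (linear_images j)" "reflecting (\<lambda>z. z\<^sup>2 / 2) linear_images"
  "j \<in> edges N \<Longrightarrow> y \<in> {0..len N j} \<Longrightarrow> linear_images j y = 0"
  unfolding linear_images_def
  by (rule image_extension_tame image_extension_reflecting, auto simp: matching_def tame_power)+
    (simp add: image_extension_on_edge)

text \<open>
  The corresponding extension for the boundary values \<open>t\<^sup>2/2\<close>, with two derivatives \<open>P\<close> and \<open>linear_images\<close>. It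
  is defined as the second antiderivative of \<open>linear_images\<close> and not by images, because it has to be
  twice continuously differentiable across the vertices. It satisfies the reflection law since the
  second derivative of the difference of both sides vanishes by the reflection law of \<open>linear_images\<close>, and
  value and slope of the difference vanish at the vertex.
\<close>

lemma quadratic_images:
  "\<exists>P Q. (\<forall>j\<in>edges N. tame (P j) \<and> tame (Q j) \<and>
      (\<forall>y. (Q j has_real_derivative P j y) (at y)) \<and>
      (\<forall>y. (P j has_real_derivative linear_images j y) (at y)) \<and>
      (\<forall>y\<in>{0..len N j}. Q j y = 0 \<and> P j y = 0)) \<and>
    reflecting (\<lambda>z. z ^ 4 / 24) Q"
proof -
  have "\<forall>j\<in>edges N. \<exists>g. tame g \<and> g 0 = 0 \<and> (\<forall>y. (g has_real_derivative linear_images j y) (at y))"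
    using tame_antiderivative[OF linear_images(1)] by metis
  then obtain P where P: "\<And>j. j \<in> edges N \<Longrightarrow> tame (P j)" "\<And>j. j \<in> edges N \<Longrightarrow> P j 0 = 0"
    "\<And>j y. j \<in> edges N \<Longrightarrow> (P j has_real_derivative linear_images j y) (at y)" by metis
  have "\<forall>j\<in>edges N. \<exists>g. tame g \<and> g 0 = 0 \<and> (\<forall>y. (g has_real_derivative P j y) (at y))"
    using tame_antiderivative[OF P(1)] by metis
  then obtain Q where Q: "\<And>j. j \<in> edges N \<Longrightarrow> tame (Q j)" "\<And>j. j \<in> edges N \<Longrightarrow> Q j 0 = 0"
    "\<And>j y. j \<in> edges N \<Longrightarrow> (Q j has_real_derivative P j y) (at y)" by metis
  have zero: "Q j y = 0" "P j y = 0" if j: "j \<in> edges N" and y: "y \<in> {0..len N j}" for j y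
    using zero_of_second_derivative[of "{0..len N j}", OF _ _ Q(3)[OF j] P(3)[OF j] Q(2)[OF j] P(2)[OF j] linear_images(3)[OF j] y]
      len_pos[OF j] by auto
  have "reflecting (\<lambda>z. z ^ 4 / 24) Q"
    unfolding reflecting_def
  proof (intro ballI allI impI)
    fix v j and z :: real assume v: "v \<in> verts N" and j: "j \<in> Inc N v" and z: "0 \<le> z"
    have dQ: "((\<lambda>z. Q k (from_vertex k v (s * z))) has_real_derivative incidence N v k * s * P k (from_vertex k v (s * z))) (at z)"
      and dP: "((\<lambda>z. P k (from_vertex k v (s * z))) has_real_derivative incidence N v k * s * linear_images k (from_vertex k v (s * z))) (at z)"
      if k: "k \<in> Inc N v" for k s z
    proof -
      have d: "((\<lambda>z. from_vertex k v (s * z)) has_real_derivative incidence N v k * s) (at z)"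
        using k v by (cases "param N k 0 = v") (auto simp: from_vertex_def[abs_def] incidence_eq intro!: derivative_eq_intros)
      show "((\<lambda>z. Q k (from_vertex k v (s * z))) has_real_derivative incidence N v k * s * P k (from_vertex k v (s * z))) (at z)"
        using DERIV_chain2[OF Q(3)[OF IncD[OF k]] d] by (simp add: mult.commute)
      show "((\<lambda>z. P k (from_vertex k v (s * z))) has_real_derivative incidence N v k * s * linear_images k (from_vertex k v (s * z))) (at z)"
        using DERIV_chain2[OF P(3)[OF IncD[OF k]] d] by (simp add: mult.commute)
    qed
    have s2: "incidence N v k * incidence N v k = 1" if "k \<in> Inc N v" for k
      using abs_incidence[OF v that] by (metis abs_mult_self_eq mult_1)
    define W where "W F s k z = (F k (from_vertex k v (s * z)) :: real)" for F s k z
    define S0 where "S0 z = (if v = v0 then z ^ 4 / 12 else 2 / real (card (Inc N v)) * (\<Sum>k\<in>Inc N v. W Q 1 k z))" for z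
    define S1 where "S1 z = (if v = v0 then z ^ 3 / 3 else 2 / real (card (Inc N v)) * (\<Sum>k\<in>Inc N v. incidence N v k * W P 1 k z))" for z
    define S2 where "S2 z = (if v = v0 then z\<^sup>2 else 2 / real (card (Inc N v)) * (\<Sum>k\<in>Inc N v. W linear_images 1 k z))" for z
    have dW: "(W Q s k has_real_derivative incidence N v k * s * W P s k z) (at z)"
      "(W P s k has_real_derivative incidence N v k * s * W linear_images s k z) (at z)"
      if "k \<in> Inc N v" for s k z
      unfolding W_def using dQ[OF that] dP[OF that] by blast+
    have dS0: "(S0 has_real_derivative S1 z) (at z)" for z
    proof (cases "v = v0")
      case True
      then have "S0 = (\<lambda>z. z ^ 4 / 12)" "S1 z = z ^ 3 / 3" by (auto simp: S0_def S1_def)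
      then show ?thesis by (auto intro!: derivative_eq_intros)
    next
      case False
      then have "S0 = (\<lambda>z. 2 / real (card (Inc N v)) * (\<Sum>k\<in>Inc N v. W Q 1 k z))" by (auto simp: S0_def)
      moreover have "S1 z = 2 / real (card (Inc N v)) * (\<Sum>k\<in>Inc N v. incidence N v k * W P 1 k z)"
        using False by (simp add: S1_def)
      moreover have "(W Q 1 k has_real_derivative incidence N v k * W P 1 k z) (at z)" if "k \<in> Inc N v" for k
        using dW(1)[OF that, of 1 z] by simp
      ultimately show ?thesis by (simp only:) (intro DERIV_cmult DERIV_sum)
    qed
    have dS1: "(S1 has_real_derivative S2 z) (at z)" for z
    proof (cases "v = v0")
      case True
      then have "S1 = (\<lambda>z. z ^ 3 / 3)" "S2 z = z\<^sup>2" by (auto simp: S1_def S2_def)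
      then show ?thesis by (auto intro!: derivative_eq_intros)
    next
      case False
      then have S1: "S1 = (\<lambda>z. 2 / real (card (Inc N v)) * (\<Sum>k\<in>Inc N v. incidence N v k * W P 1 k z))" by (auto simp: S1_def)
      have "((\<lambda>z. incidence N v k * W P 1 k z) has_real_derivative W linear_images 1 k z) (at z)" if "k \<in> Inc N v" for k
        using DERIV_cmult[OF dW(2)[OF that, of 1 z], of "incidence N v k"] s2[OF that] by (simp add: mult.assoc[symmetric])
      moreover have "S2 z = 2 / real (card (Inc N v)) * (\<Sum>k\<in>Inc N v. W linear_images 1 k z)"
        using False by (simp add: S2_def)
      ultimately show ?thesis unfolding S1 by (simp only:) (intro DERIV_cmult DERIV_sum)
    qed
    let ?f = "\<lambda>z. W Q (- 1) j z + W Q 1 j z - S0 z"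
    let ?f' = "\<lambda>z. - incidence N v j * W P (- 1) j z + incidence N v j * W P 1 j z - S1 z"
    let ?f'' = "\<lambda>z. W linear_images (- 1) j z + W linear_images 1 j z - S2 z"
    have at0: "W Q s k 0 = 0" "W P s k 0 = 0" if "k \<in> Inc N v" for s k
      unfolding W_def using zero[OF IncD[OF that] from_vertex_0(2)[OF v that]] by simp_all
    have "?f z = 0"
    proof (rule zero_of_second_derivative(1)[of "{0..}" ?f ?f' ?f''])
      show "(?f has_real_derivative ?f' z) (at z)" for z
        using DERIV_diff[OF DERIV_add[OF dW(1)[OF j, of "- 1"] dW(1)[OF j, of 1]] dS0, of z] by simp
      show "(?f' has_real_derivative ?f'' z) (at z)" for z
        using DERIV_diff[OF DERIV_add[OF DERIV_cmult[OF dW(2)[OF j, of "- 1"], of "- incidence N v j"]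
          DERIV_cmult[OF dW(2)[OF j, of 1], of "incidence N v j"]] dS1, of z] s2[OF j]
        by (simp add: mult.assoc[symmetric])
      show "?f 0 = 0" using at0(1) j by (simp add: S0_def)
      show "?f' 0 = 0" using at0(2) j by (simp add: S1_def)
      show "?f'' z = 0" if "z \<in> {0..}" for z
      proof -
        have "linear_images j (from_vertex j v (- z)) = scatter (\<lambda>z. z\<^sup>2 / 2) linear_images v z - linear_images j (from_vertex j v z)"
          using linear_images(2) v j that unfolding reflecting_def by auto
        then show ?thesis by (simp add: W_def S2_def scatter_def)
      qed
    qed (use z in auto)
    then show "Q j (from_vertex j v (- z)) = scatter (\<lambda>z. z ^ 4 / 24) Q v z - Q j (from_vertex j v z)"
      by (cases "v = v0") (simp_all add: W_def S0_def scatter_def algebra_simps)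
  qed
  then show ?thesis using P(1,3) Q(1,3) zero by (intro exI[of _ P] exI[of _ Q]) blast
qed

text \<open>
  Continued by zero to negative times, so that a time delay of the solution is a translation.
\<close>

definition delayed_heat :: "(real \<Rightarrow> real) \<Rightarrow> real \<Rightarrow> real \<Rightarrow> real" where
  "delayed_heat f y t = (if t \<le> 0 then 0 else heat f y t)"

lemma delayed_heat_continuous:
  assumes f: "tame f" and z: "\<And>y. y \<in> {0..l} \<Longrightarrow> f y = 0"
  shows "continuous_on ({0..l} \<times> UNIV) (\<lambda>p. delayed_heat f (fst p) (snd p))"
proof -
  have "continuous_on ({0..l} \<times> {..0}) (\<lambda>p. delayed_heat f (fst p) (snd p))"
    by (rule continuous_on_eq[OF continuous_on_const[of _ 0]]) (auto simp: delayed_heat_def)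
  moreover have "continuous_on ({0..l} \<times> {0..}) (\<lambda>p. delayed_heat f (fst p) (snd p))"
  proof (rule continuous_on_eq)
    show "continuous_on ({0..l} \<times> {0..}) (\<lambda>(y, t). heat f y t)"
      by (rule continuous_on_subset[OF heat_continuous[OF f]]) auto
  qed (use z in \<open>auto simp: delayed_heat_def heat_0\<close>)
  ultimately have "continuous_on ({0..l} \<times> {..0} \<union> {0..l} \<times> {0..}) (\<lambda>p. delayed_heat f (fst p) (snd p))"
    by (intro continuous_on_closed_Un closed_Times) auto
  moreover have "{0..l} \<times> {..0} \<union> {0..l} \<times> {0..} = {0..l} \<times> (UNIV :: real set)" by auto
  ultimately show ?thesis by simp
qed

lemma delayed_heat_space_deriv:
  assumes "tame f" "tame f'" "\<And>y. (f has_real_derivative f' y) (at y)"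
  shows "((\<lambda>y. delayed_heat f y t) has_real_derivative delayed_heat f' y t) (at y)"
  using heat_deriv_initial[OF assms, of t] by (auto simp: delayed_heat_def)

lemma heat_derivs_initial:
  assumes f: "tame f" "tame f'" "tame f''" "\<And>y. (f has_real_derivative f' y) (at y)"
     "\<And>y. (f' has_real_derivative f'' y) (at y)" and t: "0 < t"
  shows "heat_x f y t = heat f' y t" "heat_xx f y t = heat f'' y t"
proof -
  have 1: "heat_x f y t = heat f' y t" for y
    using DERIV_unique[OF heat_space_deriv(1)[OF f(1) t] heat_deriv_initial[OF f(1,2,4)]] t by simp
  show "heat_x f y t = heat f' y t" by (rule 1)
  show "heat_xx f y t = heat f'' y t"
    using DERIV_unique[OF heat_space_deriv(2)[OF f(1) t, unfolded 1] heat_deriv_initial[OF f(2,3,5)]] t by simp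
qed

lemma delayed_heat_time_deriv:
  assumes f: "tame f" "tame f'" "tame f''" "\<And>y. (f has_real_derivative f' y) (at y)"
     "\<And>y. (f' has_real_derivative f'' y) (at y)"
    and z: "f y = 0" "f'' y = 0"
  shows "((\<lambda>t. delayed_heat f y t) has_real_derivative delayed_heat f'' y t) (at t)"
proof -
  have pos: "((\<lambda>t. delayed_heat f y t) has_real_derivative delayed_heat f'' y t) (at t)" if t: "0 < t" for t
  proof (rule has_field_derivative_transform_within_open)
    show "((\<lambda>t. heat f y t) has_real_derivative delayed_heat f'' y t) (at t)"
      using heat_derivs_initial(2)[OF f t, of y] heat_time_deriv[OF f(1) t, of y] t
      by (simp add: delayed_heat_def)
    show "t \<in> {0<..}" using t by simp
  qed (simp_all add: delayed_heat_def)
  have cont: "isCont (\<lambda>t. delayed_heat g y t) 0" if g: "tame g" "g y = 0" for g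
  proof -
    have t: "tame (\<lambda>z. g (y + 1 * z))" by (rule tame_affine[OF g(1)]) simp
    have "continuous_on ({0..0} \<times> UNIV) (\<lambda>p. delayed_heat (\<lambda>z. g (y + 1 * z)) (fst p) (snd p))"
      by (rule delayed_heat_continuous[OF t]) (use g in auto)
    from continuous_on_compose2[OF this, of UNIV "\<lambda>t. (0, t)"]
    have "continuous_on UNIV (\<lambda>t. delayed_heat (\<lambda>z. g (y + 1 * z)) 0 t)"
      by (force intro!: continuous_intros)
    moreover have "(\<lambda>t. delayed_heat (\<lambda>z. g (y + 1 * z)) 0 t) = (\<lambda>t. delayed_heat g y t)"
    proof -
      have "heat (\<lambda>z. g (y + 1 * z)) 0 t = heat g y t" for t by (simp add: heat_def)
      then show ?thesis unfolding delayed_heat_def by presburger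
    qed
    ultimately have "continuous_on UNIV (\<lambda>t. delayed_heat g y t)" by metis
    then show ?thesis unfolding continuous_on_eq_continuous_at[OF open_UNIV] by blast
  qed
  consider "t < 0" | "t = 0" | "0 < t" by linarith
  then show ?thesis
  proof cases
    case 1
    show ?thesis
    proof (rule has_field_derivative_transform_within_open)
      show "((\<lambda>t. 0) has_real_derivative delayed_heat f'' y t) (at t)" using 1 by (simp add: delayed_heat_def)
      show "t \<in> {..<0}" using 1 by simp
    qed (simp_all add: delayed_heat_def)
  next
    case 2
    have "((\<lambda>t. delayed_heat f y t) has_real_derivative 0) (at 0)"
      by (rule derivative_extend_zero[OF _ cont[OF f(1) z(1)] pos cont[OF f(3) z(2)]])
        (auto simp: delayed_heat_def)
    then show ?thesis using 2 by (simp add: delayed_heat_def)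
  qed (rule pos)
qed

text \<open>
  By Taylor's formula,
  \<open>g t = g 0 + g1 0 * t + g2 0 * t\<^sup>2/2\<close> plus the integral over \<open>s\<close> of \<open>g3 s * (max 0 (t - s))\<^sup>2/2\<close>,
  so it suffices to superpose the solutions with boundary values \<open>1\<close>, \<open>t\<close>, \<open>t\<^sup>2/2\<close> and the delays of the last
  one. Letting the delayed solution be zero for negative times keeps the limits of integration
  fixed, so that derivatives pass under the integral; for this \<open>t\<^sup>2/2\<close>, unlike \<open>t\<close>, is smooth enough.
\<close>

theorem boundary_value_solution:
  assumes T: "0 < Tmax"
    and g: "\<And>t. t \<in> {0..Tmax} \<Longrightarrow> (g has_real_derivative g1 t) (at t within {0..Tmax})"
      "\<And>t. t \<in> {0..Tmax} \<Longrightarrow> (g1 has_real_derivative g2 t) (at t within {0..Tmax})"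
      "\<And>t. t \<in> {0..Tmax} \<Longrightarrow> (g2 has_real_derivative g3 t) (at t within {0..Tmax})"
    and g3: "continuous_on {0..Tmax} g3"
  shows "\<exists>u D1 D2. network_heat N Tmax 1 u D1 D2 \<and> (\<forall>x\<in>points N. u x 0 = g 0) \<and> (\<forall>t\<in>{0..Tmax}. u v0 t = g t)"
proof -
  from quadratic_images obtain P Q where "\<forall>j\<in>edges N. tame (P j) \<and> tame (Q j) \<and>
      (\<forall>y. (Q j has_real_derivative P j y) (at y)) \<and>
      (\<forall>y. (P j has_real_derivative linear_images j y) (at y)) \<and>
      (\<forall>y\<in>{0..len N j}. Q j y = 0 \<and> P j y = 0)"
    and Q_refl: "reflecting (\<lambda>z. z ^ 4 / 24) Q" by blast
  then have PQ: "\<And>j. j \<in> edges N \<Longrightarrow> tame (P j)" "\<And>j. j \<in> edges N \<Longrightarrow> tame (Q j)"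
    "\<And>j y. j \<in> edges N \<Longrightarrow> (Q j has_real_derivative P j y) (at y)"
    "\<And>j y. j \<in> edges N \<Longrightarrow> (P j has_real_derivative linear_images j y) (at y)"
    and PQ0: "\<And>j y. j \<in> edges N \<Longrightarrow> y \<in> {0..len N j} \<Longrightarrow> Q j y = 0"
    "\<And>j y. j \<in> edges N \<Longrightarrow> y \<in> {0..len N j} \<Longrightarrow> P j y = 0"
    by blast+
  let ?L = linear_images
  note Q_sol = image_solution[of Q "\<lambda>z. z ^ 4 / 24", OF PQ(2) Q_refl]
  note L_sol = image_solution[of ?L "\<lambda>z. z\<^sup>2 / 2", OF linear_images(1,2)]
  have Q_bd: "heat (Q e0) 0 t = t\<^sup>2 / 2" if "0 \<le> t" for t
  proof (cases "t = 0")
    case False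
    then have "heat (Q e0) 0 t = heat (\<lambda>z. \<bar>z\<bar> ^ 4 / 24) 0 t" using Q_sol(3) that by simp
    also have "\<dots> = heat (\<lambda>z. z ^ 4) 0 t / 24" unfolding heat_def by (simp add: power_even_abs)
    finally show ?thesis using heat_power(2)[OF that] by simp
  qed (use PQ0(1)[OF e0_edge, of 0] len_pos[OF e0_edge] in \<open>simp add: heat_0\<close>)
  have L_bd: "heat (?L e0) 0 t = t" if "0 \<le> t" for t
  proof (cases "t = 0")
    case False
    then have "heat (?L e0) 0 t = heat (\<lambda>z. \<bar>z\<bar>\<^sup>2 / 2) 0 t" using L_sol(3) that by simp
    also have "\<dots> = heat (\<lambda>z. z\<^sup>2) 0 t / 2" unfolding heat_def by simp
    finally show ?thesis using heat_power(1)[OF that] by simp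
  qed (use linear_images(3)[OF e0_edge, of 0] len_pos[OF e0_edge] in \<open>simp add: heat_0\<close>)

  \<comment> \<open>The Duhamel integral of \<open>Q\<close>; those of \<open>P\<close> and \<open>linear_images\<close> are its space derivatives.\<close>
  define V where "V f j y t = integral {0..Tmax} (\<lambda>s. g3 s * delayed_heat (f j) y (t - s))" for f :: "'j \<Rightarrow> real \<Rightarrow> real" and j y t
  have cf: "continuous_on S (\<lambda>x. g3 (c x) * delayed_heat f (a x) (b x - c x))"
    if f: "tame f" "\<And>y. y \<in> {0..l} \<Longrightarrow> f y = 0" and S: "continuous_on S a" "continuous_on S b" "continuous_on S c"
      "\<And>x. x \<in> S \<Longrightarrow> a x \<in> {0..l}" "\<And>x. x \<in> S \<Longrightarrow> c x \<in> {0..Tmax}"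
    for f and l and a b c :: "'z::topological_space \<Rightarrow> real" and S
  proof (intro continuous_on_mult)
    show "continuous_on S (\<lambda>x. g3 (c x))"
      by (rule continuous_on_compose2[OF g3 S(3)]) (use S(5) in blast)
    have "continuous_on S (\<lambda>x. (a x, b x - c x))" by (intro continuous_intros S)
    moreover have "(\<lambda>x. (a x, b x - c x)) ` S \<subseteq> {0..l} \<times> UNIV" using S(4) by blast
    ultimately show "continuous_on S (\<lambda>x. delayed_heat f (a x) (b x - c x))"
      using continuous_on_compose2[OF delayed_heat_continuous[of f l, OF f]] by fastforce
  qed
  have cs: "continuous_on {0..Tmax} (\<lambda>s. g3 s * delayed_heat f y (t - s))"
    if f: "tame f" "\<And>y. y \<in> {0..l} \<Longrightarrow> f y = 0" and y: "y \<in> {0..l}" for f l y t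
    by (rule cf[of f l, OF f]) (use y in \<open>auto intro!: continuous_intros\<close>)
  have V_cont: "continuous_on ({0..len N j} \<times> UNIV) (\<lambda>(y, t). V f j y t)"
    if f: "tame (f j)" "\<And>y. y \<in> {0..len N j} \<Longrightarrow> f j y = 0" for f j
  proof -
    have "continuous_on (({0..len N j} \<times> UNIV) \<times> cbox 0 Tmax) (\<lambda>(p, s). g3 s * delayed_heat (f j) (fst p) (snd p - s))"
      unfolding case_prod_unfold
      by (rule cf[of "f j" "len N j", OF f]) (auto intro!: continuous_intros)
    from integral_continuous_on_param[OF this] show ?thesis
      unfolding V_def case_prod_unfold by simp
  qed
  have V_y: "((\<lambda>y. V f j y t) has_real_derivative V f' j y t) (at y within {0..len N j})"
    if f: "tame (f j)" "\<And>y. y \<in> {0..len N j} \<Longrightarrow> f j y = 0" and f': "tame (f' j)" "\<And>y. y \<in> {0..len N j} \<Longrightarrow> f' j y = 0"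
      and d: "\<And>y. (f j has_real_derivative f' j y) (at y)" and y: "y \<in> {0..len N j}" for f f' j y t
    unfolding V_def cbox_interval[symmetric]
  proof (rule leibniz_rule_field_derivative)
    fix y s
    show "((\<lambda>y. g3 s * delayed_heat (f j) y (t - s)) has_real_derivative g3 s * delayed_heat (f' j) y (t - s)) (at y within cbox 0 (len N j))"
      by (intro DERIV_cmult has_field_derivative_at_within[OF delayed_heat_space_deriv[OF f(1) f'(1) d]])
  next
    fix y assume "y \<in> cbox 0 (len N j)"
    then show "(\<lambda>s. g3 s * delayed_heat (f j) y (t - s)) integrable_on cbox 0 Tmax"
      unfolding cbox_interval by (intro integrable_continuous_real cs[of "f j" "len N j", OF f])
  next
    show "continuous_on (cbox 0 (len N j) \<times> cbox 0 Tmax) (\<lambda>(y, s). g3 s * delayed_heat (f' j) y (t - s))"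
      unfolding cbox_interval case_prod_unfold
      by (rule cf[of "f' j" "len N j", OF f']) (auto intro!: continuous_intros)
  qed (use y in auto)
  have V_t: "((\<lambda>t. V Q j y t) has_real_derivative V ?L j y t) (at t)"
    if j: "j \<in> edges N" and y: "y \<in> {0..len N j}" for j y t
    unfolding V_def cbox_interval[symmetric]
  proof (rule leibniz_rule_field_derivative)
    fix t s
    have "((\<lambda>t. t - s) has_real_derivative 1) (at t)" by (auto intro!: derivative_eq_intros)
    from DERIV_chain2[OF delayed_heat_time_deriv[OF PQ(2)[OF j] PQ(1)[OF j] linear_images(1)[OF j] PQ(3)[OF j] PQ(4)[OF j] PQ0(1)[OF j y] linear_images(3)[OF j y]] this]
    show "((\<lambda>t. g3 s * delayed_heat (Q j) y (t - s)) has_real_derivative g3 s * delayed_heat (?L j) y (t - s)) (at t)"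
      by (intro DERIV_cmult) simp
  next
    fix t
    show "(\<lambda>s. g3 s * delayed_heat (Q j) y (t - s)) integrable_on cbox 0 Tmax"
      unfolding cbox_interval by (intro integrable_continuous_real cs[of "Q j" "len N j", OF PQ(2)[OF j] PQ0(1)[OF j] y])
  next
    show "continuous_on (UNIV \<times> cbox 0 Tmax) (\<lambda>(t, s). g3 s * delayed_heat (?L j) y (t - s))"
      unfolding cbox_interval case_prod_unfold
      by (rule cf[of "?L j" "len N j", OF linear_images(1)[OF j] linear_images(3)[OF j]])
        (use y in \<open>auto intro!: continuous_intros\<close>)
  qed auto

  have K_match: "delayed_heat (Q j) (from_vertex j v 0) t = delayed_heat (Q k) (from_vertex k v 0) t"
    if "v \<in> verts N" "j \<in> Inc N v" "k \<in> Inc N v" for v j k t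
  proof (cases "t \<le> 0")
    case False
    then have "heat (Q j) (from_vertex j v 0) t = heat (Q k) (from_vertex k v 0) t"
      using Q_sol(2)[of t] that unfolding matching_def by (meson linear)
    then show ?thesis by (simp only: delayed_heat_def)
  qed (simp add: delayed_heat_def)
  have V_match: "matching (\<lambda>j y. V Q j y t)" for t
    unfolding matching_def V_def
  proof (intro ballI)
    fix v j k assume "v \<in> verts N" "j \<in> Inc N v" "k \<in> Inc N v"
    from K_match[OF this]
    show "integral {0..Tmax} (\<lambda>s. g3 s * delayed_heat (Q j) (from_vertex j v 0) (t - s)) =
        integral {0..Tmax} (\<lambda>s. g3 s * delayed_heat (Q k) (from_vertex k v 0) (t - s))" by simp
  qed
  have K_kirchhoff: "(\<Sum>j\<in>Inc N v. incidence N v j * delayed_heat (P j) (from_vertex j v 0) t) = 0"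
    if v: "v \<in> verts N" "v \<noteq> v0" for v t
  proof (cases "t \<le> 0")
    case False
    have "v \<in> transition_verts N" "t \<in> {0<..<t+1}" using v False by (auto simp: transition_verts_eq)
    then have "(\<Sum>j\<in>Inc N v. incidence N v j * heat_x (Q j) (edge_coord N j v) t) = 0"
      using Q_sol(1)[of "t+1"] unfolding network_heat_def by blast
    moreover have "heat_x (Q j) (edge_coord N j v) t = delayed_heat (P j) (from_vertex j v 0) t" if "j \<in> Inc N v" for j
    proof -
      have j: "j \<in> edges N" by (rule IncD[OF that])
      have "heat_x (Q j) y t = heat (P j) y t" for y
        by (rule heat_derivs_initial(1)[OF PQ(2)[OF j] PQ(1)[OF j] linear_images(1)[OF j] PQ(3)[OF j] PQ(4)[OF j]])
          (use False in simp)
      then show ?thesis using False by (simp add: edge_coord_vertex[OF v(1) that] delayed_heat_def)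
    qed
    ultimately show ?thesis by simp
  qed (simp add: delayed_heat_def)
  have V_kirchhoff: "(\<Sum>j\<in>Inc N v. incidence N v j * V P j (from_vertex j v 0) t) = 0"
    if v: "v \<in> verts N" "v \<noteq> v0" for v t
  proof -
    let ?k = "\<lambda>j s. incidence N v j * (g3 s * delayed_heat (P j) (from_vertex j v 0) (t - s))"
    have "(\<Sum>j\<in>Inc N v. incidence N v j * V P j (from_vertex j v 0) t) = (\<Sum>j\<in>Inc N v. integral {0..Tmax} (?k j))"
      unfolding V_def by simp
    also have "\<dots> = integral {0..Tmax} (\<lambda>s. \<Sum>j\<in>Inc N v. ?k j s)"
    proof (rule integral_sum[symmetric, OF finite_Inc])
      fix j assume j: "j \<in> Inc N v"
      show "?k j integrable_on {0..Tmax}"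
        by (intro integrable_continuous_real continuous_on_mult_left
            cs[of "P j" "len N j", OF PQ(1) PQ0(2) from_vertex_0(2)[OF v(1) j]] IncD[OF j])
    qed
    also have "(\<lambda>s. \<Sum>j\<in>Inc N v. ?k j s) = (\<lambda>s. g3 s * (\<Sum>j\<in>Inc N v. incidence N v j * delayed_heat (P j) (from_vertex j v 0) (t - s)))"
      by (simp add: sum_distrib_left mult_ac)
    also have "integral {0..Tmax} \<dots> = 0" using K_kirchhoff[OF v] by simp
    finally show ?thesis .
  qed
  have V_sol: "network_heat N Tmax 1 (\<lambda>x t. glue (\<lambda>j y. V Q j y t) x) (V P) (V ?L)"
  proof (rule network_heat_glue)
    fix j assume j: "j \<in> edges N"
    note Q = PQ(2)[OF j] PQ0(1)[OF j] and P = PQ(1)[OF j] PQ0(2)[OF j] and L = linear_images(1)[OF j] linear_images(3)[OF j]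
    show "continuous_on ({0..len N j} \<times> {0..Tmax}) (\<lambda>(y, t). V Q j y t)"
      by (rule continuous_on_subset[OF V_cont[of Q j, OF Q]]) auto
    show "continuous_on ({0..len N j} \<times> {0<..<Tmax}) (\<lambda>(y, t). V P j y t)"
      by (rule continuous_on_subset[OF V_cont[of P j, OF P]]) auto
    show "continuous_on ({0..len N j} \<times> {0<..<Tmax}) (\<lambda>(y, t). V ?L j y t)"
      by (rule continuous_on_subset[OF V_cont[of ?L j, OF L]]) auto
    fix y t assume y: "y \<in> {0..len N j}"
    show "((\<lambda>z. V Q j z t) has_real_derivative V P j y t) (at y within {0..len N j}) \<and>
        ((\<lambda>z. V P j z t) has_real_derivative V ?L j y t) (at y within {0..len N j}) \<and>
        ((\<lambda>s. V Q j y s) has_real_derivative 1 * V ?L j y t) (at t)"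
      using V_y[of Q j P, OF Q P PQ(3)[OF j] y] V_y[of P j ?L, OF P L PQ(4)[OF j] y] V_t[OF j y] by simp
  qed (use V_match V_kirchhoff in auto)

  define u where "u x t = 1 * glue (\<lambda>j y. V Q j y t) x + 1 * (g2 0 * glue (\<lambda>j y. heat (Q j) y t) x +
      1 * (g1 0 * glue (\<lambda>j y. heat (?L j) y t) x + 1 * g 0))" for x t
  have "\<exists>D1 D2. network_heat N Tmax 1 u D1 D2"
    unfolding u_def
    by (intro exI, rule network_heat_linear[OF V_sol network_heat_linear[OF Q_sol(1) network_heat_linear[OF L_sol(1) network_heat_const]]])
  moreover have u_eq: "u (param N j y) t = V Q j y t + g2 0 * heat (Q j) y t + g1 0 * heat (?L j) y t + g 0"
    if "j \<in> edges N" "y \<in> {0..len N j}" "t \<in> {0..Tmax}" for j y t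
    unfolding u_def
    using glue_param[OF V_match that(1,2)] glue_param[OF Q_sol(2) that(1,2)] glue_param[OF L_sol(2) that(1,2)] that(3)
    by simp
  moreover have "u x 0 = g 0" if x: "x \<in> points N" for x
  proof -
    obtain j y where j: "j \<in> edges N" "y \<in> {0..len N j}" "x = param N j y" using x by (rule pointsE)
    have "V Q j y 0 = integral {0..Tmax} (\<lambda>s. 0)"
      unfolding V_def by (rule integral_cong) (simp add: delayed_heat_def)
    then show ?thesis using u_eq[OF j(1,2), of 0] PQ0(1)[OF j(1,2)] linear_images(3)[OF j(1,2)] T
      by (simp add: j(3) heat_0)
  qed
  moreover have "u v0 t = g t" if t: "t \<in> {0..Tmax}" for t
  proof -
    let ?\<Phi> = "\<lambda>s. g s + g1 s * (t - s) + g2 s * (t - s)\<^sup>2 / 2"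
    let ?k = "\<lambda>s. g3 s * delayed_heat (Q e0) 0 (t - s)"
    have "((\<lambda>s. g3 s * (t - s)\<^sup>2 / 2) has_integral ?\<Phi> t - ?\<Phi> 0) {0..t}"
    proof (rule fundamental_theorem_of_calculus)
      fix s assume s: "s \<in> {0..t}"
      then have sT: "s \<in> {0..Tmax}" "{0..t} \<subseteq> {0..Tmax}" using t by auto
      note d = DERIV_subset[OF g(1)[OF sT(1)] sT(2)] DERIV_subset[OF g(2)[OF sT(1)] sT(2)] DERIV_subset[OF g(3)[OF sT(1)] sT(2)]
      have "(?\<Phi> has_real_derivative g3 s * (t - s)\<^sup>2 / 2) (at s within {0..t})"
      proof (rule DERIV_cong)
        have e: "((\<lambda>s. t - s) has_real_derivative - 1) (at s within {0..t})"
          by (auto intro!: derivative_eq_intros)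
        have e2: "((\<lambda>s. (t - s)\<^sup>2) has_real_derivative - 2 * (t - s)) (at s within {0..t})"
          by (auto intro!: derivative_eq_intros)
        show "(?\<Phi> has_real_derivative g1 s + (g2 s * (t - s) + - 1 * g1 s)
            + (g3 s * (t - s)\<^sup>2 + - 2 * (t - s) * g2 s) / 2) (at s within {0..t})"
          by (intro DERIV_add DERIV_cdivide DERIV_mult d e e2)
        show "g1 s + (g2 s * (t - s) + - 1 * g1 s) + (g3 s * (t - s)\<^sup>2 + - 2 * (t - s) * g2 s) / 2
            = g3 s * (t - s)\<^sup>2 / 2"
          by (simp add: field_simps)
      qed
      then show "(?\<Phi> has_vector_derivative g3 s * (t - s)\<^sup>2 / 2) (at s within {0..t})"
        by (simp add: has_real_derivative_iff_has_vector_derivative)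
    qed (use t in auto)
    then have 1: "(?k has_integral ?\<Phi> t - ?\<Phi> 0) {0..t}"
    proof (rule has_integral_eq[rotated])
      fix s assume "s \<in> {0..t}"
      then have "delayed_heat (Q e0) 0 (t - s) = (t - s)\<^sup>2 / 2"
        using Q_bd[of "t - s"] by (cases "t = s") (auto simp: delayed_heat_def)
      then show "g3 s * (t - s)\<^sup>2 / 2 = ?k s" by simp
    qed
    have 2: "(?k has_integral 0) {t..Tmax}"
      by (rule has_integral_is_0) (auto simp: delayed_heat_def)
    have "(?k has_integral (?\<Phi> t - ?\<Phi> 0) + 0) {0..Tmax}"
      by (rule has_integral_combine[OF _ _ 1 2]) (use t in auto)
    then have "V Q e0 0 t = g t - (g 0 + g1 0 * t + g2 0 * t\<^sup>2 / 2)"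
      unfolding V_def by (simp add: integral_unique)
    then show ?thesis
      using u_eq[OF e0_edge _ t, of 0] len_pos[OF e0_edge] Q_bd[of t] L_bd[of t] t exit_edge(2) by simp
  qed
  ultimately show ?thesis by blast
qed

end

section \<open>The mass balance\<close>

context exit_network
begin

text \<open>
  Every edge has two ends, so a sum over edges of boundary terms can be collected at the vertices; the
  incidence numbers supply the signs.
\<close>

lemma sum_edge_increments:
  fixes h :: "'j \<Rightarrow> real \<Rightarrow> real"
  shows "(\<Sum>j\<in>edges N. h j (len N j) - h j 0) =
    - (\<Sum>v\<in>verts N. \<Sum>j\<in>Inc N v. incidence N v j * h j (from_vertex j v 0))"
proof -
  let ?a = "\<lambda>v j. incidence N v j * h j (from_vertex j v 0)"
  have fin: "finite (verts N)" using network by (simp add: is_network_def)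
  have "(\<Sum>v\<in>verts N. \<Sum>j\<in>Inc N v. ?a v j) = (\<Sum>v\<in>verts N. \<Sum>j\<in>{j\<in>edges N. v \<in> arc_of N j}. ?a v j)"
    by (simp add: Inc_def)
  also have "\<dots> = (\<Sum>j\<in>edges N. \<Sum>v\<in>{v\<in>verts N. v \<in> arc_of N j}. ?a v j)"
    by (rule sum.swap_restrict[OF fin finite_edges])
  also have "\<dots> = (\<Sum>j\<in>edges N. h j 0 - h j (len N j))"
  proof (rule sum.cong[OF refl])
    fix j assume j: "j \<in> edges N"
    have "{v\<in>verts N. v \<in> arc_of N j} = {param N j 0, param N j (len N j)}"
    proof -
      have "v = param N j 0 \<or> v = param N j (len N j)" if "v \<in> verts N" "v \<in> arc_of N j" for v
        using Inc_ends[of v j] that j by (auto simp: Inc_def)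
      then show ?thesis using param_ends[OF j] end_in_Inc[OF j] by (auto simp: Inc_def)
    qed
    moreover have "?a (param N j 0) j = h j 0" "?a (param N j (len N j)) j = - h j (len N j)"
      using incidence_eq[OF param_ends(1)[OF j] end_in_Inc(1)[OF j]]
        incidence_eq[OF param_ends(2)[OF j] end_in_Inc(2)[OF j]] ends_distinct[OF j]
      by (auto simp: from_vertex_def)
    ultimately show "(\<Sum>v\<in>{v\<in>verts N. v \<in> arc_of N j}. ?a v j) = h j 0 - h j (len N j)"
      using ends_distinct[OF j] by simp
  qed
  finally show ?thesis by (simp add: sum_negf[symmetric])
qed

lemma network_heat_edge_continuous:
  assumes "network_heat N Tmax \<sigma> u D1 D2" "j \<in> edges N"
  shows "continuous_on ({0..len N j} \<times> {0..Tmax}) (\<lambda>p. u (param N j (fst p)) (snd p))"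
proof -
  have "continuous_on (points N \<times> {0..Tmax}) (\<lambda>(x, t). u x t)" using assms by (simp add: network_heat_def)
  moreover have "continuous_on ({0..len N j} \<times> {0..Tmax}) (\<lambda>p. (param N j (fst p), snd p))"
    by (intro continuous_intros continuous_on_compose2[OF param_continuous[OF assms(2)]]) auto
  moreover have "(\<lambda>p. (param N j (fst p), snd p)) ` ({0..len N j} \<times> {0..Tmax}) \<subseteq> points N \<times> {0..Tmax}"
    using param_in_points[OF assms(2)] by auto
  ultimately show ?thesis
    using continuous_on_compose2[of "points N \<times> {0..Tmax}" "\<lambda>(x, t). u x t" _ "\<lambda>p. (param N j (fst p), snd p)"]
    by (simp add: case_prod_unfold)
qed

lemma pairing_continuous:
  assumes \<phi>: "network_heat N Tmax \<sigma> \<phi> D1 D2" and \<psi>: "network_heat N Tmax \<tau> \<psi> E1 E2"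
  shows "continuous_on {0..Tmax} (\<lambda>t. network_integral N (\<lambda>x. \<phi> x t * \<psi> x t))"
  unfolding network_integral_def
proof (rule continuous_on_sum)
  fix j assume j: "j \<in> edges N"
  have sw: "continuous_on ({0..Tmax} \<times> cbox 0 (len N j)) (\<lambda>p. u (param N j (snd p)) (fst p))"
    if "network_heat N Tmax \<rho> u A B" for \<rho> u A B
  proof -
    have "continuous_on ({0..Tmax} \<times> {0..len N j}) (\<lambda>p. (snd p, fst p))" by (intro continuous_intros)
    from continuous_on_compose2[OF network_heat_edge_continuous[OF that j] this]
    show ?thesis by (auto simp: image_subset_iff)
  qed
  have "continuous_on ({0..Tmax} \<times> cbox 0 (len N j)) (\<lambda>(t, y). \<phi> (param N j y) t * \<psi> (param N j y) t)"
    unfolding case_prod_unfold by (intro continuous_on_mult sw[OF \<phi>] sw[OF \<psi>])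
  from integral_continuous_on_param[OF this]
  show "continuous_on {0..Tmax} (\<lambda>t. integral {0..len N j} (\<lambda>y. \<phi> (param N j y) t * \<psi> (param N j y) t))"
    by simp
qed

text \<open>
  Green's formula: on each edge the time derivative of \<open>\<phi> \<psi>\<close> is the space derivative of
  \<open>\<phi> \<partial>\<psi> - \<psi> \<partial>\<phi>\<close>. At a transition vertex \<open>\<phi>\<close> and \<open>\<psi>\<close> are common to all edges, so the Kirchhoff conditions
  remove the contribution.
\<close>

lemma pairing_derivative:
  assumes \<phi>: "network_heat N Tmax (- 1) \<phi> D1 D2" and \<psi>: "network_heat N Tmax 1 \<psi> E1 E2"
    and t: "t \<in> {0<..<Tmax}" and \<psi>0: "\<psi> v0 t = 0"
  shows "((\<lambda>t. network_integral N (\<lambda>x. \<phi> x t * \<psi> x t)) has_real_derivative - (\<phi> v0 t * E1 e0 0 t)) (at t)"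
proof -
  define h where "h j y = \<phi> (param N j y) t * E1 j y t - D1 j y t * \<psi> (param N j y) t" for j y
  note dphi = network_heat_derivs[OF \<phi>] and dpsi = network_heat_derivs[OF \<psi>]
  have edge: "((\<lambda>t. integral {0..len N j} (\<lambda>y. \<phi> (param N j y) t * \<psi> (param N j y) t))
      has_real_derivative h j (len N j) - h j 0) (at t)" if j: "j \<in> edges N" for j
  proof -
    let ?f' = "\<lambda>t y. - D2 j y t * \<psi> (param N j y) t + E2 j y t * \<phi> (param N j y) t"
    let ?U = "{0<..<Tmax}"
    have c: "continuous_on (?U \<times> {0..len N j}) (\<lambda>p. f (snd p) (fst p))"
      if "continuous_on ({0..len N j} \<times> ?U) (\<lambda>p. f (fst p) (snd p))" for f :: "real \<Rightarrow> real \<Rightarrow> real"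
    proof -
      have "continuous_on (?U \<times> {0..len N j}) (\<lambda>p. (snd p, fst p))" by (intro continuous_intros)
      from continuous_on_compose2[OF that this] show ?thesis by (auto simp: image_subset_iff)
    qed
    have cp: "continuous_on ({0..len N j} \<times> ?U) (\<lambda>p. \<phi> (param N j (fst p)) (snd p))"
       "continuous_on ({0..len N j} \<times> ?U) (\<lambda>p. \<psi> (param N j (fst p)) (snd p))"
      by (rule continuous_on_subset[OF network_heat_edge_continuous[OF \<phi> j]], force,
          rule continuous_on_subset[OF network_heat_edge_continuous[OF \<psi> j]], force)
    have cd: "continuous_on ({0..len N j} \<times> ?U) (\<lambda>p. D2 j (fst p) (snd p))"
       "continuous_on ({0..len N j} \<times> ?U) (\<lambda>p. E2 j (fst p) (snd p))"
      using \<phi> \<psi> j unfolding network_heat_def case_prod_unfold by blast+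
    have "((\<lambda>t. integral (cbox 0 (len N j)) (\<lambda>y. \<phi> (param N j y) t * \<psi> (param N j y) t))
      has_real_derivative integral (cbox 0 (len N j)) (?f' t)) (at t within ?U)"
    proof (rule leibniz_rule_field_derivative)
      fix t y assume ty: "t \<in> ?U" "y \<in> cbox 0 (len N j)"
      then have y: "y \<in> {0..len N j}" by simp
      from DERIV_mult[OF dphi(3)[OF j y ty(1)] dpsi(3)[OF j y ty(1)]]
      show "((\<lambda>t. \<phi> (param N j y) t * \<psi> (param N j y) t) has_real_derivative ?f' t y) (at t within ?U)"
        by (auto intro: has_field_derivative_at_within)
    next
      fix t assume t: "t \<in> ?U"
      have "continuous_on {0..len N j} (\<lambda>y. \<phi> (param N j y) t)" "continuous_on {0..len N j} (\<lambda>y. \<psi> (param N j y) t)"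
        using dphi(1)[OF j _ t] dpsi(1)[OF j _ t] by (meson DERIV_continuous_on)+
      then show "(\<lambda>y. \<phi> (param N j y) t * \<psi> (param N j y) t) integrable_on cbox 0 (len N j)"
        unfolding cbox_interval by (intro integrable_continuous_real continuous_on_mult)
    next
      show "continuous_on (?U \<times> cbox 0 (len N j)) (\<lambda>(t, y). ?f' t y)"
        unfolding case_prod_unfold cbox_interval
        by (intro continuous_on_add continuous_on_mult continuous_on_minus c cp cd)
    qed (use t in auto)
    moreover have "(?f' t has_integral h j (len N j) - h j 0) {0..len N j}"
    proof (rule fundamental_theorem_of_calculus)
      fix y assume y: "y \<in> {0..len N j}"
      have "(h j has_real_derivative (D1 j y t * E1 j y t + E2 j y t * \<phi> (param N j y) t)
          - (D2 j y t * \<psi> (param N j y) t + E1 j y t * D1 j y t)) (at y within {0..len N j})"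
        unfolding h_def[abs_def]
        by (intro DERIV_diff DERIV_mult dphi[OF j y t] dpsi[OF j y t])
      then show "(h j has_vector_derivative ?f' t y) (at y within {0..len N j})"
        by (simp add: has_real_derivative_iff_has_vector_derivative algebra_simps)
    qed (use len_pos[OF j] in simp)
    ultimately show ?thesis using t at_within_open[of t ?U] by (simp add: integral_unique)
  qed
  have "((\<lambda>t. network_integral N (\<lambda>x. \<phi> x t * \<psi> x t)) has_real_derivative (\<Sum>j\<in>edges N. h j (len N j) - h j 0)) (at t)"
    unfolding network_integral_def by (intro DERIV_sum edge)
  moreover have "(\<Sum>j\<in>edges N. h j (len N j) - h j 0) = - (\<phi> v0 t * E1 e0 0 t)"
  proof -
    let ?B = "\<lambda>v. \<Sum>j\<in>Inc N v. incidence N v j * h j (from_vertex j v 0)"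
    have fin: "finite (verts N)" using network by (simp add: is_network_def)
    have "?B v = 0" if v: "v \<in> verts N" "v \<noteq> v0" for v
    proof -
      have "(\<Sum>j\<in>Inc N v. incidence N v j * D1 j (edge_coord N j v) t) = 0"
        "(\<Sum>j\<in>Inc N v. incidence N v j * E1 j (edge_coord N j v) t) = 0"
        using \<phi> \<psi> v t unfolding network_heat_def transition_verts_eq by blast+
      then have K: "(\<Sum>j\<in>Inc N v. incidence N v j * D1 j (from_vertex j v 0) t) = 0"
        "(\<Sum>j\<in>Inc N v. incidence N v j * E1 j (from_vertex j v 0) t) = 0"
        using edge_coord_vertex[OF v(1)] by simp_all
      have "?B v = (\<Sum>j\<in>Inc N v. \<phi> v t * (incidence N v j * E1 j (from_vertex j v 0) t)
          - \<psi> v t * (incidence N v j * D1 j (from_vertex j v 0) t))"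
        using from_vertex_0(1)[OF v(1)] by (intro sum.cong) (auto simp: h_def algebra_simps)
      also have "\<dots> = \<phi> v t * (\<Sum>j\<in>Inc N v. incidence N v j * E1 j (from_vertex j v 0) t)
          - \<psi> v t * (\<Sum>j\<in>Inc N v. incidence N v j * D1 j (from_vertex j v 0) t)"
        by (simp add: sum_subtractf sum_distrib_left)
      finally show ?thesis using K by simp
    qed
    then have "(\<Sum>v\<in>verts N. ?B v) = ?B v0"
      using sum.remove[OF fin v0_vert, of ?B] by simp
    also have "\<dots> = \<phi> v0 t * E1 e0 0 t"
      using incidence_eq[OF v0_vert, of e0] \<psi>0 by (simp add: exit_edge from_vertex_def h_def)
    finally show ?thesis using sum_edge_increments[of h] by simp
  qed
  ultimately show ?thesis by simp
qed

text \<open>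
  The derivative of the pairing is known at interior times only. The fundamental theorem of
  calculus still applies, since the antiderivative is continuous on the closed interval; it also shows
  that the integrand is integrable.
\<close>

lemma exit_mass_eq:
  assumes sol: "classical_solution N v0 Tmax c m0 \<phi> \<psi>" and s: "s \<in> {0..Tmax}"
  shows "exit_mass N v0 e0 c \<psi> s = network_integral N m0 - network_integral N (\<lambda>x. \<phi> x s * \<psi> x s)"
proof -
  let ?M = "\<lambda>s. network_integral N (\<lambda>x. \<phi> x s * \<psi> x s)"
  obtain D1 D2 E1 E2 where h: "network_heat N Tmax (- 1) \<phi> D1 D2" "network_heat N Tmax 1 \<psi> E1 E2"
    using sol unfolding classical_solution_iff by blast
  have b: "\<psi> v0 s = 0" "\<phi> v0 s = exp (c s)" if "s \<in> {0..Tmax}" for s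
    using sol that unfolding classical_solution_iff by blast+
  have pos: "\<phi> x 0 > 0" "\<psi> x 0 = m0 x / \<phi> x 0" if "x \<in> points N" for x
    using sol that s unfolding classical_solution_iff by auto
  have "((\<lambda>r. exp (c r) * vertex_deriv N e0 1 (\<lambda>x. \<psi> x r) v0) has_integral (- ?M s - - ?M 0)) {0..s}"
  proof (rule fundamental_theorem_of_calculus_interior)
    fix r assume "r \<in> {0<..<s}"
    then have r: "r \<in> {0<..<Tmax}" "r \<in> {0..Tmax}" using s by auto
    have "vertex_deriv N e0 1 (\<lambda>x. \<psi> x r) v0 = E1 e0 0 r"
      using network_heat_vertex_deriv[OF h(2) v0_vert, of e0] r edge_coord_vertex[OF v0_vert, of e0] exit_edge
      by (simp add: from_vertex_def)
    then show "((\<lambda>s. - ?M s) has_vector_derivative exp (c r) * vertex_deriv N e0 1 (\<lambda>x. \<psi> x r) v0) (at r)"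
      using DERIV_minus[OF pairing_derivative[OF h r(1) b(1)[OF r(2)]]] b(2)[OF r(2)]
      by (simp add: has_real_derivative_iff_has_vector_derivative)
  next
    show "continuous_on {0..s} (\<lambda>s. - ?M s)"
      by (intro continuous_on_minus continuous_on_subset[OF pairing_continuous[OF h]]) (use s in auto)
  qed (use s in auto)
  moreover have "?M 0 = network_integral N m0"
    unfolding network_integral_def
  proof (intro sum.cong refl integral_cong)
    fix j y assume "j \<in> edges N" "y \<in> {0..len N j}"
    from pos[OF param_in_points[OF this]]
    show "\<phi> (param N j y) 0 * \<psi> (param N j y) 0 = m0 (param N j y)" by simp
  qed
  ultimately show ?thesis unfolding exit_mass_def by (simp add: integral_unique)
qed

end

section \<open>Existence of classical solutions\<close>

lemma smooth_on_UNIV_derivs: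
  fixes f :: "real \<Rightarrow> real"
  assumes "smooth_on UNIV f"
  shows "(nderiv UNIV k f has_real_derivative nderiv UNIV (Suc k) f y) (at y)"
  using assms unfolding smooth_on_def has_real_derivative_iff_has_vector_derivative
  by (simp add: vector_derivative_works[symmetric])

text \<open>
  The boundary values of \<open>\<phi>\<close> are exponentials of the cost.
\<close>

lemma exp_three_derivs:
  fixes a :: "real \<Rightarrow> real"
  assumes d: "\<And>t. (a has_real_derivative a1 t) (at t)" "\<And>t. (a1 has_real_derivative a2 t) (at t)"
    "\<And>t. (a2 has_real_derivative a3 t) (at t)"
  shows "((\<lambda>t. exp (a t)) has_real_derivative exp (a t) * a1 t) (at t)"
    and "((\<lambda>t. exp (a t) * a1 t) has_real_derivative exp (a t) * (a1 t * a1 t + a2 t)) (at t)"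
    and "((\<lambda>t. exp (a t) * (a1 t * a1 t + a2 t)) has_real_derivative
          exp (a t) * (a1 t * (a1 t * a1 t + a2 t) + 2 * a1 t * a2 t + a3 t)) (at t)"
proof -
  show e: "((\<lambda>t. exp (a t)) has_real_derivative exp (a t) * a1 t) (at t)"
    by (rule DERIV_chain2[OF DERIV_exp d(1)])
  show "((\<lambda>t. exp (a t) * a1 t) has_real_derivative exp (a t) * (a1 t * a1 t + a2 t)) (at t)"
    by (rule DERIV_cong[OF DERIV_mult[OF e d(2)]]) (simp add: algebra_simps)
  show "((\<lambda>t. exp (a t) * (a1 t * a1 t + a2 t)) has_real_derivative
          exp (a t) * (a1 t * (a1 t * a1 t + a2 t) + 2 * a1 t * a2 t + a3 t)) (at t)"
    by (rule DERIV_cong[OF DERIV_mult[OF e DERIV_add[OF DERIV_mult[OF d(2) d(2)] d(3)]]]) (simp add: algebra_simps)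
qed

context exit_network
begin

lemma network_heat_cong:
  assumes u: "network_heat N Tmax \<sigma> u D1 D2" and eq: "\<And>x t. x \<in> points N \<Longrightarrow> t \<in> {0..Tmax} \<Longrightarrow> w x t = u x t"
  shows "network_heat N Tmax \<sigma> w D1 D2"
  unfolding network_heat_def
proof (intro conjI ballI)
  show "continuous_on (points N \<times> {0..Tmax}) (\<lambda>(x, t). w x t)"
    by (rule continuous_on_eq[of _ "\<lambda>(x, t). u x t"]) (use u eq in \<open>auto simp: network_heat_def\<close>)
  fix j assume j: "j \<in> edges N"
  show "continuous_on ({0..len N j} \<times> {0<..<Tmax}) (\<lambda>(y, t). D1 j y t)"
    "continuous_on ({0..len N j} \<times> {0<..<Tmax}) (\<lambda>(y, t). D2 j y t)"
    using u j by (simp_all add: network_heat_def)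
  fix y t assume y: "y \<in> {0..len N j}" and t: "t \<in> {0<..<Tmax}"
  note d = network_heat_derivs[OF u j y t]
  show "((\<lambda>z. w (param N j z) t) has_real_derivative D1 j y t) (at y within {0..len N j})"
    by (rule derivative_cong_on[OF y _ d(1)]) (use eq param_in_points[OF j] t in auto)
  show "((\<lambda>z. D1 j z t) has_real_derivative D2 j y t) (at y within {0..len N j})" by (rule d(2))
  show "((\<lambda>s. w (param N j y) s) has_real_derivative \<sigma> * D2 j y t) (at t)"
    by (rule has_field_derivative_transform_within_open[OF d(3), of "{0<..<Tmax}"])
      (use eq param_in_points[OF j y] t in auto)
next
  fix v t assume "v \<in> transition_verts N" "t \<in> {0<..<Tmax}"
  then show "(\<Sum>j\<in>Inc N v. incidence N v j * D1 j (edge_coord N j v) t) = 0"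
    using u unfolding network_heat_def by blast
qed

text \<open>
  The extension \<open>F\<close> is part of the conclusion, as the analyticity of the outgoing flux is read off from it.
\<close>

lemma initial_value_solution:
  assumes w: "continuous_on (points N) w" "w v0 = 0"
  obtains F where "\<And>j. j \<in> edges N \<Longrightarrow> tame (F j)"
    "\<And>Tmax. network_heat N Tmax 1 (image_flow F) (\<lambda>j. heat_x (F j)) (\<lambda>j. heat_xx (F j))"
    "\<And>x. x \<in> points N \<Longrightarrow> image_flow F x 0 = w x"
    "\<And>t. 0 \<le> t \<Longrightarrow> image_flow F v0 t = 0"
proof -
  let ?u = "\<lambda>j y. w (param N j y)"
  define F where "F = image_extension ?u (\<lambda>z. 0)"
  have m: "matching ?u" unfolding matching_def using from_vertex_0(1) by simp
  have c: "continuous_on {0..len N j} (?u j)" if "j \<in> edges N" for j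
    by (rule continuous_on_compose2[OF w(1) param_continuous[OF that]]) (use param_in_points[OF that] in auto)
  have q0: "(0::real) = ?u e0 0" using w(2) exit_edge(2) by simp
  have F: "tame (F j)" if "j \<in> edges N" for j
    unfolding F_def by (rule image_extension_tame[OF m c tame_zero q0 that])
  have R: "reflecting (\<lambda>z. 0) F"
    unfolding F_def by (rule image_extension_reflecting[OF m c tame_zero q0])
  note sol = image_solution[OF F R]
  have e0: "0 \<in> {0..len N e0}" using len_pos[OF e0_edge] by simp
  have init: "image_flow F x 0 = w x" if "x \<in> points N" for x
  proof -
    obtain j y where j: "j \<in> edges N" "y \<in> {0..len N j}" "x = param N j y" using \<open>x \<in> points N\<close> by (rule pointsE)
    have "image_flow F x 0 = heat (F j) y 0"
      unfolding j(3) by (rule glue_param[OF sol(2) j(1,2)]) simp_all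
    also have "\<dots> = w x" unfolding heat_0 F_def image_extension_on_edge[OF j(1,2)] j(3) ..
    finally show ?thesis .
  qed
  have bd: "image_flow F v0 t = 0" if "0 \<le> t" for t
  proof (cases "t = 0")
    case True
    then show ?thesis using init[OF v0_points] w(2) by simp
  next
    case False
    then have t: "0 < t" using that by simp
    have "image_flow F (param N e0 0) t = heat (F e0) 0 t"
      by (rule glue_param[OF sol(2) e0_edge e0]) (use that in simp_all)
    also have "\<dots> = heat (\<lambda>z. 0) 0 t" by (rule sol(3)[OF _ t])
    finally show ?thesis by (simp add: exit_edge(2) heat_def)
  qed
  show ?thesis by (rule that[OF F sol(1) init bd])
qed

text \<open>
  First \<open>\<phi>\<close>, whose time reversal has the constant initial value \<open>exp (c Tmax)\<close> and the boundary values
  \<open>exp (c (Tmax - t))\<close>; as these are at least 1, so is \<open>\<phi>\<close>, and it can be divided by in the initial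
  condition of \<open>\<psi>\<close>.
\<close>

lemma classical_solution_exists:
  assumes T: "0 < Tmax"
    and c: "\<And>s. (c has_real_derivative c1 s) (at s)" "\<And>s. (c1 has_real_derivative c2 s) (at s)"
      "\<And>s. (c2 has_real_derivative c3 s) (at s)" "continuous_on UNIV c3"
    and c_nonneg: "\<And>s. s \<in> {0..Tmax} \<Longrightarrow> 0 \<le> c s"
    and m0: "continuous_on (points N) m0" "m0 v0 = 0"
  shows "\<exists>\<phi> \<psi>. classical_solution N v0 Tmax c m0 \<phi> \<psi>"
proof -
  define a where "a t = c (Tmax - t)" for t
  define a1 where "a1 t = - c1 (Tmax - t)" for t
  define a2 where "a2 t = c2 (Tmax - t)" for t
  define a3 where "a3 t = - c3 (Tmax - t)" for t
  have r: "((\<lambda>t. Tmax - t) has_real_derivative - 1) (at t)" for t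
    by (auto intro!: derivative_eq_intros)
  have a: "(a has_real_derivative a1 t) (at t)" "(a1 has_real_derivative a2 t) (at t)" "(a2 has_real_derivative a3 t) (at t)" for t
    unfolding a_def[abs_def] a1_def[abs_def] a2_def[abs_def] a3_def
    using DERIV_chain2[OF c(1) r, of t] DERIV_minus[OF DERIV_chain2[OF c(2) r, of t]] DERIV_chain2[OF c(3) r, of t] by simp_all
  have ca: "continuous_on {0..Tmax} a" "continuous_on {0..Tmax} a1" "continuous_on {0..Tmax} a2"
    using a by (meson DERIV_continuous_on has_field_derivative_at_within)+
  have ca3: "continuous_on {0..Tmax} a3"
    unfolding a3_def by (intro continuous_intros continuous_on_compose2[OF c(4)]) auto
  have "continuous_on {0..Tmax} (\<lambda>t. exp (a t) * (a1 t * (a1 t * a1 t + a2 t) + 2 * a1 t * a2 t + a3 t))"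
    by (intro continuous_intros ca ca3)
  from boundary_value_solution[OF T exp_three_derivs[OF a, THEN has_field_derivative_at_within] this]
  obtain u D1 D2 where u: "network_heat N Tmax 1 u D1 D2" "\<And>x. x \<in> points N \<Longrightarrow> u x 0 = exp (a 0)"
      "\<And>t. t \<in> {0..Tmax} \<Longrightarrow> u v0 t = exp (a t)"
    by blast
  have "0 \<le> 1 * u x t + - 1 * 1" if "x \<in> points N" "t \<in> {0..Tmax}" for x t
    by (rule network_heat_nonneg[OF network_heat_linear[OF u(1) network_heat_const[of Tmax 1 1], of 1 "- 1"]])
      (use u(2,3) that T c_nonneg in \<open>auto simp: a_def\<close>)
  then have u_pos: "0 < u x t" if "x \<in> points N" "t \<in> {0..Tmax}" for x t using that by force
  define \<phi> where "\<phi> x t = u x (Tmax - t)" for x t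
  have \<phi>: "network_heat N Tmax (- 1) \<phi> (\<lambda>j y t. D1 j y (Tmax - t)) (\<lambda>j y t. D2 j y (Tmax - t))"
    unfolding \<phi>_def by (rule network_heat_reverse[OF u(1)])
  have \<phi>_pos: "0 < \<phi> x t" if "x \<in> points N" "t \<in> {0..Tmax}" for x t
    unfolding \<phi>_def using u_pos that by simp
  have "continuous_on (points N \<times> {0..Tmax}) (\<lambda>p. \<phi> (fst p) (snd p))"
    using \<phi> by (simp add: network_heat_def case_prod_unfold)
  from continuous_on_compose2[OF this, of "points N" "\<lambda>x. (x, 0)"]
  have "continuous_on (points N) (\<lambda>x. \<phi> x 0)" using T by (force intro!: continuous_intros)
  then have w: "continuous_on (points N) (\<lambda>x. m0 x / \<phi> x 0)"
    using \<phi>_pos[of _ 0] T by (intro continuous_on_divide m0) force+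
  obtain F where F: "network_heat N Tmax 1 (image_flow F) (\<lambda>j. heat_x (F j)) (\<lambda>j. heat_xx (F j))"
    "\<And>x. x \<in> points N \<Longrightarrow> image_flow F x 0 = m0 x / \<phi> x 0"
    "\<And>t. 0 \<le> t \<Longrightarrow> image_flow F v0 t = 0"
    by (rule initial_value_solution[OF w]) (use m0(2) in simp, blast)
  have "classical_solution N v0 Tmax c m0 \<phi> (image_flow F)"
    unfolding classical_solution_iff
  proof (intro conjI ballI)
    show "\<exists>D1 D2. network_heat N Tmax (- 1) \<phi> D1 D2" using \<phi> by blast
    show "\<exists>D1 D2. network_heat N Tmax 1 (image_flow F) D1 D2" using F(1) by blast
    show "\<phi> x Tmax = exp (c Tmax)" if "x \<in> points N" for x using u(2)[OF that] by (simp add: \<phi>_def a_def)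
    show "\<phi> v0 s = exp (c s)" if "s \<in> {0..Tmax}" for s using u(3)[of "Tmax - s"] that by (simp add: \<phi>_def a_def)
  qed (use \<phi>_pos F in auto)
  then show ?thesis by blast
qed

section \<open>Properties of the exit mass\<close>

lemma classical_solution_bounds:
  assumes sol: "classical_solution N v0 Tmax c m0 \<phi> \<psi>" and T: "0 < Tmax"
    and c: "\<And>s. s \<in> {0..Tmax} \<Longrightarrow> 0 \<le> c s" and m0: "\<And>x. x \<in> points N \<Longrightarrow> 0 \<le> m0 x"
    and x: "x \<in> points N" and t: "t \<in> {0..Tmax}"
  shows "1 \<le> \<phi> x t" "0 \<le> \<psi> x t"
proof -
  obtain D1 D2 E1 E2 where h: "network_heat N Tmax (- 1) \<phi> D1 D2" "network_heat N Tmax 1 \<psi> E1 E2"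
    using sol unfolding classical_solution_iff by blast
  have b: "\<psi> v0 s = 0" "\<phi> v0 s = exp (c s)" if "s \<in> {0..Tmax}" for s
    using sol that unfolding classical_solution_iff by blast+
  have i: "\<psi> x 0 = m0 x / \<phi> x 0" "\<phi> x Tmax = exp (c Tmax)" "0 < \<phi> x 0" if "x \<in> points N" for x
    using sol that T unfolding classical_solution_iff by auto
  have r: "network_heat N Tmax 1 (\<lambda>x t. \<phi> x (Tmax - t)) (\<lambda>j y t. D1 j y (Tmax - t)) (\<lambda>j y t. D2 j y (Tmax - t))"
    using network_heat_reverse[OF h(1)] by simp
  have "0 \<le> 1 * \<phi> x (Tmax - (Tmax - t)) + - 1 * 1"
    by (rule network_heat_nonneg[OF network_heat_linear[OF r network_heat_const[of Tmax 1 1], of 1 "- 1"] _ _ x])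
      (use i(2) b(2) c t T in auto)
  then show "1 \<le> \<phi> x t" by simp
  show "0 \<le> \<psi> x t"
    by (rule network_heat_nonneg[OF h(2) _ _ x t]) (use i b m0 in \<open>auto intro: divide_nonneg_pos\<close>)
qed

text \<open>
  Monotone because \<open>\<psi> \<ge> 0\<close> vanishes at \<open>v0\<close>. If the exit mass is constant on an interval, then the flux
  vanishes there, hence at all times by \<open>gmoment_vanish\<close>, and the exit mass equals its value at time zero.
\<close>

lemma exit_mass_properties:
  assumes sol: "classical_solution N v0 Tmax c m0 \<phi> \<psi>" and T: "0 < Tmax"
    and c: "\<And>s. s \<in> {0..Tmax} \<Longrightarrow> 0 \<le> c s" and m0: "\<And>x. x \<in> points N \<Longrightarrow> 0 \<le> m0 x"
    and cm0: "continuous_on (points N) m0" "m0 v0 = 0"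
  shows "continuous_on {0..Tmax} (exit_mass N v0 e0 c \<psi>)"
    and "0 \<le> s \<Longrightarrow> s \<le> s' \<Longrightarrow> s' \<le> Tmax \<Longrightarrow> exit_mass N v0 e0 c \<psi> s \<le> exit_mass N v0 e0 c \<psi> s'"
    and "0 \<le> s \<Longrightarrow> s < s' \<Longrightarrow> s' \<le> Tmax \<Longrightarrow> exit_mass N v0 e0 c \<psi> s = exit_mass N v0 e0 c \<psi> s' \<Longrightarrow>
      exit_mass N v0 e0 c \<psi> s = 0"
proof -
  let ?X = "exit_mass N v0 e0 c \<psi>"
  let ?M = "\<lambda>s. network_integral N (\<lambda>x. \<phi> x s * \<psi> x s)"
  obtain D1 D2 E1 E2 where h: "network_heat N Tmax (- 1) \<phi> D1 D2" and "network_heat N Tmax 1 \<psi> E1 E2"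
    using sol unfolding classical_solution_iff by blast
  have b: "\<psi> v0 s = 0" "\<phi> v0 s = exp (c s)" if "s \<in> {0..Tmax}" for s
    using sol that unfolding classical_solution_iff by blast+
  have i: "\<psi> x 0 = m0 x / \<phi> x 0" "0 < \<phi> x 0" if "x \<in> points N" for x
    using sol that T unfolding classical_solution_iff by auto
  \<comment> \<open>\<open>\<psi>\<close> coincides with the solution constructed by images.\<close>
  have w: "continuous_on (points N) (\<lambda>x. m0 x / \<phi> x 0)"
  proof -
    have "continuous_on (points N \<times> {0..Tmax}) (\<lambda>p. \<phi> (fst p) (snd p))"
      using h by (simp add: network_heat_def case_prod_unfold)
    from continuous_on_compose2[OF this, of "points N" "\<lambda>x. (x, 0)"]
    have "continuous_on (points N) (\<lambda>x. \<phi> x 0)" using T by (force intro!: continuous_intros)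
    then show ?thesis using i(2) by (intro continuous_on_divide cm0) force+
  qed
  obtain F where F: "\<And>j. j \<in> edges N \<Longrightarrow> tame (F j)"
    "network_heat N Tmax 1 (image_flow F) (\<lambda>j. heat_x (F j)) (\<lambda>j. heat_xx (F j))"
    "\<And>x. x \<in> points N \<Longrightarrow> image_flow F x 0 = m0 x / \<phi> x 0"
    "\<And>t. 0 \<le> t \<Longrightarrow> image_flow F v0 t = 0"
    by (rule initial_value_solution[OF w]) (use cm0(2) in simp, blast)
  have same: "\<psi> x t = image_flow F x t" if "x \<in> points N" "t \<in> {0..Tmax}" for x t
  proof -
    have "\<bar>1 * \<psi> x t + - 1 * image_flow F x t\<bar> \<le> 0"
      by (rule network_heat_bound[OF network_heat_linear[OF \<open>network_heat N Tmax 1 \<psi> E1 E2\<close> F(2), of 1 "- 1"] _ _ that])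
        (use i b F(3,4) in auto)
    then show ?thesis by simp
  qed
  have \<psi>: "network_heat N Tmax 1 \<psi> (\<lambda>j. heat_x (F j)) (\<lambda>j. heat_xx (F j))"
    by (rule network_heat_cong[OF F(2) same])
  have X: "?X s = network_integral N m0 - ?M s" if "s \<in> {0..Tmax}" for s
    by (rule exit_mass_eq[OF sol that])
  have cM: "continuous_on {0..Tmax} ?M" by (rule pairing_continuous[OF h \<psi>])
  show cX: "continuous_on {0..Tmax} ?X"
    by (rule continuous_on_eq[OF continuous_on_diff[OF continuous_on_const cM]]) (use X in auto)
  have dX: "(?X has_real_derivative exp (c t) * heat_x (F e0) 0 t) (at t)" if t: "t \<in> {0<..<Tmax}" for t
  proof (rule has_field_derivative_transform_within_open)
    have t': "t \<in> {0..Tmax}" using t by auto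
    show "((\<lambda>s. network_integral N m0 - ?M s) has_real_derivative exp (c t) * heat_x (F e0) 0 t) (at t)"
      using DERIV_diff[OF DERIV_const[of "network_integral N m0"] pairing_derivative[OF h \<psi> t b(1)[OF t']]] b(2)[OF t']
      by simp
    show "network_integral N m0 - ?M s = ?X s" if "s \<in> {0<..<Tmax}" for s using X[of s] that by auto
  qed (use t in auto)
  have nonneg: "0 \<le> heat_x (F e0) 0 t" if t: "t \<in> {0<..<Tmax}" for t
  proof (rule one_sided_derivative_nonneg)
    have L: "0 < len N e0" by (rule len_pos[OF e0_edge])
    show "((\<lambda>z. \<psi> (param N e0 z) t) has_real_derivative heat_x (F e0) 0 t) (at 0 within {0..len N e0})"
      using \<psi> e0_edge t L unfolding network_heat_def by auto
    show "\<psi> (param N e0 0) t \<le> \<psi> (param N e0 z) t" if "z \<in> {0..len N e0}" for z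
      using classical_solution_bounds(2)[OF sol T c m0 param_in_points[OF e0_edge that], of t] b(1)[of t] t
      by (simp add: exit_edge(2))
  qed (use len_pos[OF e0_edge] in auto)
  have mono: "?X s \<le> ?X s'" if "0 \<le> s" "s \<le> s'" "s' \<le> Tmax" for s s'
  proof (cases "s = s'")
    case False
    then have "s < s'" using that by simp
    moreover have "continuous_on {s..s'} ?X" by (rule continuous_on_subset[OF cX]) (use that in auto)
    moreover have "?X differentiable (at z)" if "s < z" "z < s'" for z
      using dX[of z] \<open>s < z\<close> \<open>z < s'\<close> \<open>0 \<le> s\<close> \<open>s' \<le> Tmax\<close>
      unfolding real_differentiable_def by (intro exI) simp
    ultimately obtain l z where lz: "s < z" "z < s'" "(?X has_real_derivative l) (at z)" "?X s' - ?X s = (s' - s) * l"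
      using MVT[of s s' ?X] by blast
    have z: "z \<in> {0<..<Tmax}" using lz that by auto
    have "l = exp (c z) * heat_x (F e0) 0 z" by (rule DERIV_unique[OF lz(3) dX[OF z]])
    then have "0 \<le> l" using nonneg[OF z] by simp
    then have "0 \<le> (s' - s) * l" using that by simp
    then show ?thesis using lz(4) by simp
  qed simp
  then show "0 \<le> s \<Longrightarrow> s \<le> s' \<Longrightarrow> s' \<le> Tmax \<Longrightarrow> ?X s \<le> ?X s'" .
  show "?X s = 0" if s: "0 \<le> s" "s < s'" "s' \<le> Tmax" and eq: "?X s = ?X s'"
  proof -
    have flat: "heat_x (F e0) 0 t = 0" if t: "t \<in> {s<..<s'}" for t
    proof -
      have t': "t \<in> {0<..<Tmax}" using t s by auto
      have "(?X has_real_derivative 0) (at t)"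
      proof (rule has_field_derivative_transform_within_open[OF DERIV_const[of "?X s"] _ t])
        fix r assume "r \<in> {s<..<s'}"
        then have "?X s \<le> ?X r" "?X r \<le> ?X s'" using mono[of s r] mono[of r s'] s by auto
        then show "?X s = ?X r" using eq by linarith
      qed simp
      from DERIV_unique[OF this dX[OF t']] show ?thesis by simp
    qed
    have g0: "gmoment 1 (F e0) 0 p = 0 \<longleftrightarrow> heat_x (F e0) 0 (1/(4*p)) = 0" if "0 < p" for p
    proof -
      have "1/(4*(1/(4*p))) = p" using that by simp
      then show ?thesis unfolding heat_x_def using that by simp
    qed
    define r where "r = (s + s') / 2"
    have r: "s < r" "r < s'" "0 < r" using s by (auto simp: r_def)
    have all: "gmoment 1 (F e0) 0 p = 0" if "0 < p" for p
    proof (rule gmoment_vanish[OF F(1)[OF e0_edge] _ _ _ that])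
      show "0 \<le> 1/(4 * s' )" "1/(4 * s' ) < 1/(4*r)" using r by (auto simp: divide_strict_left_mono)
      fix q assume q: "q \<in> {1/(4 * s' )<..<1/(4*r)}"
      have s'0: "0 < s'" using r by simp
      have "0 < 1/(4 * s' )" using s'0 by simp
      then have q0: "0 < q" using q unfolding greaterThanLessThan_iff by linarith
      have "1/(4*q) < s'" "r < 1/(4*q)" using q q0 r s'0 by (auto simp: field_simps)
      then have "1/(4*q) \<in> {s<..<s'}" using r by auto
      then show "gmoment 1 (F e0) 0 q = 0" using flat g0[OF q0] by blast
    qed
    have "?X s = ?X 0"
    proof (cases "s = 0")
      case False
      then have "0 < s" using s by simp
      moreover have "continuous_on {0..s} ?X" by (rule continuous_on_subset[OF cX]) (use s in auto)
      moreover have "(?X has_real_derivative 0) (at t)" if "0 < t" "t < s" for t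
      proof -
        have "heat_x (F e0) 0 t = 0" using all[of "1/(4*t)"] that by (simp add: heat_x_def)
        then show ?thesis using dX[of t] that s by simp
      qed
      ultimately show ?thesis by (intro DERIV_isconst2[of 0 s]) auto
    qed simp
    then show ?thesis by (simp add: exit_mass_def)
  qed
qed

text \<open>
  The maximum principle compares first \<open>\<phi>\<close> and \<open>\<phi>'\<close>, whose boundary and final values differ by at most
  \<open>\<delta>\<close>, and then \<open>\<psi>\<close> and \<open>\<psi>'\<close>, whose initial values differ by at most \<open>B \<delta>\<close> as \<open>\<phi>, \<phi>' \<ge> 1\<close>.
\<close>

lemma exit_mass_stability:
  assumes sol: "classical_solution N v0 Tmax c m0 \<phi> \<psi>" and sol': "classical_solution N v0 Tmax c' m0 \<phi>' \<psi>'"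
    and T: "0 < Tmax" and t: "t \<in> {0..Tmax}"
    and c: "\<And>s. s \<in> {0..Tmax} \<Longrightarrow> 0 \<le> c s" "\<And>s. s \<in> {0..Tmax} \<Longrightarrow> 0 \<le> c' s"
    and m0: "\<And>x. x \<in> points N \<Longrightarrow> 0 \<le> m0 x" "\<And>x. x \<in> points N \<Longrightarrow> m0 x \<le> B"
    and C: "\<And>s. s \<in> {0..Tmax} \<Longrightarrow> exp (c' s) \<le> C"
    and \<delta>: "\<And>s. s \<in> {0..Tmax} \<Longrightarrow> \<bar>exp (c s) - exp (c' s)\<bar> \<le> \<delta>"
  shows "\<bar>exit_mass N v0 e0 c \<psi> t - exit_mass N v0 e0 c' \<psi>' t\<bar> \<le> (1 + C) * B * \<delta> * (\<Sum>j\<in>edges N. len N j)"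
proof -
  obtain D1 D2 E1 E2 where h: "network_heat N Tmax (- 1) \<phi> D1 D2" "network_heat N Tmax 1 \<psi> E1 E2"
    using sol unfolding classical_solution_iff by blast
  obtain D1' D2' E1' E2' where h': "network_heat N Tmax (- 1) \<phi>' D1' D2'" "network_heat N Tmax 1 \<psi>' E1' E2'"
    using sol' unfolding classical_solution_iff by blast
  have b: "\<psi> v0 s = 0" "\<phi> v0 s = exp (c s)" "\<psi>' v0 s = 0" "\<phi>' v0 s = exp (c' s)" if "s \<in> {0..Tmax}" for s
    using sol sol' that unfolding classical_solution_iff by blast+
  have i: "\<psi> x 0 = m0 x / \<phi> x 0" "\<psi>' x 0 = m0 x / \<phi>' x 0" "\<phi> x Tmax = exp (c Tmax)" "\<phi>' x Tmax = exp (c' Tmax)"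
    if "x \<in> points N" for x
    using sol sol' that unfolding classical_solution_iff by auto
  have ge: "1 \<le> \<phi> x t" "0 \<le> \<psi> x t" "1 \<le> \<phi>' x t" if "x \<in> points N" "t \<in> {0..Tmax}" for x t
    by (rule classical_solution_bounds[OF sol T _ _ that], (use c m0 in auto)[2],
        rule classical_solution_bounds[OF sol T _ _ that], (use c m0 in auto)[2],
        rule classical_solution_bounds[OF sol' T _ _ that], (use c m0 in auto)[2])
  have z: "0 \<in> {0..Tmax}" "Tmax \<in> {0..Tmax}" using T by auto
  have \<delta>0: "0 \<le> \<delta>" using \<delta>[OF z(1)] by linarith
  have B0: "0 \<le> B" using m0[OF v0_points] by simp
  have C0: "0 \<le> C" using C[OF z(1)] exp_ge_zero[of "c' 0"] by linarith
  have d\<phi>: "\<bar>\<phi> x t - \<phi>' x t\<bar> \<le> \<delta>" if "x \<in> points N" "t \<in> {0..Tmax}" for x t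
  proof -
    have "\<bar>1 * \<phi> x t + - 1 * \<phi>' x t\<bar> \<le> \<delta>"
      by (rule network_heat_backward_bound[OF network_heat_linear[OF h(1) h'(1), of 1 "- 1"] _ _ that])
        (use i b \<delta> z in auto)
    then show ?thesis by simp
  qed
  have \<psi>_le: "\<bar>\<psi> x t\<bar> \<le> B" if "x \<in> points N" "t \<in> {0..Tmax}" for x t
  proof (rule network_heat_bound[OF h(2) _ _ that])
    fix x assume x: "x \<in> points N"
    have "m0 x / \<phi> x 0 \<le> m0 x / 1" using ge(1)[OF x z(1)] m0(1)[OF x] by (intro divide_left_mono) auto
    then show "\<bar>\<psi> x 0\<bar> \<le> B" using m0(2)[OF x] ge(2)[OF x z(1)] i(1)[OF x] by simp
  qed (use b B0 in auto)
  have \<phi>'_le: "\<bar>\<phi>' x t\<bar> \<le> C" if "x \<in> points N" "t \<in> {0..Tmax}" for x t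
    by (rule network_heat_backward_bound[OF h'(1) _ _ that]) (use i b C z in auto)
  have d\<psi>: "\<bar>\<psi> x t - \<psi>' x t\<bar> \<le> B * \<delta>" if "x \<in> points N" "t \<in> {0..Tmax}" for x t
  proof -
    have "\<bar>1 * \<psi> x t + - 1 * \<psi>' x t\<bar> \<le> B * \<delta>"
    proof (rule network_heat_bound[OF network_heat_linear[OF h(2) h'(2), of 1 "- 1"] _ _ that])
      fix x assume x: "x \<in> points N"
      have p: "1 \<le> \<phi> x 0" "1 \<le> \<phi>' x 0" using ge(1,3)[OF x z(1)] .
      have "\<psi> x 0 - \<psi>' x 0 = m0 x * (\<phi>' x 0 - \<phi> x 0) / (\<phi> x 0 * \<phi>' x 0)"
        using p i[OF x] by (simp add: field_simps)
      then have "\<bar>\<psi> x 0 - \<psi>' x 0\<bar> = m0 x * \<bar>\<phi> x 0 - \<phi>' x 0\<bar> / (\<phi> x 0 * \<phi>' x 0)"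
        using p m0(1)[OF x] by (simp add: abs_mult abs_minus_commute)
      also have "\<dots> \<le> m0 x * \<bar>\<phi> x 0 - \<phi>' x 0\<bar> / 1"
        using p m0(1)[OF x] mult_mono[of 1 "\<phi> x 0" 1 "\<phi>' x 0"] by (intro divide_left_mono) auto
      also have "\<dots> \<le> B * \<delta>"
        using m0[OF x] d\<phi>[OF x z(1)] B0 by (simp add: mult_mono)
      finally show "\<bar>1 * \<psi> x 0 + - 1 * \<psi>' x 0\<bar> \<le> B * \<delta>" by simp
    qed (use b B0 \<delta>0 in auto)
    then show ?thesis by simp
  qed
  let ?K = "(1 + C) * B * \<delta>"
  have prod: "\<bar>\<phi> x t * \<psi> x t - \<phi>' x t * \<psi>' x t\<bar> \<le> ?K" if x: "x \<in> points N" for x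
  proof -
    have "\<phi> x t * \<psi> x t - \<phi>' x t * \<psi>' x t = (\<phi> x t - \<phi>' x t) * \<psi> x t + \<phi>' x t * (\<psi> x t - \<psi>' x t)"
      by (simp add: algebra_simps)
    also have "\<bar>\<dots>\<bar> \<le> \<bar>\<phi> x t - \<phi>' x t\<bar> * \<bar>\<psi> x t\<bar> + \<bar>\<phi>' x t\<bar> * \<bar>\<psi> x t - \<psi>' x t\<bar>"
      unfolding abs_mult[symmetric] by (rule abs_triangle_ineq)
    also have "\<dots> \<le> \<delta> * B + C * (B * \<delta>)"
      using d\<phi>[OF x t] \<psi>_le[OF x t] \<phi>'_le[OF x t] d\<psi>[OF x t] \<delta>0 C0 by (intro add_mono mult_mono) auto
    finally show ?thesis by (simp add: algebra_simps)
  qed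
  have int: "(\<lambda>y. u (param N j y) t * w (param N j y) t) integrable_on {0..len N j}"
    if "network_heat N Tmax \<sigma> u A1 A2" "network_heat N Tmax \<tau> w B1 B2" "j \<in> edges N" for \<sigma> \<tau> u w A1 A2 B1 B2 j
  proof -
    have c: "continuous_on {0..len N j} (\<lambda>y. f (param N j y) t)"
      if "network_heat N Tmax \<rho> f F1 F2" for \<rho> f F1 F2
      using continuous_on_compose2[OF network_heat_edge_continuous[OF that \<open>j \<in> edges N\<close>], of "{0..len N j}" "\<lambda>y. (y, t)"] t
      by (force intro!: continuous_intros)
    show ?thesis by (intro integrable_continuous_real continuous_on_mult c[OF that(1)] c[OF that(2)])
  qed
  have "\<bar>exit_mass N v0 e0 c \<psi> t - exit_mass N v0 e0 c' \<psi>' t\<bar> =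
      \<bar>\<Sum>j\<in>edges N. integral {0..len N j} (\<lambda>y. \<phi> (param N j y) t * \<psi> (param N j y) t)
        - integral {0..len N j} (\<lambda>y. \<phi>' (param N j y) t * \<psi>' (param N j y) t)\<bar>"
    unfolding exit_mass_eq[OF sol t] exit_mass_eq[OF sol' t] by (simp add: network_integral_def sum_subtractf)
  also have "\<dots> \<le> (\<Sum>j\<in>edges N. ?K * len N j)"
  proof (rule order_trans[OF sum_abs sum_mono])
    fix j assume j: "j \<in> edges N"
    have "\<bar>integral {0..len N j} (\<lambda>y. \<phi> (param N j y) t * \<psi> (param N j y) t) - integral {0..len N j} (\<lambda>y. \<phi>' (param N j y) t * \<psi>' (param N j y) t)\<bar>
       = norm (integral {0..len N j} (\<lambda>y. \<phi> (param N j y) t * \<psi> (param N j y) t - \<phi>' (param N j y) t * \<psi>' (param N j y) t))"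
      unfolding Henstock_Kurzweil_Integration.integral_diff[OF int[OF h j] int[OF h' j]] real_norm_def ..
    also have "\<dots> \<le> integral {0..len N j} (\<lambda>y. ?K)"
    proof (rule integral_norm_bound_integral)
      show "(\<lambda>y. \<phi> (param N j y) t * \<psi> (param N j y) t - \<phi>' (param N j y) t * \<psi>' (param N j y) t) integrable_on {0..len N j}"
        by (rule integrable_diff[OF int[OF h j] int[OF h' j]])
      show "norm (\<phi> (param N j y) t * \<psi> (param N j y) t - \<phi>' (param N j y) t * \<psi>' (param N j y) t) \<le> ?K"
        if "y \<in> {0..len N j}" for y
        using prod[OF param_in_points[OF j that]] by simp
    qed (rule integrable_const_ivl)
    also have "\<dots> = ?K * len N j" using len_pos[OF j] by simp
    finally show "\<bar>integral {0..len N j} (\<lambda>y. \<phi> (param N j y) t * \<psi> (param N j y) t) - integral {0..len N j} (\<lambda>y. \<phi>' (param N j y) t * \<psi>' (param N j y) t)\<bar> \<le> ?K * len N j" .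
  qed
  finally show ?thesis by (simp add: sum_distrib_left)
qed

end

section \<open>The fixed point\<close>

lemma quorum_early:
  assumes "0 \<le> t0" "t0 \<le> Tmax" "\<theta> \<le> F t0"
  shows "quorum t0 Tmax \<theta> F = t0"
proof -
  have "gen_inverse Tmax F \<theta> \<le> ereal t0"
    unfolding gen_inverse_def by (rule Inf_lower) (use assms in auto)
  then show ?thesis by (simp add: quorum_def)
qed

lemma quorum_late:
  assumes "t0 < Tmax" "\<And>s. s \<in> {0..Tmax} \<Longrightarrow> F s < \<theta>"
  shows "quorum t0 Tmax \<theta> F = Tmax"
proof -
  have "{s \<in> {0..Tmax}. F s \<ge> \<theta>} = {}" using assms(2) by force
  then have "gen_inverse Tmax F \<theta> = \<infinity>" unfolding gen_inverse_def by (simp only: image_empty Inf_empty top_ereal_def)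
  then show ?thesis by (simp add: quorum_def)
qed

lemma quorum_first_hit:
  assumes "0 \<le> t0" "T \<in> {t0<..Tmax}" "F T = \<theta>" "\<And>s. s \<in> {0..<T} \<Longrightarrow> F s < \<theta>"
  shows "quorum t0 Tmax \<theta> F = T"
proof -
  have "gen_inverse Tmax F \<theta> = ereal T"
    unfolding gen_inverse_def
  proof (rule antisym)
    show "Inf (ereal ` {s \<in> {0..Tmax}. F s \<ge> \<theta>}) \<le> ereal T"
      by (rule Inf_lower) (use assms(1-3) in auto)
    show "ereal T \<le> Inf (ereal ` {s \<in> {0..Tmax}. F s \<ge> \<theta>})"
    proof (rule Inf_greatest)
      fix x assume "x \<in> ereal ` {s \<in> {0..Tmax}. F s \<ge> \<theta>}"
      then obtain s where s: "x = ereal s" "s \<in> {0..Tmax}" "F s \<ge> \<theta>" by blast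
      then have "\<not> s < T" using assms(4)[of s] by auto
      then show "ereal T \<le> x" using s by simp
    qed
  qed
  then show ?thesis using assms(2) by (auto simp: quorum_def)
qed

text \<open>
  In the case of the intermediate value theorem any \<open>T\<close> with
  \<open>F T T = \<theta>\<close> will do, because \<open>F T\<close> cannot have reached the positive value \<open>\<theta>\<close> earlier and stayed there.
\<close>

lemma quorum_fixed_point:
  fixes F :: "real \<Rightarrow> real \<Rightarrow> real"
  assumes t: "0 < t0" "t0 < Tmax" and \<theta>: "0 < \<theta>"
    and diag: "continuous_on {t0..Tmax} (\<lambda>T. F T T)"
    and mono: "\<And>T s s'. T \<in> {t0..Tmax} \<Longrightarrow> 0 \<le> s \<Longrightarrow> s \<le> s' \<Longrightarrow> s' \<le> Tmax \<Longrightarrow> F T s \<le> F T s'"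
    and strict: "\<And>T s s'. T \<in> {t0..Tmax} \<Longrightarrow> 0 \<le> s \<Longrightarrow> s < s' \<Longrightarrow> s' \<le> Tmax \<Longrightarrow> F T s = F T s' \<Longrightarrow> F T s = 0"
  shows "\<exists>T\<in>{t0..Tmax}. quorum t0 Tmax \<theta> (F T) = T"
proof -
  consider "\<theta> \<le> F t0 t0" | "F Tmax Tmax < \<theta>" | "F t0 t0 < \<theta>" "\<theta> \<le> F Tmax Tmax" by linarith
  then show ?thesis
  proof cases
    case 1
    then have "quorum t0 Tmax \<theta> (F t0) = t0" using t by (intro quorum_early) auto
    then show ?thesis using t by auto
  next
    case 2
    have "quorum t0 Tmax \<theta> (F Tmax) = Tmax"
    proof (rule quorum_late[OF t(2)])
      fix s assume "s \<in> {0..Tmax}"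
      then show "F Tmax s < \<theta>" using mono[of Tmax s Tmax] 2 t by auto
    qed
    then show ?thesis using t by auto
  next
    case 3
    then obtain T where T: "t0 \<le> T" "T \<le> Tmax" "F T T = \<theta>"
      using IVT'[of "\<lambda>T. F T T" t0 \<theta> Tmax] diag t by auto
    have "T \<noteq> t0" using 3(1) T(3) by auto
    then have T0: "T \<in> {t0<..Tmax}" using T by auto
    have "quorum t0 Tmax \<theta> (F T) = T"
    proof (rule quorum_first_hit[of t0 T Tmax "F T", OF _ T0 T(3)])
      fix s assume s: "s \<in> {0..<T}"
      then have "F T s \<le> \<theta>" using mono[of T s T] T by auto
      moreover have "F T s \<noteq> \<theta>" using strict[of T s T] s T \<theta> by auto
      ultimately show "F T s < \<theta>" by simp
    qed (use t in simp)
    then show ?thesis using T by auto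
  qed
qed

theorem theorem4p2:
  fixes N :: "('a::euclidean_space, 'j) network"
    and v0 :: 'a and e0 :: 'j
    and t0 Tmax \<theta> \<alpha> :: real
    and c1 c2 c3 :: "real \<Rightarrow> real"
    and m0 :: "'a \<Rightarrow> real"
  assumes network: "is_network N"
    and boundary: "boundary_verts N = {v0}"
    and e0: "Inc N v0 = {e0}" "param N e0 0 = v0"
    and times: "0 < t0" "t0 < Tmax"
    and theta: "0 < \<theta>" "\<theta> < 1"
    and density: "\<forall>x\<in>points N. m0 x \<ge> 0" "network_integral N m0 = 1"
    and cost_smooth: "smooth_on UNIV c1" "smooth_on UNIV c2" "smooth_on UNIV c3"
    and cost_zero: "\<forall>s\<le>0. c1 s = 0 \<and> c2 s = 0 \<and> c3 s = 0"
    and cost_pos: "\<forall>s>0. c1 s > 0 \<and> c2 s > 0 \<and> c3 s > 0"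
    and alpha: "0 < \<alpha>" "\<alpha> < 1"
    and cost_hoelder:
      "\<forall>T\<in>{0..Tmax}. hoelder_on 1 (\<alpha>/2) 0 Tmax (cost c1 c2 c3 t0 T)"
    and cost_nonneg:
      "\<forall>T\<in>{0..Tmax}. \<forall>s\<in>{0..Tmax}. cost c1 c2 c3 t0 T s \<ge> 0"
    and cost_continuous:
      "\<forall>T\<in>{0..Tmax}.
         ((\<lambda>S. hoelder_norm 1 (\<alpha>/2) 0 Tmax (\<lambda>s. cost c1 c2 c3 t0 S s - cost c1 c2 c3 t0 T s))
            \<longlongrightarrow> 0) (at T within {0..Tmax})"
    and m0_hoelder: "hoelder_network 2 \<alpha> N m0"
    and m0_zero: "m0 v0 = 0"
    and m0_compat: "vertex_deriv N e0 1 m0 v0 = 0" "vertex_deriv N e0 2 m0 v0 = 0"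
  shows "\<exists>T\<in>{t0..Tmax}. Psi N v0 e0 t0 Tmax \<theta> c1 c2 c3 m0 T = T"
proof -
  interpret exit_network N v0 e0
    by (rule exit_network.intro) (rule network boundary e0)+
  define c where "c T = cost c1 c2 c3 t0 T" for T
  define sol where "sol T = (SOME p. classical_solution N v0 Tmax (c T) m0 (fst p) (snd p))" for T
  define F where "F T = exit_mass N v0 e0 (c T) (snd (sol T))" for T
  have Psi_eq: "Psi N v0 e0 t0 Tmax \<theta> c1 c2 c3 m0 T = quorum t0 Tmax \<theta> (F T)" for T
    by (simp add: Psi_def F_def sol_def c_def Let_def)
  have Tmax: "0 < Tmax" using times by simp
  have cm0: "continuous_on (points N) m0" using m0_hoelder by (simp add: hoelder_network_def)
  have m0_nonneg: "\<And>x. x \<in> points N \<Longrightarrow> 0 \<le> m0 x" using density(1) by blast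
  have c_nonneg: "0 \<le> c T s" if "T \<in> {0..Tmax}" "s \<in> {0..Tmax}" for T s
    using cost_nonneg that by (simp add: c_def)

  \<comment> \<open>The derivatives of the cost in its argument \<open>s\<close>.\<close>
  define d where "d k T s = nderiv UNIV k c1 (s - t0) + nderiv UNIV k c2 (s - T) + (- 1) ^ k * nderiv UNIV k c3 (T - s)" for k T s
  have d_deriv: "(d k T has_real_derivative d (Suc k) T s) (at s)" for k T s
  proof -
    have s1: "((\<lambda>s. s - a) has_real_derivative 1) (at s)" and s2: "((\<lambda>s. a - s) has_real_derivative - 1) (at s)" for a
      by (auto intro!: derivative_eq_intros)
    show ?thesis
      unfolding d_def[abs_def]
      by (rule DERIV_cong[OF DERIV_add[OF DERIV_add[OF
            DERIV_chain2[OF smooth_on_UNIV_derivs[OF cost_smooth(1)] s1]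
            DERIV_chain2[OF smooth_on_UNIV_derivs[OF cost_smooth(2)] s1]]
            DERIV_cmult[OF DERIV_chain2[OF smooth_on_UNIV_derivs[OF cost_smooth(3)] s2]]]]) simp
  qed
  have d0: "d 0 T = c T" for T by (simp add: d_def[abs_def] c_def cost_def[abs_def])
  have sol: "classical_solution N v0 Tmax (c T) m0 (fst (sol T)) (snd (sol T))" if T: "T \<in> {0..Tmax}" for T
  proof -
    have "\<exists>\<phi> \<psi>. classical_solution N v0 Tmax (c T) m0 \<phi> \<psi>"
    proof (rule classical_solution_exists[OF Tmax])
      show "(c T has_real_derivative d 1 T s) (at s)" for s using d_deriv[of 0 T s] by (simp add: d0)
      show "(d 1 T has_real_derivative d 2 T s) (at s)" for s using d_deriv[of 1 T s] by (simp add: numeral_2_eq_2)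
      show "(d 2 T has_real_derivative d 3 T s) (at s)" for s using d_deriv[of 2 T s] by (simp add: numeral_3_eq_3 numeral_2_eq_2)
      show "continuous_on UNIV (d 3 T)" by (rule DERIV_continuous_on[OF d_deriv])
    qed (use c_nonneg T cm0 m0_zero in auto)
    then have "\<exists>p. classical_solution N v0 Tmax (c T) m0 (fst p) (snd p)" by auto
    then show ?thesis unfolding sol_def by (rule someI_ex)
  qed
  note F_props = exit_mass_properties[OF sol Tmax c_nonneg m0_nonneg cm0 m0_zero, folded F_def]

  have "continuous_on {t0..Tmax} (\<lambda>T. F T T)"
  proof -
    let ?P = "{0..Tmax} \<times> {0..Tmax}"
    let ?e = "\<lambda>p. exp (c (fst p) (snd p))"
    have cc: "continuous_on UNIV c1" "continuous_on UNIV c2" "continuous_on UNIV c3"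
      using cost_smooth[THEN smooth_on_UNIV_derivs[where k=0]]
      by (auto intro!: continuous_at_imp_continuous_on DERIV_isCont)
    have ce: "continuous_on ?P ?e"
      unfolding c_def cost_def
      by (intro continuous_intros continuous_on_compose2[OF cc(1)] continuous_on_compose2[OF cc(2)] continuous_on_compose2[OF cc(3)]) auto
    have cP: "compact ?P" by (intro compact_Times) auto
    have "bounded (?e ` ?P)" by (rule compact_imp_bounded[OF compact_continuous_image[OF ce cP]])
    then obtain C where C: "\<And>p. p \<in> ?P \<Longrightarrow> norm (?e p) \<le> C"
      unfolding bounded_iff ball_simps by blast
    obtain B where B: "\<And>x. x \<in> points N \<Longrightarrow> norm (m0 x) \<le> B"
      using compact_imp_bounded[OF compact_continuous_image[OF cm0 compact_points]] unfolding bounded_iff by auto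
    have uc: "uniformly_continuous_on ?P ?e" by (rule compact_uniformly_continuous[OF ce cP])
    define K where "K = (1 + C) * B * (\<Sum>j\<in>edges N. len N j)"
    have K: "0 \<le> K"
      unfolding K_def
    proof (intro mult_nonneg_nonneg sum_nonneg)
      have "norm (?e (0, 0)) \<le> C" by (rule C) (use Tmax in auto)
      then have "0 \<le> C" by (rule order_trans[OF norm_ge_zero])
      then show "0 \<le> 1 + C" by simp
      show "0 \<le> B" using B[OF v0_points] norm_ge_zero order_trans by blast
      show "0 \<le> len N j" if "j \<in> edges N" for j using len_pos[OF that] by simp
    qed
    show ?thesis
      unfolding continuous_on_iff
    proof (intro ballI allI impI)
      fix T e :: real assume T: "T \<in> {t0..Tmax}" and e: "0 < e"
      have T': "T \<in> {0..Tmax}" using T times by auto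
      define e' where "e' = e / (2 * (K + 1))"
      have e': "0 < e'" using e K by (simp add: e'_def)
      have Ke: "K * e' < e / 2"
      proof -
        have "K * e' < (K + 1) * e'" using e' by simp
        also have "\<dots> = e / 2" using K by (simp add: e'_def field_simps)
        finally show ?thesis .
      qed
      obtain r1 where r1: "0 < r1" "\<And>S. S \<in> {0..Tmax} \<Longrightarrow> dist S T < r1 \<Longrightarrow> dist (F T S) (F T T) < e / 2"
        using F_props(1)[OF T'] T' e unfolding continuous_on_iff by (metis half_gt_zero)
      obtain r2 where r2: "0 < r2" "\<And>p p'. p \<in> ?P \<Longrightarrow> p' \<in> ?P \<Longrightarrow> dist p' p < r2 \<Longrightarrow> dist (?e p') (?e p) < e'"
        using uc e' unfolding uniformly_continuous_on_def by metis
      show "\<exists>r>0. \<forall>S\<in>{t0..Tmax}. dist S T < r \<longrightarrow> dist (F S S) (F T T) < e"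
      proof (intro exI conjI ballI impI)
        show "0 < min r1 r2" using r1(1) r2(1) by simp
        fix S assume S: "S \<in> {t0..Tmax}" and ST: "dist S T < min r1 r2"
        have S': "S \<in> {0..Tmax}" using S times by auto
        have "\<bar>F S S - F T S\<bar> \<le> (1 + C) * B * e' * (\<Sum>j\<in>edges N. len N j)"
          unfolding F_def
        proof (rule exit_mass_stability[OF sol[OF S'] sol[OF T'] Tmax S'])
          fix s assume s: "s \<in> {0..Tmax}"
          show "0 \<le> c S s" "0 \<le> c T s" using c_nonneg S' T' s by auto
          show "exp (c T s) \<le> C" using C[of "(T, s)"] T' s by simp
          have "dist (?e (S, s)) (?e (T, s)) < e'"
            by (rule r2(2)) (use S' T' s ST in \<open>auto simp: dist_Pair_Pair\<close>)
          then show "\<bar>exp (c S s) - exp (c T s)\<bar> \<le> e'" by (simp add: dist_real_def)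
        qed (use m0_nonneg B in \<open>force+\<close>)
        also have "\<dots> = K * e'" by (simp add: K_def)
        finally have "\<bar>F S S - F T S\<bar> < e / 2" using Ke by simp
        moreover have "\<bar>F T S - F T T\<bar> < e / 2" using r1(2)[OF S'] ST by (simp add: dist_real_def)
        ultimately show "dist (F S S) (F T T) < e"
          using abs_triangle_ineq[of "F S S - F T S" "F T S - F T T"] unfolding dist_real_def by linarith
      qed
    qed
  qed
  moreover have "F T s \<le> F T s'" if "T \<in> {t0..Tmax}" "0 \<le> s" "s \<le> s'" "s' \<le> Tmax" for T s s'
    using F_props(2)[of T s s'] that times by simp
  moreover have "F T s = 0" if "T \<in> {t0..Tmax}" "0 \<le> s" "s < s'" "s' \<le> Tmax" "F T s = F T s'" for T s s'
    using F_props(3)[of T s s'] that times by simp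
  ultimately have "\<exists>T\<in>{t0..Tmax}. quorum t0 Tmax \<theta> (F T) = T"
    by (intro quorum_fixed_point[OF times theta(1)]) blast+
  then show ?thesis unfolding Psi_eq .
qed

end
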